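(* Let $\mathscr G$ be an ample groupoid and $\mathcal O$ a $\mathscr G$-sheaf of fields. The following are equivalent: (1) $\Gamma_c(\mathscr G,\mathcal O)$ is simple; (2) $\Gamma_c(\mathscr G^{(0)},\mathcal O)$ is $\mathscr G^a$-simple and a maximal commutative subring of $\Gamma_c(\mathscr G,\mathcal O)$; (3) $\mathscr G$ is minimal, $\mathrm{Int}(\ker\mathcal O)=\mathscr G^{(0)}$ and $\Gamma_c(\mathrm{Int}(\ker\mathcal O),\mathcal O)=\{f\in\Gamma_c(\mathscr G,\mathcal O)\mid\mathrm{supp}(f)\subseteq\ker\mathcal O\}$. If, moreover, $\mathscr G$ is Hausdorff, then (1), (2) and (3) are also equivalent to: (4) $\mathscr G$ is minimal and $\mathrm{Int}(\ker\mathcal O)=\mathscr G^{(0)}$.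
   Context: "Compact" includes Hausdorff. A groupoid $\mathscr G$ (identified with its set of arrows) has unit space $\mathscr G^{(0)}$, $\boldsymbol d(\gamma)=\gamma^{-1}\gamma$, $\boldsymbol r(\gamma)=\gamma\gamma^{-1}$. It is ample if it is a topological groupoid such that $\mathscr G^{(0)}$ is locally compact Hausdorff with a basis of compact open sets and $\boldsymbol r$ is a local homeomorphism ($\mathscr G$ itself need not be Hausdorff). A bisection is a subset on which $\boldsymbol d$ and $\boldsymbol r$ are injective. $\mathrm{Iso}(\mathscr G)=\{g\in\mathscr G:\boldsymbol d(g)=\boldsymbol r(g)\}$. $\mathrm{Int}$ denotes topological interior in $\mathscr G$. A subset $D\subseteq\mathscr G^{(0)}$ is invariant if for all $\gamma\in\mathscr G$, $\boldsymbol d(\gamma)\in D$ iff $\boldsymbol r(\gamma)\in D$. $\mathscr G$ is minimal if the only open invariant subsets of $\mathscr G^{(0)}$ are $\emptyset$ and $\mathscr G^{(0)}$. A $\mathscr G$-sheaf $(E,p,\alpha)$ is a space $E$, a local homeomorphism $p:E\to\mathscr G^{(0)}$ and a continuous map $\alpha:\mathscr G\times_{\boldsymbol d,p}E\to E$, $(\gamma,e)\mapsto\alpha_\gamma(e)$, with $\alpha_{p(e)}(e)=e$, $p(\alpha_\gamma(e))=\boldsymbol r(\gamma)$, and $\alpha_\beta(\alpha_\gamma(e))=\alpha_{\beta\gamma}(e)$ whenever defined. The stalk at $x$ is $p^{-1}(x)$. A $\mathscr G$-sheaf of rings $\mathcal O=(E,p,\alpha)$ is a $\mathscr G$-sheaf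 with a unital ring structure on each stalk $\mathcal O_x$ such that fiberwise addition and multiplication $E\times_{p,p}E\to E$ and the unit section $x\mapsto 1_x$ are continuous, and each $\alpha_\gamma:\mathcal O_{\boldsymbol d(\gamma)}\to\mathcal O_{\boldsymbol r(\gamma)}$ is a (unital) ring homomorphism. It is a sheaf of fields if every stalk is a field. $\Gamma_c(\mathscr G,\mathcal O)$ is the additive group generated by all maps $f:\mathscr G\to E$ with $p\circ f=\boldsymbol r$ for which there is a compact open bisection $U$ with $f|_U$ continuous and $f=0$ off $U$. It is a ring under pointwise addition and convolution $(f*g)(\gamma)=\sum_{\beta\rho=\gamma}f(\beta)\alpha_\beta(g(\rho))$. $\mathrm{supp}(f)=\{\gamma:f(\gamma)\ne 0\}$. $\Gamma_c(\mathscr G^{(0)},\mathcal O)$ is the ring of compactly supported continuous sections $\mathscr G^{(0)}\to E$ of $p$ with pointwise operations, viewed as a subring of $\Gamma_c(\mathscr G,\mathcal O)$ by extending by zero. $\ker\mathcal O=\{\gamma\in\mathrm{Iso}(\mathscr G)\mid\alpha_\gamma(a)=a\ \text{for all } a\in\mathcal O_{\boldsymbol d(\gamma)}\}$. $\mathrm{Int}(\ker\mathcal O)$ is an ample subgroupoid, and $\Gamma_c(\mathrm{Int}(\ker\mathcal O),\mathcal O)$ is identified with the additive subgroup of $\Gamma_c(\mathscr G,\mathcal O)$ generated by all maps $f:\mathscr G\to E$ with $p\circ f=\boldsymbol r$ for which there is a compact open bisection $U\subseteq\mathrm{Int}(\ker\mathcal O)$ with $f|_U$ continuous and $f=0$ off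 $U$. $\mathscr G^a$ is the inverse semigroup of compact open bisections of $\mathscr G$ (setwise product and inverse). It acts on $\Gamma_c(\mathscr G^{(0)},\mathcal O)$: for $s\in\mathscr G^a$, $D_s$ is the ideal of sections supported on $\boldsymbol r(s)$ and $\tilde\alpha_s:D_{s^{*}}\to D_s$ (where $s^*=s^{-1}$) is given by $\tilde\alpha_s(f)(\boldsymbol r(\gamma))=\alpha_\gamma(f(\boldsymbol d(\gamma)))$ for $\gamma\in s$. An ideal $I$ of $\Gamma_c(\mathscr G^{(0)},\mathcal O)$ is $\mathscr G^a$-invariant if $\tilde\alpha_s(D_{s^*}\cap I)\subseteq I$ for all $s\in\mathscr G^a$; $\Gamma_c(\mathscr G^{(0)},\mathcal O)$ is $\mathscr G^a$-simple if its only $\mathscr G^a$-invariant ideals are $\{0\}$ and itself. A ring is simple if its only two-sided ideals are $\{0\}$ and itself. *)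

theory Defs
  imports "HOL-Analysis.Analysis" "HOL-Algebra.Generated_Groups" "HOL-Algebra.Subrings"
begin

section \<open>Rings without unit, ideals, subrings\<close>

text \<open>
  The rings of sections below have local units but in general no unit, so the library locales
  \<^locale>\<open>ring\<close>, \<^locale>\<open>ideal\<close> and \<^const>\<open>subring\<close> do not apply to them.
  The following notions ignore the \<open>one\<close> field of the ring record.
\<close>

definition rng_ideal :: "'a set \<Rightarrow> ('a, 'm) ring_scheme \<Rightarrow> bool" where
  "rng_ideal I R \<longleftrightarrow> additive_subgroup I R \<and>
     (\<forall>a \<in> carrier R. \<forall>x \<in> I. a \<otimes>\<^bsub>R\<^esub> x \<in> I \<and> x \<otimes>\<^bsub>R\<^esub> a \<in> I)"

definition rng_simple :: "('a, 'm) ring_scheme \<Rightarrow> bool" where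
  "rng_simple R \<longleftrightarrow> (\<forall>I. rng_ideal I R \<longrightarrow> I = {\<zero>\<^bsub>R\<^esub>} \<or> I = carrier R)"

definition commutative_subrng :: "'a set \<Rightarrow> ('a, 'm) ring_scheme \<Rightarrow> bool" where
  "commutative_subrng S R \<longleftrightarrow> additive_subgroup S R \<and>
     (\<forall>x \<in> S. \<forall>y \<in> S. x \<otimes>\<^bsub>R\<^esub> y \<in> S \<and> x \<otimes>\<^bsub>R\<^esub> y = y \<otimes>\<^bsub>R\<^esub> x)"

definition maximal_commutative_subrng :: "'a set \<Rightarrow> ('a, 'm) ring_scheme \<Rightarrow> bool" where
  "maximal_commutative_subrng S R \<longleftrightarrow> commutative_subrng S R \<and>
     (\<forall>T. commutative_subrng T R \<and> S \<subseteq> T \<longrightarrow> T = S)"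


section \<open>Topological preliminaries\<close>

definition compact_Hausdorff_in :: "'a topology \<Rightarrow> 'a set \<Rightarrow> bool" where
  "compact_Hausdorff_in X K \<longleftrightarrow> compactin X K \<and> Hausdorff_space (subtopology X K)"

definition local_homeomorphism :: "'a topology \<Rightarrow> 'b topology \<Rightarrow> ('a \<Rightarrow> 'b) \<Rightarrow> bool" where
  "local_homeomorphism X Y f \<longleftrightarrow>
     (\<forall>x \<in> topspace X. \<exists>U. openin X U \<and> x \<in> U \<and> openin Y (f ` U) \<and>
        homeomorphic_map (subtopology X U) (subtopology Y (f ` U)) f)"


section \<open>Ample groupoids\<close>

text \<open>
  The points of \<open>gtop\<close> are the arrows; \<open>gmul \<beta> \<gamma>\<close> is only meaningful when
  \<open>src G \<beta> = tgt G \<gamma>\<close>.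
\<close>

record 'g top_groupoid =
  gtop :: "'g topology"
  gmul :: "'g \<Rightarrow> 'g \<Rightarrow> 'g"
  ginv :: "'g \<Rightarrow> 'g"

definition arrows :: "'g top_groupoid \<Rightarrow> 'g set" where
  "arrows G = topspace (gtop G)"

definition src :: "'g top_groupoid \<Rightarrow> 'g \<Rightarrow> 'g" where
  "src G \<gamma> = gmul G (ginv G \<gamma>) \<gamma>"

definition tgt :: "'g top_groupoid \<Rightarrow> 'g \<Rightarrow> 'g" where
  "tgt G \<gamma> = gmul G \<gamma> (ginv G \<gamma>)"

definition units :: "'g top_groupoid \<Rightarrow> 'g set" where
  "units G = src G ` arrows G"

definition unit_space :: "'g top_groupoid \<Rightarrow> 'g topology" where
  "unit_space G = subtopology (gtop G) (units G)"

definition composable :: "'g top_groupoid \<Rightarrow> ('g \<times> 'g) set" where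
  "composable G = {(\<beta>, \<gamma>). \<beta> \<in> arrows G \<and> \<gamma> \<in> arrows G \<and> src G \<beta> = tgt G \<gamma>}"

locale groupoid =
  fixes G :: "'g top_groupoid"
  assumes ginv_closed: "\<gamma> \<in> arrows G \<Longrightarrow> ginv G \<gamma> \<in> arrows G"
    and ginv_ginv: "\<gamma> \<in> arrows G \<Longrightarrow> ginv G (ginv G \<gamma>) = \<gamma>"
    and gmul_closed: "(\<beta>, \<gamma>) \<in> composable G \<Longrightarrow> gmul G \<beta> \<gamma> \<in> arrows G"
    and src_gmul: "(\<beta>, \<gamma>) \<in> composable G \<Longrightarrow> src G (gmul G \<beta> \<gamma>) = src G \<gamma>"
    and tgt_gmul: "(\<beta>, \<gamma>) \<in> composable G \<Longrightarrow> tgt G (gmul G \<beta> \<gamma>) = tgt G \<beta>"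
    and gmul_assoc: "(\<beta>, \<gamma>) \<in> composable G \<Longrightarrow> (\<gamma>, \<delta>) \<in> composable G \<Longrightarrow>
          gmul G (gmul G \<beta> \<gamma>) \<delta> = gmul G \<beta> (gmul G \<gamma> \<delta>)"
    and gmul_src: "\<gamma> \<in> arrows G \<Longrightarrow> gmul G \<gamma> (src G \<gamma>) = \<gamma>"
    and gmul_tgt: "\<gamma> \<in> arrows G \<Longrightarrow> gmul G (tgt G \<gamma>) \<gamma> = \<gamma>"

locale topological_groupoid = groupoid +
  assumes continuous_gmul:
      "continuous_map (subtopology (prod_topology (gtop G) (gtop G)) (composable G)) (gtop G)
         (\<lambda>(\<beta>, \<gamma>). gmul G \<beta> \<gamma>)"
    and continuous_ginv: "continuous_map (gtop G) (gtop G) (ginv G)"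

locale ample_groupoid = topological_groupoid +
  assumes Hausdorff_units: "Hausdorff_space (unit_space G)"
    and locally_compact_units: "locally_compact_space (unit_space G)"
    and compact_open_basis: "openin (unit_space G) U \<Longrightarrow> x \<in> U \<Longrightarrow>
          \<exists>K. openin (unit_space G) K \<and> compact_Hausdorff_in (unit_space G) K \<and> x \<in> K \<and> K \<subseteq> U"
    and local_homeomorphism_tgt: "local_homeomorphism (gtop G) (unit_space G) (tgt G)"

definition bisection :: "'g top_groupoid \<Rightarrow> 'g set \<Rightarrow> bool" where
  "bisection G U \<longleftrightarrow> U \<subseteq> arrows G \<and> inj_on (src G) U \<and> inj_on (tgt G) U"

definition compact_open_bisections :: "'g top_groupoid \<Rightarrow> 'g set set" where
  "compact_open_bisections G =
     {U. bisection G U \<and> openin (gtop G) U \<and> compact_Hausdorff_in (gtop G) U}"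

definition Iso :: "'g top_groupoid \<Rightarrow> 'g set" where
  "Iso G = {\<gamma> \<in> arrows G. src G \<gamma> = tgt G \<gamma>}"

definition invariant :: "'g top_groupoid \<Rightarrow> 'g set \<Rightarrow> bool" where
  "invariant G D \<longleftrightarrow> D \<subseteq> units G \<and> (\<forall>\<gamma> \<in> arrows G. src G \<gamma> \<in> D \<longleftrightarrow> tgt G \<gamma> \<in> D)"

definition minimal :: "'g top_groupoid \<Rightarrow> bool" where
  "minimal G \<longleftrightarrow> (\<forall>D. openin (unit_space G) D \<and> invariant G D \<longrightarrow> D = {} \<or> D = units G)"


section \<open>Sheaves of rings and fields\<close>

text \<open>
  The stalks are disjoint subsets of the total space, so the ring operations of all stalks are
  given by single binary operations \<open>eadd\<close> and \<open>emul\<close>, relevant only on pairs in a common stalk.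
\<close>

record ('g, 'e) ring_sheaf =
  etop :: "'e topology"
  proj :: "'e \<Rightarrow> 'g"
  act :: "'g \<Rightarrow> 'e \<Rightarrow> 'e"
  eadd :: "'e \<Rightarrow> 'e \<Rightarrow> 'e"
  emul :: "'e \<Rightarrow> 'e \<Rightarrow> 'e"
  ezero :: "'g \<Rightarrow> 'e"
  eone :: "'g \<Rightarrow> 'e"

definition stalk :: "('g, 'e) ring_sheaf \<Rightarrow> 'g \<Rightarrow> 'e ring" where
  "stalk \<O> x = \<lparr>carrier = {e \<in> topspace (etop \<O>). proj \<O> e = x},
     mult = emul \<O>, one = eone \<O> x, zero = ezero \<O> x, add = eadd \<O>\<rparr>"

definition act_domain :: "'g top_groupoid \<Rightarrow> ('g, 'e) ring_sheaf \<Rightarrow> ('g \<times> 'e) set" where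
  "act_domain G \<O> = {(\<gamma>, e). \<gamma> \<in> arrows G \<and> e \<in> topspace (etop \<O>) \<and> src G \<gamma> = proj \<O> e}"

definition fibre_square :: "('g, 'e) ring_sheaf \<Rightarrow> ('e \<times> 'e) set" where
  "fibre_square \<O> =
     {(a, b). a \<in> topspace (etop \<O>) \<and> b \<in> topspace (etop \<O>) \<and> proj \<O> a = proj \<O> b}"

locale groupoid_sheaf =
  fixes G :: "'g top_groupoid" and \<O> :: "('g, 'e) ring_sheaf"
  assumes local_homeomorphism_proj: "local_homeomorphism (etop \<O>) (unit_space G) (proj \<O>)"
    and continuous_act:
      "continuous_map (subtopology (prod_topology (gtop G) (etop \<O>)) (act_domain G \<O>)) (etop \<O>)
         (\<lambda>(\<gamma>, e). act \<O> \<gamma> e)"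
    and act_unit: "e \<in> topspace (etop \<O>) \<Longrightarrow> act \<O> (proj \<O> e) e = e"
    and proj_act: "(\<gamma>, e) \<in> act_domain G \<O> \<Longrightarrow> proj \<O> (act \<O> \<gamma> e) = tgt G \<gamma>"
    and act_act: "(\<gamma>, e) \<in> act_domain G \<O> \<Longrightarrow> (\<beta>, \<gamma>) \<in> composable G \<Longrightarrow>
          act \<O> \<beta> (act \<O> \<gamma> e) = act \<O> (gmul G \<beta> \<gamma>) e"

locale sheaf_of_rings = groupoid_sheaf +
  assumes ring_stalk: "x \<in> units G \<Longrightarrow> ring (stalk \<O> x)"
    and continuous_eadd:
      "continuous_map (subtopology (prod_topology (etop \<O>) (etop \<O>)) (fibre_square \<O>)) (etop \<O>)
         (\<lambda>(a, b). eadd \<O> a b)"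
    and continuous_emul:
      "continuous_map (subtopology (prod_topology (etop \<O>) (etop \<O>)) (fibre_square \<O>)) (etop \<O>)
         (\<lambda>(a, b). emul \<O> a b)"
    and continuous_eone: "continuous_map (unit_space G) (etop \<O>) (eone \<O>)"
    and act_ring_hom: "\<gamma> \<in> arrows G \<Longrightarrow>
          act \<O> \<gamma> \<in> ring_hom (stalk \<O> (src G \<gamma>)) (stalk \<O> (tgt G \<gamma>))"

locale sheaf_of_fields = sheaf_of_rings +
  assumes field_stalk: "x \<in> units G \<Longrightarrow> field (stalk \<O> x)"

definition sheaf_ker :: "'g top_groupoid \<Rightarrow> ('g, 'e) ring_sheaf \<Rightarrow> 'g set" where
  "sheaf_ker G \<O> = {\<gamma> \<in> Iso G. \<forall>a \<in> carrier (stalk \<O> (src G \<gamma>)). act \<O> \<gamma> a = a}"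


section \<open>The convolution ring\<close>

text \<open>
  Maps defined on a subset of a type are represented by total functions that are
  \<^const>\<open>undefined\<close> off that subset.
\<close>

definition supp :: "'g top_groupoid \<Rightarrow> ('g, 'e) ring_sheaf \<Rightarrow> ('g \<Rightarrow> 'e) \<Rightarrow> 'g set" where
  "supp G \<O> f = {\<gamma> \<in> arrows G. f \<gamma> \<noteq> ezero \<O> (tgt G \<gamma>)}"

text \<open>
  The sum defining \<open>f * g\<close> at \<open>\<gamma>\<close> runs over the factorisations of \<open>\<gamma>\<close> with nonzero summand;
  \<^const>\<open>finsum\<close> returns zero over an infinite index set, a case that does not occur for
  \<open>f\<close> and \<open>g\<close> in the convolution ring.
\<close>

definition convolution ::
  "'g top_groupoid \<Rightarrow> ('g, 'e) ring_sheaf \<Rightarrow> ('g \<Rightarrow> 'e) \<Rightarrow> ('g \<Rightarrow> 'e) \<Rightarrow> 'g \<Rightarrow> 'e" where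
  "convolution G \<O> f g = (\<lambda>\<gamma> \<in> arrows G.
     finsum (stalk \<O> (tgt G \<gamma>)) (\<lambda>(\<beta>, \<rho>). emul \<O> (f \<beta>) (act \<O> \<beta> (g \<rho>)))
       {(\<beta>, \<rho>) \<in> composable G. gmul G \<beta> \<rho> = \<gamma> \<and>
          emul \<O> (f \<beta>) (act \<O> \<beta> (g \<rho>)) \<noteq> ezero \<O> (tgt G \<gamma>)})"

definition extend_by_zero ::
  "'g top_groupoid \<Rightarrow> ('g, 'e) ring_sheaf \<Rightarrow> ('g \<Rightarrow> 'e) \<Rightarrow> 'g \<Rightarrow> 'e" where
  "extend_by_zero G \<O> f = (\<lambda>\<gamma> \<in> arrows G. if \<gamma> \<in> units G then f \<gamma> else ezero \<O> (tgt G \<gamma>))"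

text \<open>
  All maps \<open>f\<close> from the arrows to the total space with \<open>p \<circ> f = r\<close>. This is an additive group;
  its multiplication is meaningful only on \<open>Gamma_c\<close> below. The \<open>one\<close> field belongs to
  \<open>Gamma_c\<close> just when the unit space is compact.
\<close>

definition all_sections :: "'g top_groupoid \<Rightarrow> ('g, 'e) ring_sheaf \<Rightarrow> ('g \<Rightarrow> 'e) ring" where
  "all_sections G \<O> =
     \<lparr>carrier = (\<Pi>\<^sub>E \<gamma> \<in> arrows G. carrier (stalk \<O> (tgt G \<gamma>))),
      mult = convolution G \<O>,
      one = extend_by_zero G \<O> (eone \<O>),
      zero = (\<lambda>\<gamma> \<in> arrows G. ezero \<O> (tgt G \<gamma>)),
      add = (\<lambda>f g. \<lambda>\<gamma> \<in> arrows G. eadd \<O> (f \<gamma>) (g \<gamma>))\<rparr>"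

definition bisection_sections ::
  "'g top_groupoid \<Rightarrow> ('g, 'e) ring_sheaf \<Rightarrow> 'g set \<Rightarrow> ('g \<Rightarrow> 'e) set" where
  "bisection_sections G \<O> W = {f \<in> carrier (all_sections G \<O>).
     \<exists>U \<in> compact_open_bisections G. U \<subseteq> W \<and>
        continuous_map (subtopology (gtop G) U) (etop \<O>) f \<and>
        (\<forall>\<gamma> \<in> arrows G - U. f \<gamma> = ezero \<O> (tgt G \<gamma>))}"

text \<open>
  For an open subgroupoid \<open>W\<close> of \<open>G\<close>, this is the convolution ring of \<open>W\<close> inside that of \<open>G\<close>.
\<close>

definition Gamma_c_on ::
  "'g top_groupoid \<Rightarrow> ('g, 'e) ring_sheaf \<Rightarrow> 'g set \<Rightarrow> ('g \<Rightarrow> 'e) set" where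
  "Gamma_c_on G \<O> W = generate (add_monoid (all_sections G \<O>)) (bisection_sections G \<O> W)"

definition Gamma_c :: "'g top_groupoid \<Rightarrow> ('g, 'e) ring_sheaf \<Rightarrow> ('g \<Rightarrow> 'e) ring" where
  "Gamma_c G \<O> = (all_sections G \<O>)\<lparr>carrier := Gamma_c_on G \<O> (arrows G)\<rparr>"


section \<open>The ring of sections over the unit space\<close>

definition unit_supp :: "'g top_groupoid \<Rightarrow> ('g, 'e) ring_sheaf \<Rightarrow> ('g \<Rightarrow> 'e) \<Rightarrow> 'g set" where
  "unit_supp G \<O> f = {x \<in> units G. f x \<noteq> ezero \<O> x}"

text \<open>
  No closure is needed in the compact support condition: the zero section of a sheaf of rings has
  open image, so the nonvanishing set of a continuous section is closed in the unit space.
\<close>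

definition Gamma_c_units :: "'g top_groupoid \<Rightarrow> ('g, 'e) ring_sheaf \<Rightarrow> ('g \<Rightarrow> 'e) ring" where
  "Gamma_c_units G \<O> =
     \<lparr>carrier = {f \<in> (\<Pi>\<^sub>E x \<in> units G. carrier (stalk \<O> x)).
        continuous_map (unit_space G) (etop \<O>) f \<and>
        compact_Hausdorff_in (unit_space G) (unit_supp G \<O> f)},
      mult = (\<lambda>f g. \<lambda>x \<in> units G. emul \<O> (f x) (g x)),
      one = (\<lambda>x \<in> units G. eone \<O> x),
      zero = (\<lambda>x \<in> units G. ezero \<O> x),
      add = (\<lambda>f g. \<lambda>x \<in> units G. eadd \<O> (f x) (g x))\<rparr>"

definition bisection_ideal ::
  "'g top_groupoid \<Rightarrow> ('g, 'e) ring_sheaf \<Rightarrow> 'g set \<Rightarrow> ('g \<Rightarrow> 'e) set" where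
  "bisection_ideal G \<O> s = {f \<in> carrier (Gamma_c_units G \<O>). unit_supp G \<O> f \<subseteq> tgt G ` s}"

definition bisection_act ::
  "'g top_groupoid \<Rightarrow> ('g, 'e) ring_sheaf \<Rightarrow> 'g set \<Rightarrow> ('g \<Rightarrow> 'e) \<Rightarrow> 'g \<Rightarrow> 'e" where
  "bisection_act G \<O> s f = (\<lambda>x \<in> units G.
     if x \<in> tgt G ` s
     then let \<gamma> = the_inv_into s (tgt G) x in act \<O> \<gamma> (f (src G \<gamma>))
     else ezero \<O> x)"

definition invariant_ideal ::
  "'g top_groupoid \<Rightarrow> ('g, 'e) ring_sheaf \<Rightarrow> ('g \<Rightarrow> 'e) set \<Rightarrow> bool" where
  "invariant_ideal G \<O> I \<longleftrightarrow> rng_ideal I (Gamma_c_units G \<O>) \<and>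
     (\<forall>s \<in> compact_open_bisections G.
        bisection_act G \<O> s ` (bisection_ideal G \<O> (ginv G ` s) \<inter> I) \<subseteq> I)"

definition bisection_simple :: "'g top_groupoid \<Rightarrow> ('g, 'e) ring_sheaf \<Rightarrow> bool" where
  "bisection_simple G \<O> \<longleftrightarrow> (\<forall>I. invariant_ideal G \<O> I \<longrightarrow>
     I = {\<zero>\<^bsub>Gamma_c_units G \<O>\<^esub>} \<or> I = carrier (Gamma_c_units G \<O>))"

end

theory Submission
  imports Defs
begin

text \<open>
  Identify \<open>A = Gamma_c_units G \<O>\<close> with the diagonal subring \<open>diag\<close> of \<open>R = Gamma_c G \<O>\<close>.
  Because the stalks are fields, the elements of \<open>R\<close> commuting with \<open>A\<close> are those supported in
  \<open>sheaf_ker G \<O>\<close>; a double centralizer argument then shows that \<open>A\<close> is maximal commutative iff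
  every \<open>f \<in> R\<close> supported in \<open>sheaf_ker G \<O>\<close> is diagonal. A nonzero value of a section can be
  inverted nearby, so invariant ideals of \<open>A\<close> correspond to open invariant sets of units.

  If \<open>R\<close> is simple, consider its left module of sections over the unit space, a quotient of \<open>R\<close>
  by summation over the range fibres. Its annihilator is a proper ideal, hence zero, and it
  contains \<open>f - tot f\<close> for every \<open>f\<close> supported in \<open>sheaf_ker G \<O>\<close>; so such an \<open>f\<close> is diagonal.
  Conversely, a nonzero ideal contains a nonzero sum of fewest possible bisection sections, one of
  them diagonal; its commutators with \<open>A\<close> are shorter sums, so it commutes with \<open>A\<close> and is diagonal.
  In the Hausdorff case elements of \<open>R\<close> are continuous and so have open support.
\<close>

section \<open>Groupoid algebra\<close>

text \<open>The obstacle is that the arrows need not form a Hausdorff space. A section on a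
  bisection may jump at its boundary, so an element of \<open>R\<close> need not be continuous or
  have open support, and the interior of the kernel does not control the elements of
  \<open>R\<close> supported in the kernel. Hence the pivot \<open>ker_cond\<close> speaks of
  elements of \<open>R\<close>, not of arrows. Hausdorffness is at hand only on the unit space and
  on single bisections, so compactness arguments go through the range map. The module works because
  an arrow \<beta> of the kernel with range x has source x and fixes the stalk there: an
  \<open>f\<close> supported in the kernel acts at x as multiplication by the sum of its values over
  x, which is how \<open>tot f\<close> acts. The annihilator is proper because characteristic
  sections of compact open sets of units act nontrivially. The commutator in the converse is shorter
  because the diagonal summand drops out, the stalks being commutative, while multiplying a section
  on a bisection by a diagonal one, on either side, keeps its bisection.\<close>

context groupoid
begin

abbreviation mult_arrow (infixl \<open>\<cdot>\<close> 70) where "\<beta> \<cdot> \<gamma> \<equiv> gmul G \<beta> \<gamma>"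

lemma composable_iff: "(\<beta>, \<gamma>) \<in> composable G \<longleftrightarrow> \<beta> \<in> arrows G \<and> \<gamma> \<in> arrows G \<and> src G \<beta> = tgt G \<gamma>"
  by (simp add: composable_def)

lemma tgt_ginv [simp]: "\<gamma> \<in> arrows G \<Longrightarrow> tgt G (ginv G \<gamma>) = src G \<gamma>"
  by (simp add: tgt_def src_def ginv_ginv)

lemma src_ginv [simp]: "\<gamma> \<in> arrows G \<Longrightarrow> src G (ginv G \<gamma>) = tgt G \<gamma>"
  by (simp add: tgt_def src_def ginv_ginv)

declare ginv_closed [simp] ginv_ginv [simp]

lemma mult_closed [simp]:
  "\<beta> \<in> arrows G \<Longrightarrow> \<gamma> \<in> arrows G \<Longrightarrow> src G \<beta> = tgt G \<gamma> \<Longrightarrow> \<beta> \<cdot> \<gamma> \<in> arrows G"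
  by (simp add: composable_iff gmul_closed)

lemma src_mult [simp]:
  "\<beta> \<in> arrows G \<Longrightarrow> \<gamma> \<in> arrows G \<Longrightarrow> src G \<beta> = tgt G \<gamma> \<Longrightarrow> src G (\<beta> \<cdot> \<gamma>) = src G \<gamma>"
  by (simp add: composable_iff src_gmul)

lemma tgt_mult [simp]:
  "\<beta> \<in> arrows G \<Longrightarrow> \<gamma> \<in> arrows G \<Longrightarrow> src G \<beta> = tgt G \<gamma> \<Longrightarrow> tgt G (\<beta> \<cdot> \<gamma>) = tgt G \<beta>"
  by (simp add: composable_iff tgt_gmul)

lemma mult_assoc:
  "\<beta> \<in> arrows G \<Longrightarrow> \<gamma> \<in> arrows G \<Longrightarrow> \<delta> \<in> arrows G \<Longrightarrow> src G \<beta> = tgt G \<gamma> \<Longrightarrow> src G \<gamma> = tgt G \<delta> \<Longrightarrow>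
    \<beta> \<cdot> \<gamma> \<cdot> \<delta> = \<beta> \<cdot> (\<gamma> \<cdot> \<delta>)"
  by (simp add: composable_iff gmul_assoc)

lemma units_arrows: "x \<in> units G \<Longrightarrow> x \<in> arrows G"
  unfolding units_def
proof clarify
  fix \<gamma> assume "\<gamma> \<in> arrows G"
  then show "src G \<gamma> \<in> arrows G"
    using mult_closed [of "ginv G \<gamma>" \<gamma>] by (simp add: src_def [symmetric])
qed

lemma src_units [simp]: "\<gamma> \<in> arrows G \<Longrightarrow> src G \<gamma> \<in> units G"
  by (simp add: units_def)

lemma tgt_units [simp]: "\<gamma> \<in> arrows G \<Longrightarrow> tgt G \<gamma> \<in> units G"
  using src_units [of "ginv G \<gamma>"] by simp

lemma src_arrows [simp]: "\<gamma> \<in> arrows G \<Longrightarrow> src G \<gamma> \<in> arrows G"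
  by (simp add: units_arrows)

lemma tgt_arrows [simp]: "\<gamma> \<in> arrows G \<Longrightarrow> tgt G \<gamma> \<in> arrows G"
  by (simp add: units_arrows)

lemma src_unit [simp]: "x \<in> units G \<Longrightarrow> src G x = x"
  unfolding units_def
  using src_mult [of "ginv G \<gamma>" \<gamma> for \<gamma>] by (auto simp: src_def [symmetric])

lemma tgt_unit [simp]: "x \<in> units G \<Longrightarrow> tgt G x = x"
  unfolding units_def
  using tgt_mult [of "ginv G \<gamma>" \<gamma> for \<gamma>] by (auto simp: src_def [symmetric])

lemma mult_src [simp]: "\<gamma> \<in> arrows G \<Longrightarrow> \<gamma> \<cdot> src G \<gamma> = \<gamma>"
  by (rule gmul_src)

lemma tgt_mult_self [simp]: "\<gamma> \<in> arrows G \<Longrightarrow> tgt G \<gamma> \<cdot> \<gamma> = \<gamma>"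
  by (rule gmul_tgt)

lemma mult_ginv [simp]: "\<gamma> \<in> arrows G \<Longrightarrow> \<gamma> \<cdot> ginv G \<gamma> = tgt G \<gamma>"
  by (simp add: tgt_def)

lemma ginv_mult [simp]: "\<gamma> \<in> arrows G \<Longrightarrow> ginv G \<gamma> \<cdot> \<gamma> = src G \<gamma>"
  by (simp add: src_def)

lemma ginv_unit [simp]: "x \<in> units G \<Longrightarrow> ginv G x = x"
  by (metis ginv_closed ginv_mult mult_src src_ginv src_unit tgt_unit units_arrows)

lemma ginv_cancel [simp]:
  "\<beta> \<in> arrows G \<Longrightarrow> \<gamma> \<in> arrows G \<Longrightarrow> src G \<beta> = tgt G \<gamma> \<Longrightarrow> ginv G \<beta> \<cdot> (\<beta> \<cdot> \<gamma>) = \<gamma>"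
  by (simp flip: mult_assoc)

lemma ginv_cancel' [simp]:
  "\<beta> \<in> arrows G \<Longrightarrow> \<gamma> \<in> arrows G \<Longrightarrow> tgt G \<beta> = tgt G \<gamma> \<Longrightarrow> \<beta> \<cdot> (ginv G \<beta> \<cdot> \<gamma>) = \<gamma>"
  by (simp flip: mult_assoc)

lemma mult_left_cancel:
  assumes "\<beta> \<in> arrows G" "\<gamma> \<in> arrows G" "\<delta> \<in> arrows G" "src G \<beta> = tgt G \<gamma>" "src G \<beta> = tgt G \<delta>"
    "\<beta> \<cdot> \<gamma> = \<beta> \<cdot> \<delta>"
  shows "\<gamma> = \<delta>"
  by (metis assms ginv_cancel)

lemma bisectionD:
  assumes "bisection G U" "\<beta> \<in> U"
  shows "\<beta> \<in> arrows G"
    "\<gamma> \<in> U \<Longrightarrow> src G \<beta> = src G \<gamma> \<Longrightarrow> \<beta> = \<gamma>"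
    "\<gamma> \<in> U \<Longrightarrow> tgt G \<beta> = tgt G \<gamma> \<Longrightarrow> \<beta> = \<gamma>"
  using assms unfolding bisection_def inj_on_def by auto

definition bis_mult :: "'g set \<Rightarrow> 'g set \<Rightarrow> 'g set" where
  "bis_mult U V = {\<beta> \<cdot> \<gamma> | \<beta> \<gamma>. \<beta> \<in> U \<and> \<gamma> \<in> V \<and> src G \<beta> = tgt G \<gamma>}"

lemma bisection_bis_mult:
  assumes U: "bisection G U" and V: "bisection G V"
  shows "bisection G (bis_mult U V)"
proof -
  have "bis_mult U V \<subseteq> arrows G"
    using U V by (auto simp: bis_mult_def bisection_def subset_iff)
  moreover have "inj_on (src G) (bis_mult U V)" "inj_on (tgt G) (bis_mult U V)"
    unfolding inj_on_def bis_mult_def using bisectionD [OF U] bisectionD [OF V]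
    by (smt (verit, ccfv_SIG) mem_Collect_eq src_mult tgt_mult)+
  ultimately show ?thesis
    by (simp add: bisection_def)
qed

lemma bisection_ginv:
  assumes "bisection G U"
  shows "bisection G (ginv G ` U)"
  using assms unfolding bisection_def inj_on_def by (auto simp: subset_iff)

end

section \<open>Compact open bisections\<close>

lemma continuous_map_locallyI:
  assumes "\<And>x. x \<in> topspace X \<Longrightarrow> \<exists>U. openin X U \<and> x \<in> U \<and> continuous_map (subtopology X U) Y f"
  shows "continuous_map X Y f"
proof (intro continuous_map_openin_preimage_eq [THEN iffD2] conjI allI impI)
  show "f \<in> topspace X \<rightarrow> topspace Y"
  proof
    fix x assume "x \<in> topspace X"
    then obtain U where "x \<in> U" "x \<in> topspace X" "continuous_map (subtopology X U) Y f"
      using assms by blast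
    then show "f x \<in> topspace Y"
      using continuous_map_funspace by fastforce
  qed
  fix W assume W: "openin Y W"
  show "openin X (topspace X \<inter> f -` W)"
  proof (subst openin_subopen, clarsimp)
    fix x assume x: "x \<in> topspace X" "f x \<in> W"
    then obtain U where U: "openin X U" "x \<in> U" "continuous_map (subtopology X U) Y f"
      using assms by blast
    have "openin (subtopology X U) {z \<in> topspace (subtopology X U). f z \<in> W}"
      using openin_continuous_map_preimage U(3) W by blast
    then have "openin X {z \<in> topspace (subtopology X U). f z \<in> W}"
      using U(1) openin_trans_full by blast
    moreover have "x \<in> {z \<in> topspace (subtopology X U). f z \<in> W}"
      using U(2) x by simp
    moreover have "{z \<in> topspace (subtopology X U). f z \<in> W} \<subseteq> topspace X \<inter> f -` W"
      by auto
    ultimately show "\<exists>T. openin X T \<and> x \<in> T \<and> T \<subseteq> topspace X \<and> T \<subseteq> f -` W"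
      by (metis (no_types, lifting) Int_subset_iff)
  qed
qed

lemma local_homeomorphism_imp_continuous_map:
  assumes "local_homeomorphism X Y f"
  shows "continuous_map X Y f"
  using assms unfolding local_homeomorphism_def
  by (intro continuous_map_locallyI)
     (meson continuous_map_in_subtopology homeomorphic_imp_continuous_map)

lemma local_homeomorphism_imp_open_map:
  assumes "local_homeomorphism X Y f"
  shows "open_map X Y f"
  unfolding open_map_def
proof (intro allI impI)
  fix W assume W: "openin X W"
  show "openin Y (f ` W)"
  proof (subst openin_subopen, clarsimp)
    fix x assume x: "x \<in> W"
    then have "x \<in> topspace X"
      using openin_subset [OF W] by blast
    then obtain U where U: "openin X U" "x \<in> U" "openin Y (f ` U)"
        "homeomorphic_map (subtopology X U) (subtopology Y (f ` U)) f"
      using assms unfolding local_homeomorphism_def by meson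
    have "openin (subtopology X U) (U \<inter> W)"
      using W by (simp add: openin_subtopology_Int2)
    then have "openin (subtopology Y (f ` U)) (f ` (U \<inter> W))"
      using U(4) homeomorphic_imp_open_map open_map_def by blast
    then have "openin Y (f ` (U \<inter> W))"
      using U(3) openin_trans_full by blast
    then show "\<exists>T. openin Y T \<and> f x \<in> T \<and> T \<subseteq> f ` W"
      using x U(2) by blast
  qed
qed

lemma local_homeomorphism_locally_injective:
  assumes "local_homeomorphism X Y f" "x \<in> topspace X"
  obtains U where "openin X U" "x \<in> U" "inj_on f U"
  using assms unfolding local_homeomorphism_def
  by (metis homeomorphic_imp_injective_map inf.absorb_iff2 openin_subset topspace_subtopology)

text \<open>The preimage of an open \<open>W\<close> under the inverse is the image of
  \<open>U \<inter> W\<close>, open because \<open>f\<close> is an open map. Both the slices of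
  bisections and the local sections of the sheaf are inverses of this kind.\<close>

lemma continuous_map_the_inv_into:
  assumes "continuous_map X Y f" "open_map X Y f" "openin X U" "inj_on f U"
  shows "continuous_map (subtopology Y (f ` U)) X (the_inv_into U f)"
proof (intro continuous_map_openin_preimage_eq [THEN iffD2] conjI allI impI)
  have U: "U \<subseteq> topspace X" "f ` U \<subseteq> topspace Y"
    using assms openin_subset open_map_def by metis+
  show "the_inv_into U f \<in> topspace (subtopology Y (f ` U)) \<rightarrow> topspace X"
    using U assms(4) the_inv_into_into by (fastforce simp: Pi_iff)
  fix W assume W: "openin X W"
  have "topspace (subtopology Y (f ` U)) \<inter> the_inv_into U f -` W = f ` U \<inter> f ` (U \<inter> W)"
    using U assms(4) by (auto simp: the_inv_into_f_f)
  moreover have "openin Y (f ` (U \<inter> W))"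
    using assms W by (simp add: open_map_def openin_Int)
  ultimately show "openin (subtopology Y (f ` U)) (topspace (subtopology Y (f ` U)) \<inter> the_inv_into U f -` W)"
    by (simp add: openin_subtopology_Int2)
qed

section \<open>Continuity of the groupoid operations\<close>

context topological_groupoid
begin

lemma units_subset: "units G \<subseteq> topspace (gtop G)"
  using units_arrows by (auto simp: arrows_def)

lemma topspace_unit_space [simp]: "topspace (unit_space G) = units G"
  using units_subset by (auto simp: unit_space_def)

lemma continuous_map_mult:
  assumes "continuous_map X (gtop G) f" "continuous_map X (gtop G) g"
    and "\<And>x. x \<in> topspace X \<Longrightarrow> src G (f x) = tgt G (g x)"
  shows "continuous_map X (gtop G) (\<lambda>x. f x \<cdot> g x)"
proof -
  have "continuous_map X (subtopology (prod_topology (gtop G) (gtop G)) (composable G)) (\<lambda>x. (f x, g x))"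
    using assms continuous_map_funspace [OF assms(1)] continuous_map_funspace [OF assms(2)]
    by (auto simp: continuous_map_in_subtopology continuous_map_paired composable_iff arrows_def Pi_iff)
  from continuous_map_compose [OF this continuous_gmul] show ?thesis
    by (simp add: o_def)
qed

lemma continuous_map_ginv:
  assumes "continuous_map X (gtop G) f"
  shows "continuous_map X (gtop G) (\<lambda>x. ginv G (f x))"
  using continuous_map_compose [OF assms continuous_ginv] by (simp add: o_def)

lemma openin_ginv: "openin (gtop G) U \<Longrightarrow> openin (gtop G) (ginv G ` U)"
proof -
  assume U: "openin (gtop G) U"
  have "homeomorphic_map (gtop G) (gtop G) (ginv G)"
    using continuous_ginv by (intro homeomorphic_map_involution) (auto simp: arrows_def [symmetric])
  then show ?thesis
    using U homeomorphic_imp_open_map open_map_def by blast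
qed

end

section \<open>Source, range and the unit space\<close>

context ample_groupoid
begin

lemma continuous_map_tgt_units: "continuous_map (gtop G) (unit_space G) (tgt G)"
  using local_homeomorphism_tgt by (rule local_homeomorphism_imp_continuous_map)

lemma continuous_map_tgt:
  assumes "continuous_map X (gtop G) f"
  shows "continuous_map X (gtop G) (\<lambda>x. tgt G (f x))"
  using continuous_map_compose [OF assms continuous_map_tgt_units]
  by (simp add: o_def unit_space_def continuous_map_in_subtopology)

lemma continuous_map_src:
  assumes "continuous_map X (gtop G) f"
  shows "continuous_map X (gtop G) (\<lambda>x. src G (f x))"
proof (rule continuous_map_eq)
  show "continuous_map X (gtop G) (\<lambda>x. tgt G (ginv G (f x)))"
    by (intro continuous_map_tgt continuous_map_ginv assms)
  show "tgt G (ginv G (f x)) = src G (f x)" if "x \<in> topspace X" for x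
  proof (rule tgt_ginv)
    show "f x \<in> arrows G"
      using assms that continuous_map_image_subset_topspace unfolding arrows_def by fastforce
  qed
qed

text \<open>On a neighbourhood of a unit where the range map is injective,
  \<open>\<gamma>\<close> and \<open>tgt G \<gamma>\<close> have the same range, so arrows close to a unit are units.\<close>
lemma open_units: "openin (gtop G) (units G)"
proof (subst openin_subopen, clarify)
  fix x assume x: "x \<in> units G"
  then obtain U where U: "openin (gtop G) U" "x \<in> U" "inj_on (tgt G) U"
    using local_homeomorphism_locally_injective [OF local_homeomorphism_tgt] units_subset by blast
  let ?V = "U \<inter> {\<gamma> \<in> topspace (gtop G). tgt G \<gamma> \<in> U}"
  have "openin (gtop G) ?V"
    using U(1) continuous_map_tgt [of "gtop G" id] openin_continuous_map_preimage
    by (fastforce simp: id_def)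
  moreover have "\<gamma> \<in> units G" if "\<gamma> \<in> ?V" for \<gamma>
  proof -
    have "\<gamma> \<in> arrows G" using that by (simp add: arrows_def)
    moreover from this have "tgt G \<gamma> = \<gamma>"
      using that U(3) by (auto simp: inj_on_def)
    ultimately show ?thesis
      using tgt_units by metis
  qed
  moreover have "x \<in> ?V"
    using x U units_subset by auto
  ultimately show "\<exists>T. openin (gtop G) T \<and> x \<in> T \<and> T \<subseteq> units G"
    by blast
qed

text \<open>\<open>open_units\<close> makes relative openness absolute, so open sets of units can be
  handled inside \<open>gtop G\<close> itself.\<close>

lemma openin_unit_space: "openin (unit_space G) U \<longleftrightarrow> openin (gtop G) U \<and> U \<subseteq> units G"
  by (simp add: unit_space_def openin_open_subtopology open_units)

lemma compactin_unit_space: "compactin (unit_space G) K \<longleftrightarrow> compactin (gtop G) K \<and> K \<subseteq> units G"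
  by (simp add: unit_space_def compactin_subtopology)

lemma compact_Hausdorff_in_unit_space:
  "compact_Hausdorff_in (unit_space G) K \<longleftrightarrow> compactin (gtop G) K \<and> K \<subseteq> units G"
  using Hausdorff_units
  by (auto simp: compact_Hausdorff_in_def compactin_unit_space Hausdorff_space_subtopology)

lemma open_map_tgt: "openin (gtop G) U \<Longrightarrow> openin (gtop G) (tgt G ` U)"
  using local_homeomorphism_imp_open_map [OF local_homeomorphism_tgt]
  by (auto simp: open_map_def openin_unit_space)

lemma closedin_compact_units:
  "compactin (gtop G) K \<Longrightarrow> K \<subseteq> units G \<Longrightarrow> closedin (unit_space G) K"
  using Hausdorff_units compactin_imp_closedin compactin_unit_space by blast

text \<open>A compact set of arrows need not be closed. Compact sets of units are closed in the
  Hausdorff unit space, and their preimages under the range map supply the closed sets of arrows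
  used below.\<close>

lemma closedin_tgt_preimage:
  assumes "compactin (gtop G) K" "K \<subseteq> units G"
  shows "closedin (gtop G) {\<gamma> \<in> arrows G. tgt G \<gamma> \<in> K}"
  using closedin_continuous_map_preimage
     [OF continuous_map_tgt_units closedin_compact_units [OF assms]]
  by (simp add: arrows_def)

lemma openin_tgt_preimage:
  assumes "openin (gtop G) K"
  shows "openin (gtop G) {\<gamma> \<in> arrows G. tgt G \<gamma> \<in> K}"
  using openin_continuous_map_preimage [OF continuous_map_tgt [of "gtop G" "\<lambda>x. x"] assms]
  by (simp add: arrows_def)

section \<open>Calculus of compact open bisections\<close>

abbreviation cob :: "'a set set" where "cob \<equiv> compact_open_bisections G"

text \<open>The Hausdorff half of compactness is automatic: the range map sends a bisection
  continuously and injectively into the Hausdorff unit space.\<close>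

lemma cob_iff: "U \<in> cob \<longleftrightarrow> bisection G U \<and> openin (gtop G) U \<and> compactin (gtop G) U"
proof -
  have "Hausdorff_space (subtopology (gtop G) U)" if "bisection G U"
  proof (rule Hausdorff_space_injective_preimage [OF Hausdorff_units])
    show "continuous_map (subtopology (gtop G) U) (unit_space G) (tgt G)"
      by (simp add: continuous_map_from_subtopology continuous_map_tgt_units)
    show "inj_on (tgt G) (topspace (subtopology (gtop G) U))"
      using that by (auto simp: bisection_def inj_on_def)
  qed
  then show ?thesis
    by (auto simp: compact_open_bisections_def compact_Hausdorff_in_def)
qed

lemma cob_open: "U \<in> cob \<Longrightarrow> openin (gtop G) U"
  and cob_compact: "U \<in> cob \<Longrightarrow> compactin (gtop G) U"
  and cob_bisection: "U \<in> cob \<Longrightarrow> bisection G U"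
  by (simp_all add: cob_iff)

lemma cob_arrows: "U \<in> cob \<Longrightarrow> U \<subseteq> arrows G"
  by (simp add: cob_iff bisection_def)

lemma cob_units:
  "K \<subseteq> units G \<Longrightarrow> K \<in> cob \<longleftrightarrow> openin (gtop G) K \<and> compactin (gtop G) K"
  using units_arrows by (auto simp: cob_iff bisection_def inj_on_def subset_iff)

lemma unit_cob_nhd:
  assumes "openin (gtop G) W" "x \<in> W" "x \<in> units G"
  obtains K where "K \<in> cob" "K \<subseteq> units G" "x \<in> K" "K \<subseteq> W"
proof -
  have "openin (unit_space G) (W \<inter> units G)"
    using assms by (simp add: openin_unit_space openin_Int open_units)
  from compact_open_basis [OF this, of x] show ?thesis
    using assms that
    by (auto simp: openin_unit_space compact_Hausdorff_in_unit_space cob_units)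
qed

lemma cob_ginv:
  assumes "U \<in> cob"
  shows "ginv G ` U \<in> cob"
  using assms unfolding cob_iff
  using bisection_ginv openin_ginv image_compactin [OF _ continuous_ginv] by blast

lemma src_image_eq: "U \<subseteq> arrows G \<Longrightarrow> src G ` U = tgt G ` (ginv G ` U)"
  by (auto simp: image_image subset_iff)

lemma cob_tgt:
  assumes "U \<in> cob"
  shows "tgt G ` U \<in> cob"
proof -
  have "tgt G ` U \<subseteq> units G"
    using cob_arrows [OF assms] by auto
  moreover have "compactin (gtop G) (tgt G ` U)"
    using image_compactin [OF cob_compact [OF assms] continuous_map_tgt_units]
    by (simp add: compactin_unit_space)
  ultimately show ?thesis
    using open_map_tgt [OF cob_open [OF assms]] by (simp add: cob_units)
qed

lemma cob_tgt_units: "U \<in> cob \<Longrightarrow> tgt G ` U \<subseteq> units G"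
  using cob_arrows by (force simp: subset_iff)

lemma cob_src: "U \<in> cob \<Longrightarrow> src G ` U \<in> cob"
  using cob_tgt [OF cob_ginv] src_image_eq [OF cob_arrows] by simp

text \<open>Take neighbourhoods of \<gamma> and of its inverse on which the range map is injective.
  The first meets the inverse of the second in an open bisection \<open>B\<close>, which is then cut
  down by a compact open set of units inside its range.\<close>

lemma cob_nhd:
  assumes W: "openin (gtop G) W" and \<gamma>: "\<gamma> \<in> W"
  obtains U where "U \<in> cob" "\<gamma> \<in> U" "U \<subseteq> W"
proof -
  have \<gamma>_top: "\<gamma> \<in> topspace (gtop G)"
    using W \<gamma> openin_subset by blast
  then have \<gamma>_arr: "\<gamma> \<in> arrows G" by (simp add: arrows_def)
  obtain U where U: "openin (gtop G) U" "\<gamma> \<in> U" "inj_on (tgt G) U"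
    using local_homeomorphism_locally_injective [OF local_homeomorphism_tgt \<gamma>_top] .
  obtain V where V: "openin (gtop G) V" "ginv G \<gamma> \<in> V" "inj_on (tgt G) V"
    using local_homeomorphism_locally_injective [OF local_homeomorphism_tgt, of "ginv G \<gamma>"]
      ginv_closed [OF \<gamma>_arr] by (auto simp: arrows_def)
  define B where "B = U \<inter> ginv G ` V \<inter> W"
  have B: "openin (gtop G) B" "\<gamma> \<in> B" "B \<subseteq> W" "B \<subseteq> arrows G"
    using U V W \<gamma> \<gamma>_arr openin_ginv [OF V(1)] openin_subset [OF U(1)]
    by (auto simp: B_def openin_Int arrows_def intro: image_eqI [of _ _ "ginv G \<gamma>"])
  have V_arr: "V \<subseteq> arrows G"
    using openin_subset [OF V(1)] by (simp add: arrows_def)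
  have bis: "bisection G B"
    unfolding bisection_def
  proof (intro conjI)
    show "inj_on (tgt G) B"
      using U(3) by (auto simp: B_def inj_on_def)
    show "inj_on (src G) B"
    proof (rule inj_onI)
      fix \<beta> \<beta>' assume *: "\<beta> \<in> B" "\<beta>' \<in> B" "src G \<beta> = src G \<beta>'"
      then obtain v v' where v: "\<beta> = ginv G v" "v \<in> V" "\<beta>' = ginv G v'" "v' \<in> V"
        unfolding B_def by blast
      with V_arr have "v \<in> arrows G" "v' \<in> arrows G" by blast+
      with * v have "tgt G v = tgt G v'" by simp
      then have "v = v'" using v V(3) by (simp add: inj_on_def)
      with v show "\<beta> = \<beta>'" by simp
    qed
  qed (fact B)
  obtain K where K: "K \<in> cob" "K \<subseteq> units G" "tgt G \<gamma> \<in> K" "K \<subseteq> tgt G ` B"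
    using unit_cob_nhd [OF open_map_tgt [OF B(1)], of "tgt G \<gamma>"] B(2) \<gamma>_arr by auto
  have inj: "inj_on (tgt G) B" using bis by (simp add: bisection_def)
  have "continuous_map (subtopology (unit_space G) (tgt G ` B)) (gtop G) (the_inv_into B (tgt G))"
    using continuous_map_the_inv_into [OF continuous_map_tgt_units
        local_homeomorphism_imp_open_map [OF local_homeomorphism_tgt] B(1) inj] .
  moreover have "compactin (subtopology (unit_space G) (tgt G ` B)) K"
    using K by (simp add: compactin_subtopology compactin_unit_space cob_compact)
  ultimately have "compactin (gtop G) (the_inv_into B (tgt G) ` K)"
    using image_compactin by blast
  \<comment> \<open>The left side is compact, as the image of \<open>K\<close> under the continuous
    local inverse; the right side is visibly open.\<close>
  moreover have eq: "the_inv_into B (tgt G) ` K = B \<inter> {\<beta> \<in> arrows G. tgt G \<beta> \<in> K}"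
  proof (intro subset_antisym subsetI)
    fix \<beta> assume "\<beta> \<in> the_inv_into B (tgt G) ` K"
    then obtain x where x: "x \<in> K" "\<beta> = the_inv_into B (tgt G) x" by blast
    then have "\<beta> \<in> B" "tgt G \<beta> = x"
      using K(4) the_inv_into_into [OF inj _ order_refl] f_the_inv_into_f [OF inj] by blast+
    then show "\<beta> \<in> B \<inter> {\<beta> \<in> arrows G. tgt G \<beta> \<in> K}"
      using x B(4) by blast
  next
    fix \<beta> assume \<beta>: "\<beta> \<in> B \<inter> {\<beta> \<in> arrows G. tgt G \<beta> \<in> K}"
    then have "\<beta> = the_inv_into B (tgt G) (tgt G \<beta>)"
      using the_inv_into_f_f [OF inj] by simp
    then show "\<beta> \<in> the_inv_into B (tgt G) ` K"
      using \<beta> by blast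
  qed
  moreover have "openin (gtop G) (B \<inter> {\<beta> \<in> arrows G. tgt G \<beta> \<in> K})"
    by (intro openin_Int openin_tgt_preimage B cob_open K)
  moreover have "bisection G (B \<inter> {\<beta> \<in> arrows G. tgt G \<beta> \<in> K})"
    using bis unfolding bisection_def inj_on_def by auto
  ultimately have "B \<inter> {\<beta> \<in> arrows G. tgt G \<beta> \<in> K} \<in> cob"
    by (simp add: cob_iff)
  then show thesis
    using that B K \<gamma>_arr by blast
qed

lemma cob_restrict:
  assumes "U \<in> cob" "K \<in> cob" "K \<subseteq> units G"
  shows "{\<gamma> \<in> U. tgt G \<gamma> \<in> K} \<in> cob"
proof -
  have eq: "{\<gamma> \<in> U. tgt G \<gamma> \<in> K} = {\<gamma> \<in> arrows G. tgt G \<gamma> \<in> K} \<inter> U"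
    using cob_arrows [OF assms(1)] by blast
  have "bisection G {\<gamma> \<in> U. tgt G \<gamma> \<in> K}"
    using cob_bisection [OF assms(1)] unfolding bisection_def inj_on_def by auto
  moreover have "compactin (gtop G) {\<gamma> \<in> U. tgt G \<gamma> \<in> K}"
    unfolding eq by (intro closed_Int_compactin closedin_tgt_preimage cob_compact assms)
  moreover have "openin (gtop G) {\<gamma> \<in> U. tgt G \<gamma> \<in> K}"
    unfolding eq by (intro openin_Int openin_tgt_preimage cob_open assms)
  ultimately show ?thesis by (simp add: cob_iff)
qed

lemma cob_Un_units:
  assumes "K \<in> cob" "L \<in> cob" "K \<subseteq> units G" "L \<subseteq> units G"
  shows "K \<union> L \<in> cob"
  using assms by (simp add: cob_units compactin_Un openin_Un)

text \<open>The arrow of \<open>U\<close> with a given range, meaningful only at points of the range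
  of \<open>U\<close>. A left factor known to lie in \<open>U\<close> is determined by the range of
  the product, so this recovers it, and continuously.\<close>

definition slice :: "'a set \<Rightarrow> 'a \<Rightarrow> 'a" where
  "slice U = the_inv_into U (tgt G)"

lemma slice_tgt [simp]: "U \<in> cob \<Longrightarrow> \<beta> \<in> U \<Longrightarrow> slice U (tgt G \<beta>) = \<beta>"
  by (simp add: slice_def cob_iff bisection_def the_inv_into_f_f)

lemma slice_in: "U \<in> cob \<Longrightarrow> x \<in> tgt G ` U \<Longrightarrow> slice U x \<in> U"
  by auto

lemma tgt_slice: "U \<in> cob \<Longrightarrow> x \<in> tgt G ` U \<Longrightarrow> tgt G (slice U x) = x"
  by auto

lemma continuous_map_slice:
  assumes "U \<in> cob" "continuous_map X (gtop G) f" "\<And>x. x \<in> topspace X \<Longrightarrow> f x \<in> tgt G ` U"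
  shows "continuous_map X (gtop G) (\<lambda>x. slice U (f x))"
proof -
  have "continuous_map (subtopology (unit_space G) (tgt G ` U)) (gtop G) (slice U)"
    unfolding slice_def
    using continuous_map_the_inv_into [OF continuous_map_tgt_units
        local_homeomorphism_imp_open_map [OF local_homeomorphism_tgt] cob_open [OF assms(1)]]
       cob_bisection [OF assms(1)] by (simp add: bisection_def)
  moreover have "continuous_map X (subtopology (unit_space G) (tgt G ` U)) f"
    using assms(2,3) cob_tgt_units [OF assms(1)]
    unfolding continuous_map_in_subtopology unit_space_def by blast
  ultimately show ?thesis
    using continuous_map_compose [of X _ f _ "slice U"] by (simp add: o_def)
qed

text \<open>Left translation by \<open>U\<close> is a partial homeomorphism with inverse the left translation
  by \<open>ginv G ` U\<close>: one description shows that the product is open, the other that it is compact.\<close>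
lemma cob_bis_mult:
  assumes U: "U \<in> cob" and V: "V \<in> cob"
  shows "bis_mult U V \<in> cob"
proof -
  have arr: "U \<subseteq> arrows G" "V \<subseteq> arrows G"
    using U V cob_arrows by auto
  have Ui: "ginv G ` U \<in> cob" "tgt G ` ginv G ` U = src G ` U"
    using U cob_ginv src_image_eq [OF arr(1)] by auto
  define X where "X = {\<delta> \<in> arrows G. tgt G \<delta> \<in> tgt G ` U}"
  \<comment> \<open>\<open>h\<close> strips off the left factor in \<open>U\<close> that is read off
    from the range, so the product set is the part of \<open>X\<close> that \<open>h\<close> maps
    into \<open>V\<close>.\<close>
  define h where "h \<delta> = ginv G (slice U (tgt G \<delta>)) \<cdot> \<delta>" for \<delta>
  have X: "openin (gtop G) X"
    unfolding X_def by (intro openin_tgt_preimage open_map_tgt cob_open U)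
  then have topX: "topspace (subtopology (gtop G) X) = X"
    using openin_subset by (metis inf_absorb2 topspace_subtopology)
  have slX: "slice U (tgt G \<delta>) \<in> arrows G" "tgt G (slice U (tgt G \<delta>)) = tgt G \<delta>" if "\<delta> \<in> X" for \<delta>
    using that slice_in [OF U] tgt_slice [OF U] arr by (auto simp: X_def)
  have id: "continuous_map (subtopology (gtop G) S) (gtop G) (\<lambda>x. x)" for S
    using continuous_map_from_subtopology by fastforce
  have "continuous_map (subtopology (gtop G) X) (gtop G) h"
    unfolding h_def
    by (intro continuous_map_mult continuous_map_ginv continuous_map_slice U continuous_map_tgt id)
       (use slX in \<open>auto simp: topX X_def\<close>)
  then have "openin (subtopology (gtop G) X) {\<delta> \<in> X. h \<delta> \<in> V}"
    using openin_continuous_map_preimage cob_open [OF V] topX by fastforce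
  then have "openin (gtop G) {\<delta> \<in> X. h \<delta> \<in> V}"
    using X openin_trans_full by blast
  moreover have "{\<delta> \<in> X. h \<delta> \<in> V} = bis_mult U V"
  proof (intro subset_antisym subsetI)
    fix \<delta> assume "\<delta> \<in> {\<delta> \<in> X. h \<delta> \<in> V}"
    then have \<delta>: "\<delta> \<in> X" "h \<delta> \<in> V" by auto
    have "\<delta> = slice U (tgt G \<delta>) \<cdot> h \<delta>" "src G (slice U (tgt G \<delta>)) = tgt G (h \<delta>)"
      using slX [OF \<delta>(1)] \<delta>(1) by (auto simp: h_def X_def)
    moreover have "slice U (tgt G \<delta>) \<in> U"
      using \<delta>(1) slice_in [OF U] by (auto simp: X_def)
    ultimately show "\<delta> \<in> bis_mult U V"
      unfolding bis_mult_def using \<delta>(2) by blast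
  next
    fix \<delta> assume "\<delta> \<in> bis_mult U V"
    then obtain \<beta> \<gamma> where "\<delta> = \<beta> \<cdot> \<gamma>" "\<beta> \<in> U" "\<gamma> \<in> V" "src G \<beta> = tgt G \<gamma>"
      by (auto simp: bis_mult_def)
    then show "\<delta> \<in> {\<delta> \<in> X. h \<delta> \<in> V}"
      using arr U by (auto simp: X_def h_def subset_iff)
  qed
  ultimately have op: "openin (gtop G) (bis_mult U V)"
    by simp
  \<comment> \<open>Only arrows of \<open>V\<close> whose range is a source of \<open>U\<close> can
    be multiplied. On this compact part \<open>k\<close> multiplies from the left by the arrow of
    \<open>U\<close> with the matching source, which is found by slicing the inverse
    bisection.\<close>
  define W where "W = {\<gamma> \<in> V. tgt G \<gamma> \<in> src G ` U}"
  define k where "k \<gamma> = ginv G (slice (ginv G ` U) (tgt G \<gamma>)) \<cdot> \<gamma>" for \<gamma>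
  have W: "W \<in> cob"
    unfolding W_def by (intro cob_restrict V cob_src U) (use arr in auto)
  then have topW: "topspace (subtopology (gtop G) W) = W" "W \<subseteq> arrows G"
    using openin_subset cob_open cob_arrows by (force simp: inf_absorb2)+
  have slW: "slice (ginv G ` U) (tgt G \<gamma>) \<in> arrows G" "tgt G (slice (ginv G ` U) (tgt G \<gamma>)) = tgt G \<gamma>"
    if "\<gamma> \<in> W" for \<gamma>
    using that slice_in [OF Ui(1)] tgt_slice [OF Ui(1)] Ui(2) cob_arrows [OF Ui(1)] by (auto simp: W_def)
  have "continuous_map (subtopology (gtop G) W) (gtop G) k"
    unfolding k_def
    by (intro continuous_map_mult continuous_map_ginv continuous_map_slice Ui continuous_map_tgt id)
       (use slW Ui(2) in \<open>auto simp: topW W_def\<close>)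
  moreover have "compactin (subtopology (gtop G) W) W"
    using cob_compact [OF W] by (simp add: compactin_subtopology)
  ultimately have "compactin (gtop G) (k ` W)"
    using image_compactin by blast
  moreover have "k ` W = bis_mult U V"
  proof -
    have k: "k \<gamma> = \<beta> \<cdot> \<gamma>" if "\<beta> \<in> U" "tgt G \<gamma> = src G \<beta>" for \<beta> \<gamma>
      using that slice_tgt [OF Ui(1), of "ginv G \<beta>"] arr by (auto simp: k_def subset_iff)
    show ?thesis
    proof (intro subset_antisym subsetI)
      fix \<delta> assume "\<delta> \<in> k ` W"
      then obtain \<gamma> \<beta> where "\<delta> = k \<gamma>" "\<gamma> \<in> V" "\<beta> \<in> U" "tgt G \<gamma> = src G \<beta>"
        unfolding W_def by blast
      with k show "\<delta> \<in> bis_mult U V"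
        unfolding bis_mult_def by fastforce
    next
      fix \<delta> assume "\<delta> \<in> bis_mult U V"
      then obtain \<gamma> \<beta> where *: "\<delta> = \<beta> \<cdot> \<gamma>" "\<gamma> \<in> V" "\<beta> \<in> U" "tgt G \<gamma> = src G \<beta>"
        unfolding bis_mult_def by fastforce
      then have "\<gamma> \<in> W" "\<delta> = k \<gamma>"
        unfolding W_def using k [OF *(3,4)] by auto
      then show "\<delta> \<in> k ` W" by blast
    qed
  qed
  ultimately show ?thesis
    using op bisection_bis_mult U V by (simp add: cob_iff)
qed

end

section \<open>Sheaves of rings over an ample groupoid\<close>

locale ample_ring_sheaf = ample_groupoid G + sheaf_of_rings G \<O>
  for G :: "'g top_groupoid" and \<O> :: "('g, 'e) ring_sheaf"
begin

section \<open>Arithmetic in the stalks\<close>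

abbreviation fib :: "'g \<Rightarrow> 'e set" where "fib x \<equiv> carrier (stalk \<O> x)"

text \<open>The sheaf record carries no negation. Taking it in the stalk through \<open>e\<close>
  gives one map on the total space, whose continuity can then be stated and proved.\<close>

definition eneg :: "'e \<Rightarrow> 'e" where
  "eneg e = a_inv (stalk \<O> (proj \<O> e)) e"

lemma fib_iff: "e \<in> fib x \<longleftrightarrow> e \<in> topspace (etop \<O>) \<and> proj \<O> e = x"
  by (simp add: stalk_def)

lemma stalk_simps [simp]:
  "add (stalk \<O> x) = eadd \<O>" "mult (stalk \<O> x) = emul \<O>"
  "zero (stalk \<O> x) = ezero \<O> x" "one (stalk \<O> x) = eone \<O> x"
  by (simp_all add: stalk_def)

lemma proj_fib: "e \<in> fib x \<Longrightarrow> proj \<O> e = x"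
  by (simp add: fib_iff)

lemma fib_proj: "e \<in> topspace (etop \<O>) \<Longrightarrow> e \<in> fib (proj \<O> e)"
  by (simp add: fib_iff)

lemma continuous_map_proj_units: "continuous_map (etop \<O>) (unit_space G) (proj \<O>)"
  using local_homeomorphism_proj by (rule local_homeomorphism_imp_continuous_map)

lemma continuous_map_proj:
  assumes "continuous_map X (etop \<O>) f"
  shows "continuous_map X (gtop G) (\<lambda>x. proj \<O> (f x))"
  using continuous_map_compose [OF assms continuous_map_proj_units]
  by (simp add: o_def unit_space_def continuous_map_in_subtopology)

lemma proj_units [simp]: "e \<in> topspace (etop \<O>) \<Longrightarrow> proj \<O> e \<in> units G"
  using continuous_map_funspace [OF continuous_map_proj_units] by auto

lemma fib_units: "e \<in> fib x \<Longrightarrow> x \<in> units G"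
  by (auto simp: fib_iff)

context
  fixes x assumes x: "x \<in> units G"
begin

interpretation R: ring "stalk \<O> x" using ring_stalk [OF x] .

lemma
  shows ezero_closed [simp]: "ezero \<O> x \<in> fib x"
    and eone_closed [simp]: "eone \<O> x \<in> fib x"
  using R.zero_closed R.one_closed by simp_all

end

lemma ring_stalk_fib: "a \<in> fib x \<Longrightarrow> ring (stalk \<O> x)"
  using ring_stalk fib_units by blast

context
  fixes a x assumes a: "a \<in> fib x"
begin

interpretation R: ring "stalk \<O> x" using ring_stalk_fib [OF a] .

lemma
  shows eadd_closed [simp]: "b \<in> fib x \<Longrightarrow> eadd \<O> a b \<in> fib x"
    and emul_closed [simp]: "b \<in> fib x \<Longrightarrow> emul \<O> a b \<in> fib x"
    and eneg_closed [simp]: "eneg a \<in> fib x"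
    and eadd_ezero [simp]: "eadd \<O> a (ezero \<O> x) = a"
    and ezero_eadd [simp]: "eadd \<O> (ezero \<O> x) a = a"
    and eadd_comm: "b \<in> fib x \<Longrightarrow> eadd \<O> a b = eadd \<O> b a"
    and eadd_assoc: "b \<in> fib x \<Longrightarrow> c \<in> fib x \<Longrightarrow> eadd \<O> (eadd \<O> a b) c = eadd \<O> a (eadd \<O> b c)"
    and eadd_eneg: "eadd \<O> a (eneg a) = ezero \<O> x"
    and emul_ezero [simp]: "emul \<O> a (ezero \<O> x) = ezero \<O> x"
    and ezero_emul [simp]: "emul \<O> (ezero \<O> x) a = ezero \<O> x"
    and emul_eone [simp]: "emul \<O> a (eone \<O> x) = a"
    and eone_emul [simp]: "emul \<O> (eone \<O> x) a = a"
    and emul_assoc: "b \<in> fib x \<Longrightarrow> c \<in> fib x \<Longrightarrow> emul \<O> (emul \<O> a b) c = emul \<O> a (emul \<O> b c)"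
    and eadd_emul: "b \<in> fib x \<Longrightarrow> c \<in> fib x \<Longrightarrow>
      emul \<O> (eadd \<O> a b) c = eadd \<O> (emul \<O> a c) (emul \<O> b c)"
    and emul_eadd: "b \<in> fib x \<Longrightarrow> c \<in> fib x \<Longrightarrow>
      emul \<O> a (eadd \<O> b c) = eadd \<O> (emul \<O> a b) (emul \<O> a c)"
  using R.a_closed [of a b] R.m_closed [of a b] R.a_inv_closed [of a] R.r_zero [of a] R.l_zero [of a]
    R.a_comm [of a b] R.a_assoc [of a b c] R.r_neg [of a] R.r_null [of a] R.l_null [of a] R.r_one [of a]
    R.l_one [of a] R.m_assoc [of a b c] R.l_distr [of a b c] R.r_distr [of b c a] a
  by (simp_all add: eneg_def proj_fib)

end

lemma eadd_eq_ezero: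
  assumes "a \<in> fib x" "b \<in> fib x" "eadd \<O> a b = ezero \<O> x"
  shows "b = eneg a"
proof -
  have n: "eneg a \<in> fib x" using assms(1) by simp
  have "eadd \<O> (eadd \<O> (eneg a) a) b = eadd \<O> (eneg a) (ezero \<O> x)"
    by (simp only: eadd_assoc [OF n assms(1,2)] assms(3))
  then show ?thesis
    using assms(2) n eadd_eneg [OF assms(1)] by (simp add: eadd_comm [OF n assms(1)])
qed

lemma eneg_ezero [simp]: "x \<in> units G \<Longrightarrow> eneg (ezero \<O> x) = ezero \<O> x"
  using eadd_eq_ezero [of "ezero \<O> x" x "ezero \<O> x"] by simp

text \<open>Singles out zero by an equation in addition alone, which additive maps and continuity of
  addition respect. It yields both \<open>act_ezero\<close> and the continuity of the zero
  section.\<close>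

lemma eadd_idem:
  assumes "a \<in> fib x" "eadd \<O> a a = a"
  shows "a = ezero \<O> x"
  using eadd_assoc [OF assms(1,1) eneg_closed, OF assms(1)] assms by (simp add: eadd_eneg)

lemma act_closed [simp]: "\<gamma> \<in> arrows G \<Longrightarrow> a \<in> fib (src G \<gamma>) \<Longrightarrow> act \<O> \<gamma> a \<in> fib (tgt G \<gamma>)"
  using act_ring_hom ring_hom_closed by fastforce

lemma act_eadd: "\<gamma> \<in> arrows G \<Longrightarrow> a \<in> fib (src G \<gamma>) \<Longrightarrow> b \<in> fib (src G \<gamma>) \<Longrightarrow>
    act \<O> \<gamma> (eadd \<O> a b) = eadd \<O> (act \<O> \<gamma> a) (act \<O> \<gamma> b)"
  using act_ring_hom ring_hom_add by fastforce

lemma act_emul: "\<gamma> \<in> arrows G \<Longrightarrow> a \<in> fib (src G \<gamma>) \<Longrightarrow> b \<in> fib (src G \<gamma>) \<Longrightarrow>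
    act \<O> \<gamma> (emul \<O> a b) = emul \<O> (act \<O> \<gamma> a) (act \<O> \<gamma> b)"
  using act_ring_hom ring_hom_mult by fastforce

lemma act_eone [simp]: "\<gamma> \<in> arrows G \<Longrightarrow> act \<O> \<gamma> (eone \<O> (src G \<gamma>)) = eone \<O> (tgt G \<gamma>)"
  using act_ring_hom ring_hom_one by fastforce

lemma act_ezero [simp]: "\<gamma> \<in> arrows G \<Longrightarrow> act \<O> \<gamma> (ezero \<O> (src G \<gamma>)) = ezero \<O> (tgt G \<gamma>)"
  by (rule eadd_idem) (simp_all flip: act_eadd)

lemma act_mult: "\<beta> \<in> arrows G \<Longrightarrow> \<gamma> \<in> arrows G \<Longrightarrow> src G \<beta> = tgt G \<gamma> \<Longrightarrow> a \<in> fib (src G \<gamma>) \<Longrightarrow>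
    act \<O> (\<beta> \<cdot> \<gamma>) a = act \<O> \<beta> (act \<O> \<gamma> a)"
  using act_act [of \<gamma> a \<beta>] by (simp add: act_domain_def composable_iff fib_iff)

lemma act_unit_fib [simp]: "a \<in> fib x \<Longrightarrow> act \<O> x a = a"
  using act_unit by (auto simp: fib_iff)

lemma act_ginv_act [simp]: "\<gamma> \<in> arrows G \<Longrightarrow> a \<in> fib (src G \<gamma>) \<Longrightarrow> act \<O> (ginv G \<gamma>) (act \<O> \<gamma> a) = a"
  by (simp flip: act_mult)

lemma act_eq_ezero: "\<gamma> \<in> arrows G \<Longrightarrow> a \<in> fib (src G \<gamma>) \<Longrightarrow>
    act \<O> \<gamma> a = ezero \<O> (tgt G \<gamma>) \<longleftrightarrow> a = ezero \<O> (src G \<gamma>)"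
  by (metis act_ezero act_ginv_act ginv_closed src_ginv tgt_ginv)

section \<open>Continuity of the sheaf operations\<close>

lemma continuous_map_eadd:
  assumes "continuous_map X (etop \<O>) f" "continuous_map X (etop \<O>) g"
    and "\<And>x. x \<in> topspace X \<Longrightarrow> proj \<O> (f x) = proj \<O> (g x)"
  shows "continuous_map X (etop \<O>) (\<lambda>x. eadd \<O> (f x) (g x))"
proof -
  have "continuous_map X (subtopology (prod_topology (etop \<O>) (etop \<O>)) (fibre_square \<O>)) (\<lambda>x. (f x, g x))"
    using assms continuous_map_funspace [OF assms(1)] continuous_map_funspace [OF assms(2)]
    by (auto simp: continuous_map_in_subtopology continuous_map_paired fibre_square_def Pi_iff)
  from continuous_map_compose [OF this continuous_eadd] show ?thesis
    by (simp add: o_def)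
qed

lemma continuous_map_emul:
  assumes "continuous_map X (etop \<O>) f" "continuous_map X (etop \<O>) g"
    and "\<And>x. x \<in> topspace X \<Longrightarrow> proj \<O> (f x) = proj \<O> (g x)"
  shows "continuous_map X (etop \<O>) (\<lambda>x. emul \<O> (f x) (g x))"
proof -
  have "continuous_map X (subtopology (prod_topology (etop \<O>) (etop \<O>)) (fibre_square \<O>)) (\<lambda>x. (f x, g x))"
    using assms continuous_map_funspace [OF assms(1)] continuous_map_funspace [OF assms(2)]
    by (auto simp: continuous_map_in_subtopology continuous_map_paired fibre_square_def Pi_iff)
  from continuous_map_compose [OF this continuous_emul] show ?thesis
    by (simp add: o_def)
qed

lemma continuous_map_act:
  assumes "continuous_map X (gtop G) f" "continuous_map X (etop \<O>) g"
    and "\<And>x. x \<in> topspace X \<Longrightarrow> src G (f x) = proj \<O> (g x)"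
  shows "continuous_map X (etop \<O>) (\<lambda>x. act \<O> (f x) (g x))"
proof -
  have "continuous_map X (subtopology (prod_topology (gtop G) (etop \<O>)) (act_domain G \<O>)) (\<lambda>x. (f x, g x))"
    using assms continuous_map_funspace [OF assms(1)] continuous_map_funspace [OF assms(2)]
    by (auto simp: continuous_map_in_subtopology continuous_map_paired act_domain_def arrows_def Pi_iff)
  from continuous_map_compose [OF this continuous_act] show ?thesis
    by (simp add: o_def)
qed

text \<open>Both maps lift the same map to the base, and the projection is injective near the common
  value, so they agree wherever both stay in that neighbourhood. The later openness statements about
  zeros, nonzeros and inverses rest on this.\<close>

lemma eventually_agree:
  assumes "continuous_map X (etop \<O>) f" "continuous_map X (etop \<O>) g"
    and "\<And>x. x \<in> topspace X \<Longrightarrow> proj \<O> (f x) = proj \<O> (g x)"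
    and x: "x \<in> topspace X" "f x = g x"
  shows "\<exists>N. openin X N \<and> x \<in> N \<and> (\<forall>y\<in>N. f y = g y)"
proof -
  have "f x \<in> topspace (etop \<O>)"
    using continuous_map_funspace [OF assms(1)] x(1) by blast
  then obtain U where U: "openin (etop \<O>) U" "f x \<in> U" "inj_on (proj \<O>) U"
    using local_homeomorphism_locally_injective [OF local_homeomorphism_proj] by blast
  let ?N = "{y \<in> topspace X. f y \<in> U} \<inter> {y \<in> topspace X. g y \<in> U}"
  show ?thesis
  proof (intro exI conjI ballI)
    show "openin X ?N"
      using openin_continuous_map_preimage [OF assms(1) U(1)]
        openin_continuous_map_preimage [OF assms(2) U(1)] by blast
    show "x \<in> ?N" using U x by auto
    show "f y = g y" if "y \<in> ?N" for y
      using that U(3) assms(3) by (auto simp: inj_on_def)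
  qed
qed

lemma continuous_map_unit_space:
  assumes "continuous_map (unit_space G) Y f" "continuous_map X (gtop G) g" "\<And>x. x \<in> topspace X \<Longrightarrow> g x \<in> units G"
  shows "continuous_map X Y (\<lambda>x. f (g x))"
proof -
  have "continuous_map X (unit_space G) g"
    using assms(2,3) by (auto simp: unit_space_def continuous_map_in_subtopology)
  from continuous_map_compose [OF this assms(1)] show ?thesis
    by (simp add: o_def)
qed

lemma local_section:
  assumes "e \<in> topspace (etop \<O>)"
  obtains N s where "openin (gtop G) N" "N \<subseteq> units G" "proj \<O> e \<in> N"
    "continuous_map (subtopology (gtop G) N) (etop \<O>) s" "\<And>y. y \<in> N \<Longrightarrow> s y \<in> fib y" "s (proj \<O> e) = e"
proof -
  obtain U where U: "openin (etop \<O>) U" "e \<in> U" "inj_on (proj \<O>) U"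
    using local_homeomorphism_locally_injective [OF local_homeomorphism_proj assms] .
  let ?N = "proj \<O> ` U" and ?s = "the_inv_into U (proj \<O>)"
  have N: "openin (gtop G) ?N" "?N \<subseteq> units G"
    using local_homeomorphism_imp_open_map [OF local_homeomorphism_proj] U(1)
    by (auto simp: open_map_def openin_unit_space)
  have eq: "subtopology (unit_space G) ?N = subtopology (gtop G) ?N"
    using N(2) by (simp add: unit_space_def subtopology_subtopology inf_absorb2)
  have "continuous_map (subtopology (gtop G) ?N) (etop \<O>) ?s"
    using continuous_map_the_inv_into [OF continuous_map_proj_units
        local_homeomorphism_imp_open_map [OF local_homeomorphism_proj] U(1,3)] eq by simp
  moreover have "?s y \<in> fib y" if "y \<in> ?N" for y
    using that U(3) openin_subset [OF U(1)] by (auto simp: the_inv_into_f_f fib_iff)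
  ultimately show thesis
    using that [of ?N ?s] N U by (simp add: the_inv_into_f_f)
qed

lemma continuous_map_id_subtopology: "continuous_map (subtopology X S) X (\<lambda>x. x)"
  using continuous_map_from_subtopology by fastforce

lemma topspace_subtopology_open: "openin X S \<Longrightarrow> topspace (subtopology X S) = S"
  by (simp add: inf_absorb2 openin_subset)

text \<open>A local section \<open>s\<close> vanishing at a point agrees with \<open>s + s\<close> there, hence nearby, hence is zero nearby.\<close>
lemma continuous_ezero: "continuous_map (unit_space G) (etop \<O>) (ezero \<O>)"
proof (rule continuous_map_locallyI)
  fix x assume "x \<in> topspace (unit_space G)"
  then have x: "x \<in> units G" by simp
  then obtain N s where N: "openin (gtop G) N" "N \<subseteq> units G" "x \<in> N"
    and s: "continuous_map (subtopology (gtop G) N) (etop \<O>) s" "\<And>y. y \<in> N \<Longrightarrow> s y \<in> fib y" "s x = ezero \<O> x"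
    using local_section [of "ezero \<O> x"] ezero_closed [OF x] by (metis fib_iff)
  have top: "topspace (subtopology (gtop G) N) = N"
    using N(1) by (rule topspace_subtopology_open)
  have "continuous_map (subtopology (gtop G) N) (etop \<O>) (\<lambda>y. eadd \<O> (s y) (s y))"
    by (intro continuous_map_eadd s) auto
  moreover have "proj \<O> (eadd \<O> (s y) (s y)) = proj \<O> (s y)" if "y \<in> N" for y
    using s(2) [OF that] by (simp add: proj_fib)
  ultimately obtain M where M: "openin (subtopology (gtop G) N) M" "x \<in> M" "\<forall>y\<in>M. eadd \<O> (s y) (s y) = s y"
    using eventually_agree [OF _ s(1), of "\<lambda>y. eadd \<O> (s y) (s y)" x] s(3) x N(3) top by auto
  have MN: "M \<subseteq> N" using openin_subset [OF M(1)] top by simp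
  have "openin (gtop G) M" using M(1) N(1) openin_trans_full by blast
  moreover have "continuous_map (subtopology (gtop G) M) (etop \<O>) (ezero \<O>)"
  proof (rule continuous_map_eq)
    show "continuous_map (subtopology (gtop G) M) (etop \<O>) s"
      using s(1) MN by (rule continuous_map_from_subtopology_mono)
    show "s y = ezero \<O> y" if "y \<in> topspace (subtopology (gtop G) M)" for y
      using that M(3) s(2) MN by (auto intro: eadd_idem)
  qed
  moreover have "subtopology (unit_space G) M = subtopology (gtop G) M"
    using MN N(2) by (simp add: unit_space_def subtopology_subtopology inf_absorb2)
  ultimately show "\<exists>U. openin (unit_space G) U \<and> x \<in> U \<and> continuous_map (subtopology (unit_space G) U) (etop \<O>) (ezero \<O>)"
    using M(2) MN N(2) by (intro exI [of _ M]) (auto simp: openin_unit_space)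
qed

lemma continuous_map_ezero:
  assumes "continuous_map X (gtop G) f" "\<And>x. x \<in> topspace X \<Longrightarrow> f x \<in> units G"
  shows "continuous_map X (etop \<O>) (\<lambda>x. ezero \<O> (f x))"
  using continuous_map_unit_space [OF continuous_ezero assms] .

lemma continuous_map_eone:
  assumes "continuous_map X (gtop G) f" "\<And>x. x \<in> topspace X \<Longrightarrow> f x \<in> units G"
  shows "continuous_map X (etop \<O>) (\<lambda>x. eone \<O> (f x))"
  using continuous_map_unit_space [OF continuous_eone assms] .

text \<open>Vanishing is agreement of two continuous lifts: \<open>f\<close>, and the zero section
  along the projection of \<open>f\<close>. Consequently nonvanishing sets are closed.\<close>

lemma open_zeros:
  assumes "continuous_map X (etop \<O>) f"
  shows "openin X {x \<in> topspace X. f x = ezero \<O> (proj \<O> (f x))}"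
proof (subst openin_subopen, clarify)
  fix x assume x: "x \<in> topspace X" "f x = ezero \<O> (proj \<O> (f x))"
  have *: "proj \<O> (f y) \<in> units G" if "y \<in> topspace X" for y
    using that continuous_map_funspace [OF assms] proj_units by blast
  have zero: "continuous_map X (etop \<O>) (\<lambda>y. ezero \<O> (proj \<O> (f y)))"
    by (intro continuous_map_ezero continuous_map_proj assms *)
  obtain N where N: "openin X N" "x \<in> N" "\<forall>y\<in>N. f y = ezero \<O> (proj \<O> (f y))"
    using eventually_agree [OF assms zero, of x] x proj_fib [OF ezero_closed [OF *]] by auto
  then show "\<exists>T. openin X T \<and> x \<in> T \<and> T \<subseteq> {x \<in> topspace X. f x = ezero \<O> (proj \<O> (f x))}"
    using openin_subset by (intro exI [of _ N]) auto
qed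

text \<open>Near \<open>e\<close>, negation coincides with a local section \<open>s\<close> through
  the negative of \<open>e\<close>, pulled back along the projection: the sum of a point and its
  \<open>s\<close>-value is zero at \<open>e\<close>, hence nearby, and negatives are
  unique.\<close>

lemma continuous_eneg: "continuous_map (etop \<O>) (etop \<O>) eneg"
proof (rule continuous_map_locallyI)
  fix e assume e: "e \<in> topspace (etop \<O>)"
  then have ne: "eneg e \<in> fib (proj \<O> e)" by (simp add: fib_proj)
  then obtain N s where N: "openin (gtop G) N" "N \<subseteq> units G" "proj \<O> e \<in> N"
    and s: "continuous_map (subtopology (gtop G) N) (etop \<O>) s" "\<And>y. y \<in> N \<Longrightarrow> s y \<in> fib y"
       "s (proj \<O> e) = eneg e"
    using local_section [of "eneg e"] by (metis fib_iff)
  define P where "P = {e \<in> topspace (etop \<O>). proj \<O> e \<in> N}"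
  have P: "openin (etop \<O>) P"
    unfolding P_def using continuous_map_proj_units N by (simp add: openin_continuous_map_preimage openin_unit_space)
  let ?X = "subtopology (etop \<O>) P"
  have top: "topspace ?X = P" using P by (rule topspace_subtopology_open)
  have pr: "continuous_map ?X (gtop G) (proj \<O>)"
    by (intro continuous_map_proj continuous_map_id_subtopology)
  then have "continuous_map ?X (subtopology (gtop G) N) (proj \<O>)"
    by (auto simp: continuous_map_in_subtopology P_def)
  from continuous_map_compose [OF this s(1)]
  have sp: "continuous_map ?X (etop \<O>) (\<lambda>e. s (proj \<O> e))"
    by (simp add: o_def)
  have spP: "s (proj \<O> e) \<in> fib (proj \<O> e)" if "e \<in> P" for e
    using that s(2) by (auto simp: P_def)
  have add: "continuous_map ?X (etop \<O>) (\<lambda>e. eadd \<O> e (s (proj \<O> e)))"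
    by (intro continuous_map_eadd continuous_map_id_subtopology sp) (metis spP proj_fib top)
  have zero: "continuous_map ?X (etop \<O>) (\<lambda>e. ezero \<O> (proj \<O> e))"
    by (intro continuous_map_ezero pr) (auto simp: P_def)
  have pr_eq: "proj \<O> (eadd \<O> e (s (proj \<O> e))) = proj \<O> (ezero \<O> (proj \<O> e))" if "e \<in> topspace ?X" for e
    using that spP [of e] unfolding top by (metis (no_types, lifting) P_def eadd_closed ezero_closed fib_proj mem_Collect_eq proj_fib proj_units)
  obtain M where M: "openin ?X M" "e \<in> M"
      "\<forall>e\<in>M. eadd \<O> e (s (proj \<O> e)) = ezero \<O> (proj \<O> e)"
    using eventually_agree [OF add zero pr_eq, of e] s(3) N(3) top e
    by (auto simp: fib_proj eadd_eneg P_def)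
  have MP: "M \<subseteq> P" using openin_subset [OF M(1)] top by simp
  have "openin (etop \<O>) M" using M(1) P openin_trans_full by blast
  moreover have "continuous_map (subtopology (etop \<O>) M) (etop \<O>) eneg"
  proof (rule continuous_map_eq)
    show "continuous_map (subtopology (etop \<O>) M) (etop \<O>) (\<lambda>e. s (proj \<O> e))"
      using sp MP by (rule continuous_map_from_subtopology_mono)
    show "s (proj \<O> e) = eneg e" if "e \<in> topspace (subtopology (etop \<O>) M)" for e
      using that M(3) spP [of e] MP by (auto intro!: eadd_eq_ezero simp: fib_proj)
  qed
  ultimately show "\<exists>U. openin (etop \<O>) U \<and> e \<in> U \<and> continuous_map (subtopology (etop \<O>) U) (etop \<O>) eneg"
    using M(2) by blast
qed

lemma continuous_map_eneg:
  "continuous_map X (etop \<O>) f \<Longrightarrow> continuous_map X (etop \<O>) (\<lambda>x. eneg (f x))"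
  using continuous_map_compose [OF _ continuous_eneg, of X f] by (simp add: o_def)

end

section \<open>Sections over the arrows\<close>

lemma (in abelian_group) additive_subgroup_iff:
  "additive_subgroup H G \<longleftrightarrow> H \<subseteq> carrier G \<and> \<zero> \<in> H \<and> (\<forall>x\<in>H. \<forall>y\<in>H. x \<oplus> y \<in> H) \<and> (\<forall>x\<in>H. \<ominus> x \<in> H)"
  unfolding additive_subgroup_def subgroup_def by (auto simp: a_inv_def)

context ample_ring_sheaf
begin

section \<open>The additive group of all sections\<close>

abbreviation sections :: "('g \<Rightarrow> 'e) set" where "sections \<equiv> carrier (all_sections G \<O>)"

definition szero :: "'g \<Rightarrow> 'e" where "szero = (\<lambda>\<gamma> \<in> arrows G. ezero \<O> (tgt G \<gamma>))"
definition sadd :: "('g \<Rightarrow> 'e) \<Rightarrow> ('g \<Rightarrow> 'e) \<Rightarrow> 'g \<Rightarrow> 'e" where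
  "sadd f g = (\<lambda>\<gamma> \<in> arrows G. eadd \<O> (f \<gamma>) (g \<gamma>))"
definition sneg :: "('g \<Rightarrow> 'e) \<Rightarrow> 'g \<Rightarrow> 'e" where "sneg f = (\<lambda>\<gamma> \<in> arrows G. eneg (f \<gamma>))"

abbreviation conv (infixl \<open>\<star>\<close> 70) where "f \<star> g \<equiv> convolution G \<O> f g"

lemma all_sections_simps [simp]:
  "zero (all_sections G \<O>) = szero" "add (all_sections G \<O>) = sadd" "mult (all_sections G \<O>) = convolution G \<O>"
  by (auto simp: all_sections_def szero_def sadd_def fun_eq_iff)

lemma sections_iff: "f \<in> sections \<longleftrightarrow> f \<in> extensional (arrows G) \<and> (\<forall>\<gamma> \<in> arrows G. f \<gamma> \<in> fib (tgt G \<gamma>))"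
  by (auto simp: all_sections_def PiE_def)

lemma sections_fib [simp]: "f \<in> sections \<Longrightarrow> \<gamma> \<in> arrows G \<Longrightarrow> f \<gamma> \<in> fib (tgt G \<gamma>)"
  by (simp add: sections_iff)

lemma sections_fib_eq: "f \<in> sections \<Longrightarrow> \<gamma> \<in> arrows G \<Longrightarrow> tgt G \<gamma> = x \<Longrightarrow> f \<gamma> \<in> fib x"
  by auto

lemma sections_eqI: "f \<in> sections \<Longrightarrow> g \<in> sections \<Longrightarrow> (\<And>\<gamma>. \<gamma> \<in> arrows G \<Longrightarrow> f \<gamma> = g \<gamma>) \<Longrightarrow> f = g"
  by (auto simp: sections_iff intro: extensionalityI)

lemma szero_apply [simp]: "\<gamma> \<in> arrows G \<Longrightarrow> szero \<gamma> = ezero \<O> (tgt G \<gamma>)"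
  by (simp add: szero_def)

lemma sadd_apply [simp]: "\<gamma> \<in> arrows G \<Longrightarrow> sadd f g \<gamma> = eadd \<O> (f \<gamma>) (g \<gamma>)"
  by (simp add: sadd_def)

lemma sneg_apply [simp]: "\<gamma> \<in> arrows G \<Longrightarrow> sneg f \<gamma> = eneg (f \<gamma>)"
  by (simp add: sneg_def)

lemma szero_closed [simp]: "szero \<in> sections"
  by (simp add: sections_iff szero_def)

lemma sadd_closed [simp]: "f \<in> sections \<Longrightarrow> g \<in> sections \<Longrightarrow> sadd f g \<in> sections"
  by (simp add: sections_iff sadd_def)

lemma sneg_closed [simp]: "f \<in> sections \<Longrightarrow> sneg f \<in> sections"
  by (simp add: sections_iff sneg_def)

lemma sadd_szero [simp]: "f \<in> sections \<Longrightarrow> sadd f szero = f" "f \<in> sections \<Longrightarrow> sadd szero f = f"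
  by (auto intro!: sections_eqI simp: eadd_ezero [OF sections_fib] ezero_eadd [OF sections_fib])

lemma sadd_comm: "f \<in> sections \<Longrightarrow> g \<in> sections \<Longrightarrow> sadd f g = sadd g f"
  by (auto intro!: sections_eqI eadd_comm [OF sections_fib])

lemma sadd_assoc: "f \<in> sections \<Longrightarrow> g \<in> sections \<Longrightarrow> h \<in> sections \<Longrightarrow> sadd (sadd f g) h = sadd f (sadd g h)"
  by (auto intro!: sections_eqI eadd_assoc [OF sections_fib])

lemma sadd_sneg: "f \<in> sections \<Longrightarrow> sadd f (sneg f) = szero"
  by (auto intro!: sections_eqI eadd_eneg [OF sections_fib])

lemma sadd_eq_szero:
  assumes "f \<in> sections" "g \<in> sections" "sadd f g = szero"
  shows "g = sneg f"
proof (rule sections_eqI)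
  fix \<gamma> assume \<gamma>: "\<gamma> \<in> arrows G"
  have "sadd f g \<gamma> = szero \<gamma>" by (simp only: assms(3))
  then have "eadd \<O> (f \<gamma>) (g \<gamma>) = ezero \<O> (tgt G \<gamma>)" using \<gamma> by simp
  then show "g \<gamma> = sneg f \<gamma>"
    using assms(1,2) \<gamma> by (auto intro!: eadd_eq_ezero [of _ "tgt G \<gamma>"])
qed (use assms in auto)

text \<open>Additive subgroups of \<open>sections\<close>, detached from the ring record, so that
  ideals and subrings over different carriers are described by one predicate; see
  \<open>additive_subgroup_add_closed\<close>.\<close>

definition add_closed :: "('g \<Rightarrow> 'e) set \<Rightarrow> bool" where
  "add_closed T \<longleftrightarrow> T \<subseteq> sections \<and> szero \<in> T \<and> (\<forall>f\<in>T. \<forall>g\<in>T. sadd f g \<in> T) \<and> (\<forall>f\<in>T. sneg f \<in> T)"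

lemma
  assumes T: "add_closed T"
  shows abelian_group_add_closed: "abelian_group (all_sections G \<O> \<lparr>carrier := T\<rparr>)"
    and a_inv_add_closed: "f \<in> T \<Longrightarrow> a_inv (all_sections G \<O> \<lparr>carrier := T\<rparr>) f = sneg f"
proof -
  have sub: "f \<in> sections" if "f \<in> T" for f
    using T that by (auto simp: add_closed_def)
  show ag: "abelian_group (all_sections G \<O> \<lparr>carrier := T\<rparr>)"
  proof (rule abelian_groupI, simp_all add: sub)
    show "sadd f g \<in> T" if "f \<in> T" "g \<in> T" for f g
      using T that by (simp add: add_closed_def)
    show "szero \<in> T"
      using T by (simp add: add_closed_def)
    show "sadd (sadd f g) h = sadd f (sadd g h)" if "f \<in> T" "g \<in> T" "h \<in> T" for f g h
      using sub that by (simp add: sadd_assoc)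
    show "sadd f g = sadd g f" if "f \<in> T" "g \<in> T" for f g
      using sub that by (simp add: sadd_comm)
    show "\<exists>g\<in>T. sadd g f = szero" if "f \<in> T" for f
      using T that sub by (intro bexI [of _ "sneg f"]) (auto simp: sadd_sneg sadd_comm [of "sneg f"] add_closed_def)
  qed
  assume f: "f \<in> T"
  show "a_inv (all_sections G \<O> \<lparr>carrier := T\<rparr>) f = sneg f"
    using T f sub by (intro abelian_group.minus_equality [OF ag])
      (auto simp: sadd_sneg sadd_comm [of "sneg f"] add_closed_def)
qed

lemma additive_subgroup_add_closed:
  assumes "add_closed T"
  shows "additive_subgroup I (all_sections G \<O> \<lparr>carrier := T\<rparr>) \<longleftrightarrow> I \<subseteq> T \<and> add_closed I"
proof -
  interpret abelian_group "all_sections G \<O> \<lparr>carrier := T\<rparr>"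
    using assms by (rule abelian_group_add_closed)
  show ?thesis
    using assms unfolding additive_subgroup_iff add_closed_def
    by (auto simp: a_inv_add_closed [OF assms] subset_iff)
qed

lemma add_closed_sections: "add_closed sections"
  by (simp add: add_closed_def)

lemma group_sections: "group (add_monoid (all_sections G \<O>))"
  using abelian_group.a_comm_group [OF abelian_group_add_closed [OF add_closed_sections]]
  by (simp add: comm_group_def)

lemma inv_sections: "f \<in> sections \<Longrightarrow> inv\<^bsub>add_monoid (all_sections G \<O>)\<^esub> f = sneg f"
  using a_inv_add_closed [OF add_closed_sections] by (simp add: a_inv_def)

text \<open>A generator together with its bisection, which the computations need by name. Continuity
  is required on \<open>U\<close> only: \<open>f\<close> may vanish on part of \<open>U\<close> and
  may jump at its boundary.\<close>

definition bsec :: "'g set \<Rightarrow> ('g \<Rightarrow> 'e) \<Rightarrow> bool" where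
  "bsec U f \<longleftrightarrow> f \<in> sections \<and> U \<in> cob \<and> continuous_map (subtopology (gtop G) U) (etop \<O>) f \<and>
     (\<forall>\<gamma> \<in> arrows G - U. f \<gamma> = ezero \<O> (tgt G \<gamma>))"

lemma bsecD:
  assumes "bsec U f"
  shows "f \<in> sections" "U \<in> cob" "continuous_map (subtopology (gtop G) U) (etop \<O>) f"
    "\<gamma> \<in> arrows G \<Longrightarrow> \<gamma> \<notin> U \<Longrightarrow> f \<gamma> = ezero \<O> (tgt G \<gamma>)"
  using assms by (auto simp: bsec_def)

lemma bisection_sections_iff: "f \<in> bisection_sections G \<O> W \<longleftrightarrow> (\<exists>U\<subseteq>W. bsec U f)"
  by (auto simp: bisection_sections_def bsec_def)

lemma proj_sections: "f \<in> sections \<Longrightarrow> \<gamma> \<in> arrows G \<Longrightarrow> proj \<O> (f \<gamma>) = tgt G \<gamma>"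
  using sections_fib proj_fib by blast

lemma topspace_cob: "U \<in> cob \<Longrightarrow> topspace (subtopology (gtop G) U) = U"
  by (rule topspace_subtopology_open [OF cob_open])

lemma bsec_sadd:
  assumes f: "bsec U f" and g: "bsec U g"
  shows "bsec U (sadd f g)"
proof -
  note F = bsecD [OF f] and H = bsecD [OF g]
  have "continuous_map (subtopology (gtop G) U) (etop \<O>) (sadd f g)"
  proof (rule continuous_map_eq)
    show "continuous_map (subtopology (gtop G) U) (etop \<O>) (\<lambda>\<gamma>. eadd \<O> (f \<gamma>) (g \<gamma>))"
      using F H cob_arrows [OF F(2)] topspace_cob [OF F(2)]
      by (intro continuous_map_eadd) (auto simp: proj_sections subset_iff)
  qed (use cob_arrows [OF F(2)] in auto)
  then show ?thesis
    unfolding bsec_def using F H by simp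
qed

lemma bsec_sneg:
  assumes f: "bsec U f"
  shows "bsec U (sneg f)"
proof -
  note F = bsecD [OF f]
  have "continuous_map (subtopology (gtop G) U) (etop \<O>) (sneg f)"
    by (rule continuous_map_eq [OF continuous_map_eneg [OF F(3)]]) (use cob_arrows [OF F(2)] in auto)
  then show ?thesis
    unfolding bsec_def using F by simp
qed

text \<open>Summands are counted for the sake of the minimal length argument. A given section has
  many lengths, and negatives need no clause because the negative of a generator is a generator on
  the same bisection.\<close>

inductive bsum :: "'g set \<Rightarrow> nat \<Rightarrow> ('g \<Rightarrow> 'e) \<Rightarrow> bool" for W where
  bsum_szero: "bsum W 0 szero"
| bsum_sadd: "bsec U f \<Longrightarrow> U \<subseteq> W \<Longrightarrow> bsum W n g \<Longrightarrow> bsum W (Suc n) (sadd f g)"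

lemma bsum_sections: "bsum W n f \<Longrightarrow> f \<in> sections"
  by (induction rule: bsum.induct) (auto dest: bsecD)

lemma bsum_1: "bsec U f \<Longrightarrow> U \<subseteq> W \<Longrightarrow> bsum W 1 f"
  using bsum_sadd [OF _ _ bsum_szero, of U f W] by (simp add: bsecD(1))

lemma bsum_add: "bsum W m f \<Longrightarrow> bsum W n g \<Longrightarrow> bsum W (m + n) (sadd f g)"
proof (induction rule: bsum.induct)
  case bsum_szero
  then show ?case by (simp add: bsum_sections)
next
  case (bsum_sadd U f n' h)
  then show ?case
    using bsum.bsum_sadd [OF bsum_sadd(1,2) bsum_sadd(4)] by (simp add: sadd_assoc bsum_sections bsecD(1))
qed

lemma Gamma_c_on_iff: "f \<in> Gamma_c_on G \<O> W \<longleftrightarrow> (\<exists>n. bsum W n f)"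
proof
  assume "f \<in> Gamma_c_on G \<O> W"
  then show "\<exists>n. bsum W n f"
    unfolding Gamma_c_on_def
  proof (induction rule: generate.induct)
    case one
    then show ?case using bsum_szero by auto
  next
    case (incl h)
    then show ?case using bsum_1 by (auto simp: bisection_sections_iff)
  next
    case (inv h)
    then obtain U where "bsec U h" "U \<subseteq> W" by (auto simp: bisection_sections_iff)
    then show ?case using bsum_1 [OF bsec_sneg] bsecD(1) inv_sections by metis
  next
    case (eng f g)
    then show ?case using bsum_add by fastforce
  qed
next
  assume "\<exists>n. bsum W n f"
  then obtain n where "bsum W n f" ..
  then show "f \<in> Gamma_c_on G \<O> W"
    unfolding Gamma_c_on_def
  proof (induction rule: bsum.induct)
    case bsum_szero
    then show ?case using generate.one [of "add_monoid (all_sections G \<O>)"] by simp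
  next
    case (bsum_sadd U f n g)
    then show ?case
      using generate.eng [OF generate.incl, of f "bisection_sections G \<O> W" g "add_monoid (all_sections G \<O>)"]
      by (auto simp: bisection_sections_iff)
  qed
qed

lemma Gamma_c_on_add_closed: "add_closed (Gamma_c_on G \<O> W)"
proof -
  have "sneg f \<in> Gamma_c_on G \<O> W" if "f \<in> Gamma_c_on G \<O> W" for f
  proof -
    have BS: "bisection_sections G \<O> W \<subseteq> carrier (add_monoid (all_sections G \<O>))"
      by (auto simp: bisection_sections_iff bsecD(1))
    have "inv\<^bsub>add_monoid (all_sections G \<O>)\<^esub> f \<in> Gamma_c_on G \<O> W"
      unfolding Gamma_c_on_def
      by (intro group.generate_m_inv_closed [OF group_sections BS]) (use that Gamma_c_on_def in metis)
    then show ?thesis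
      using that by (metis inv_sections Gamma_c_on_iff bsum_sections)
  qed
  then show ?thesis
    unfolding add_closed_def
    using bsum_szero bsum_add bsum_sections by (fastforce simp: Gamma_c_on_iff)
qed

abbreviation Gam :: "('g \<Rightarrow> 'e) set" where "Gam \<equiv> Gamma_c_on G \<O> (arrows G)"

lemma Gamma_c_simps [simp]:
  "carrier (Gamma_c G \<O>) = Gam" "zero (Gamma_c G \<O>) = szero" "add (Gamma_c G \<O>) = sadd" "mult (Gamma_c G \<O>) = convolution G \<O>"
  by (simp_all add: Gamma_c_def)

lemma additive_subgroup_Gamma_c: "additive_subgroup I (Gamma_c G \<O>) \<longleftrightarrow> I \<subseteq> Gam \<and> add_closed I"
  unfolding Gamma_c_def by (rule additive_subgroup_add_closed [OF Gamma_c_on_add_closed])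

lemma Gam_sections: "f \<in> Gam \<Longrightarrow> f \<in> sections"
  using Gamma_c_on_add_closed [of "arrows G"] by (auto simp: add_closed_def)

lemma bsec_Gamma_c_on: "bsec U f \<Longrightarrow> U \<subseteq> W \<Longrightarrow> f \<in> Gamma_c_on G \<O> W"
  using bsum_1 Gamma_c_on_iff by blast

lemma bsec_Gam: "bsec U f \<Longrightarrow> f \<in> Gam"
  using bsec_Gamma_c_on bsecD(2) cob_arrows by blast

lemma Gamma_c_on_induct [consumes 1, case_names zero add]:
  assumes "f \<in> Gamma_c_on G \<O> W" "P szero"
    and "\<And>U f g. bsec U f \<Longrightarrow> U \<subseteq> W \<Longrightarrow> g \<in> Gamma_c_on G \<O> W \<Longrightarrow> P g \<Longrightarrow> P (sadd f g)"
  shows "P f"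
proof -
  obtain n where "bsum W n f" using assms(1) Gamma_c_on_iff by blast
  then show ?thesis
    by (induction rule: bsum.induct) (use assms(2,3) Gamma_c_on_iff in blast)+
qed

text \<open>If every summand vanished at \<gamma>, so would the sum; a nonvanishing one is brought
  to the front by commutativity, which does not change the count.\<close>

lemma bsum_pick:
  assumes "bsum W n f" "\<gamma> \<in> arrows G" "f \<gamma> \<noteq> ezero \<O> (tgt G \<gamma>)"
  shows "\<exists>U g h m. bsec U g \<and> U \<subseteq> W \<and> g \<gamma> \<noteq> ezero \<O> (tgt G \<gamma>) \<and> n = Suc m \<and> bsum W m h \<and> f = sadd g h"
  using assms
proof (induction rule: bsum.induct)
  case bsum_szero
  then show ?case by simp
next
  case (bsum_sadd U f n g)
  show ?case
  proof (cases "f \<gamma> = ezero \<O> (tgt G \<gamma>)")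
    case False
    then show ?thesis using bsum_sadd.hyps by metis
  next
    case True
    then have "g \<gamma> \<noteq> ezero \<O> (tgt G \<gamma>)"
      using bsum_sadd by (auto simp: bsum_sections)
    then obtain U' g' h m where *: "bsec U' g'" "U' \<subseteq> W" "g' \<gamma> \<noteq> ezero \<O> (tgt G \<gamma>)" "n = Suc m" "bsum W m h" "g = sadd g' h"
      using bsum_sadd by blast
    have "sadd f g = sadd g' (sadd f h)"
      using sadd_assoc [of g' f h] sadd_assoc [of f g' h] sadd_comm [of f g']
        bsecD(1) [OF *(1)] bsecD(1) [OF bsum_sadd(1)] bsum_sections [OF *(5)] by (simp add: *(6))
    then show ?thesis
      using * bsum.bsum_sadd [OF bsum_sadd(1,2) *(5)] by blast
  qed
qed

text \<open>The image of a bisection in \<open>R\<close>. Multiplication by it translates sections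
  along \<open>U\<close>, which makes the inverse semigroup visible inside the ring.\<close>

definition indic :: "'g set \<Rightarrow> 'g \<Rightarrow> 'e" where
  "indic U = (\<lambda>\<gamma> \<in> arrows G. if \<gamma> \<in> U then eone \<O> (tgt G \<gamma>) else ezero \<O> (tgt G \<gamma>))"

lemma indic_apply [simp]: "\<gamma> \<in> arrows G \<Longrightarrow> indic U \<gamma> = (if \<gamma> \<in> U then eone \<O> (tgt G \<gamma>) else ezero \<O> (tgt G \<gamma>))"
  by (simp add: indic_def)

lemma bsec_indic:
  assumes "U \<in> cob"
  shows "bsec U (indic U)"
proof -
  have "continuous_map (subtopology (gtop G) U) (etop \<O>) (indic U)"
  proof (rule continuous_map_eq)
    show "continuous_map (subtopology (gtop G) U) (etop \<O>) (\<lambda>\<gamma>. eone \<O> (tgt G \<gamma>))"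
      by (intro continuous_map_eone continuous_map_tgt continuous_map_id_subtopology)
        (use topspace_cob [OF assms] cob_arrows [OF assms] in auto)
  qed (use topspace_cob [OF assms] cob_arrows [OF assms] in \<open>auto simp: indic_def\<close>)
  moreover have "indic U \<in> sections"
    by (simp add: sections_iff indic_def)
  ultimately show ?thesis
    using assms by (simp add: bsec_def)
qed

text \<open>A local section through \<open>e\<close> is cut off to a compact open set of units, as
  small as desired, and extended by zero. So diagonal sections take every value in every
  stalk.\<close>

lemma bsec_through:
  assumes e: "e \<in> fib x" and W: "openin (gtop G) W" "x \<in> W"
  obtains K f where "bsec K f" "K \<subseteq> units G" "K \<subseteq> W" "x \<in> K" "f x = e"
proof -
  obtain N s where N: "openin (gtop G) N" "N \<subseteq> units G" "x \<in> N"
    and s: "continuous_map (subtopology (gtop G) N) (etop \<O>) s" "\<And>y. y \<in> N \<Longrightarrow> s y \<in> fib y" "s x = e"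
    using local_section [of e] e by (metis fib_iff)
  obtain K where K: "K \<in> cob" "K \<subseteq> units G" "x \<in> K" "K \<subseteq> N \<inter> W"
    using unit_cob_nhd [of "N \<inter> W" x] N W by (auto simp: openin_Int)
  define f where "f = (\<lambda>\<gamma> \<in> arrows G. if \<gamma> \<in> K then s \<gamma> else ezero \<O> (tgt G \<gamma>))"
  have "f \<in> sections"
    using s(2) K by (auto simp: sections_iff f_def subset_iff)
  moreover have "continuous_map (subtopology (gtop G) K) (etop \<O>) f"
  proof (rule continuous_map_eq)
    show "continuous_map (subtopology (gtop G) K) (etop \<O>) s"
      using s(1) K(4) by (auto intro: continuous_map_from_subtopology_mono)
  qed (use topspace_cob [OF K(1)] cob_arrows [OF K(1)] in \<open>auto simp: f_def\<close>)
  ultimately have "bsec K f"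
    using K by (simp add: bsec_def f_def)
  moreover have "f x = e"
    using K(3) cob_arrows [OF K(1)] s(3) by (auto simp: f_def)
  ultimately show thesis
    using that K by auto
qed

end

section \<open>Convolution\<close>

lemma (in groupoid) ginv_mult_distrib:
  assumes "\<beta> \<in> arrows G" "\<gamma> \<in> arrows G" "src G \<beta> = tgt G \<gamma>"
  shows "ginv G (\<beta> \<cdot> \<gamma>) = ginv G \<gamma> \<cdot> ginv G \<beta>"
proof (rule mult_left_cancel)
  show "\<beta> \<cdot> \<gamma> \<cdot> ginv G (\<beta> \<cdot> \<gamma>) = \<beta> \<cdot> \<gamma> \<cdot> (ginv G \<gamma> \<cdot> ginv G \<beta>)"
    using assms by (simp add: mult_assoc)
qed (use assms in auto)

context ample_ring_sheaf
begin

text \<open>A factorisation of \<gamma> is determined by its left factor \<beta>, which runs over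
  the arrows with the range of \<gamma>; the sum over pairs becomes a sum over one range
  fibre.\<close>

definition cterm :: "('g \<Rightarrow> 'e) \<Rightarrow> ('g \<Rightarrow> 'e) \<Rightarrow> 'g \<Rightarrow> 'g \<Rightarrow> 'e" where
  "cterm f g \<gamma> \<beta> = emul \<O> (f \<beta>) (act \<O> \<beta> (g (ginv G \<beta> \<cdot> \<gamma>)))"

lemma cterm_factor_closed:
  assumes "g \<in> sections" "\<beta> \<in> arrows G" "\<gamma> \<in> arrows G" "tgt G \<beta> = tgt G \<gamma>"
  shows "g (ginv G \<beta> \<cdot> \<gamma>) \<in> fib (src G \<beta>)" "act \<O> \<beta> (g (ginv G \<beta> \<cdot> \<gamma>)) \<in> fib (tgt G \<gamma>)"
proof -
  show 1: "g (ginv G \<beta> \<cdot> \<gamma>) \<in> fib (src G \<beta>)"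
    using assms by (intro sections_fib_eq) auto
  show "act \<O> \<beta> (g (ginv G \<beta> \<cdot> \<gamma>)) \<in> fib (tgt G \<gamma>)"
    using act_closed [OF assms(2) 1] assms(4) by simp
qed

lemma cterm_closed:
  assumes "f \<in> sections" "g \<in> sections" "\<beta> \<in> arrows G" "\<gamma> \<in> arrows G" "tgt G \<beta> = tgt G \<gamma>"
  shows "cterm f g \<gamma> \<beta> \<in> fib (tgt G \<gamma>)"
  unfolding cterm_def
  using assms by (intro emul_closed cterm_factor_closed sections_fib_eq)

lemma cterm_zero:
  assumes "f \<in> sections" "g \<in> sections" "\<beta> \<in> arrows G" "\<gamma> \<in> arrows G" "tgt G \<beta> = tgt G \<gamma>"
    and "f \<beta> = ezero \<O> (tgt G \<gamma>) \<or> g (ginv G \<beta> \<cdot> \<gamma>) = ezero \<O> (src G \<beta>)"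
  shows "cterm f g \<gamma> \<beta> = ezero \<O> (tgt G \<gamma>)"
  using assms(6)
proof
  assume "f \<beta> = ezero \<O> (tgt G \<gamma>)"
  then show ?thesis
    using cterm_factor_closed(2) [OF assms(2-5)] by (simp add: cterm_def)
next
  assume "g (ginv G \<beta> \<cdot> \<gamma>) = ezero \<O> (src G \<beta>)"
  then show ?thesis
    using assms sections_fib_eq [of f \<beta>] by (simp add: cterm_def)
qed

lemma factorisations:
  "{(\<beta>, \<rho>) \<in> composable G. \<beta> \<cdot> \<rho> = \<gamma> \<and> emul \<O> (f \<beta>) (act \<O> \<beta> (g \<rho>)) \<noteq> ezero \<O> (tgt G \<gamma>)}
    = (\<lambda>\<beta>. (\<beta>, ginv G \<beta> \<cdot> \<gamma>)) ` {\<beta> \<in> arrows G. tgt G \<beta> = tgt G \<gamma> \<and> cterm f g \<gamma> \<beta> \<noteq> ezero \<O> (tgt G \<gamma>)}"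
  if "\<gamma> \<in> arrows G"
proof (intro subset_antisym subsetI)
  fix z assume "z \<in> {(\<beta>, \<rho>) \<in> composable G. \<beta> \<cdot> \<rho> = \<gamma> \<and> emul \<O> (f \<beta>) (act \<O> \<beta> (g \<rho>)) \<noteq> ezero \<O> (tgt G \<gamma>)}"
  then obtain \<beta> \<rho> where z: "z = (\<beta>, \<rho>)" "\<beta> \<in> arrows G" "\<rho> \<in> arrows G" "src G \<beta> = tgt G \<rho>" "\<gamma> = \<beta> \<cdot> \<rho>"
      "emul \<O> (f \<beta>) (act \<O> \<beta> (g \<rho>)) \<noteq> ezero \<O> (tgt G \<gamma>)"
    by (auto simp: composable_iff)
  then have "ginv G \<beta> \<cdot> \<gamma> = \<rho>" by simp
  with z show "z \<in> (\<lambda>\<beta>. (\<beta>, ginv G \<beta> \<cdot> \<gamma>)) ` {\<beta> \<in> arrows G. tgt G \<beta> = tgt G \<gamma> \<and> cterm f g \<gamma> \<beta> \<noteq> ezero \<O> (tgt G \<gamma>)}"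
    by (intro image_eqI [of _ _ \<beta>]) (auto simp: cterm_def)
next
  fix z assume "z \<in> (\<lambda>\<beta>. (\<beta>, ginv G \<beta> \<cdot> \<gamma>)) ` {\<beta> \<in> arrows G. tgt G \<beta> = tgt G \<gamma> \<and> cterm f g \<gamma> \<beta> \<noteq> ezero \<O> (tgt G \<gamma>)}"
  then show "z \<in> {(\<beta>, \<rho>) \<in> composable G. \<beta> \<cdot> \<rho> = \<gamma> \<and> emul \<O> (f \<beta>) (act \<O> \<beta> (g \<rho>)) \<noteq> ezero \<O> (tgt G \<gamma>)}"
    using that by (auto simp: cterm_def composable_iff)
qed

lemma conv_eq_finsum_support:
  assumes fg: "f \<in> sections" "g \<in> sections" and \<gamma>: "\<gamma> \<in> arrows G"
  shows "(f \<star> g) \<gamma> = finsum (stalk \<O> (tgt G \<gamma>)) (cterm f g \<gamma>)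
    {\<beta> \<in> arrows G. tgt G \<beta> = tgt G \<gamma> \<and> cterm f g \<gamma> \<beta> \<noteq> ezero \<O> (tgt G \<gamma>)}" (is "_ = finsum ?S _ ?A")
proof -
  interpret R: ring ?S using ring_stalk \<gamma> by simp
  have "(f \<star> g) \<gamma> = finsum ?S (\<lambda>(\<beta>, \<rho>). emul \<O> (f \<beta>) (act \<O> \<beta> (g \<rho>))) ((\<lambda>\<beta>. (\<beta>, ginv G \<beta> \<cdot> \<gamma>)) ` ?A)"
    using \<gamma> by (simp add: convolution_def factorisations [OF \<gamma>])
  also have "\<dots> = finsum ?S (\<lambda>\<beta>. (\<lambda>(\<beta>, \<rho>). emul \<O> (f \<beta>) (act \<O> \<beta> (g \<rho>))) (\<beta>, ginv G \<beta> \<cdot> \<gamma>)) ?A"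
    by (rule R.finsum_reindex)
      (use fg \<gamma> in \<open>auto simp: inj_on_def simp flip: cterm_def intro: cterm_closed\<close>)
  finally show ?thesis
    by (simp add: cterm_def [abs_def])
qed

text \<open>The index set in the definition of convolution changes with \<open>f\<close> and
  \<open>g\<close>. Replacing it by any finite set that contains all nonzero terms allows sums for
  different functions to be compared over one index set.\<close>

lemma conv_eq_finsum:
  assumes fg: "f \<in> sections" "g \<in> sections" and \<gamma>: "\<gamma> \<in> arrows G"
    and B: "finite B" "B \<subseteq> {\<beta> \<in> arrows G. tgt G \<beta> = tgt G \<gamma>}"
    and 0: "\<And>\<beta>. \<beta> \<in> arrows G \<Longrightarrow> tgt G \<beta> = tgt G \<gamma> \<Longrightarrow> \<beta> \<notin> B \<Longrightarrow> cterm f g \<gamma> \<beta> = ezero \<O> (tgt G \<gamma>)"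
  shows "(f \<star> g) \<gamma> = finsum (stalk \<O> (tgt G \<gamma>)) (cterm f g \<gamma>) B"
proof -
  interpret R: ring "stalk \<O> (tgt G \<gamma>)" using ring_stalk \<gamma> by simp
  show ?thesis
    unfolding conv_eq_finsum_support [OF fg \<gamma>]
    by (rule R.add.finprod_mono_neutral_cong_left) (use B 0 in \<open>auto intro: cterm_closed fg \<gamma>\<close>)
qed

lemma conv_closed [simp]:
  assumes fg: "f \<in> sections" "g \<in> sections"
  shows "f \<star> g \<in> sections"
  unfolding sections_iff
proof (intro conjI ballI)
  show "f \<star> g \<in> extensional (arrows G)" by (simp add: convolution_def)
  fix \<gamma> assume \<gamma>: "\<gamma> \<in> arrows G"
  interpret R: ring "stalk \<O> (tgt G \<gamma>)" using ring_stalk \<gamma> by simp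
  show "(f \<star> g) \<gamma> \<in> fib (tgt G \<gamma>)"
    unfolding conv_eq_finsum_support [OF fg \<gamma>]
    by (rule R.finsum_closed) (auto intro: cterm_closed fg \<gamma>)
qed

lemma conv_eq_single:
  assumes fg: "f \<in> sections" "g \<in> sections" and \<gamma>: "\<gamma> \<in> arrows G" and \<beta>: "\<beta> \<in> arrows G" "tgt G \<beta> = tgt G \<gamma>"
    and 0: "\<And>\<beta>'. \<beta>' \<in> arrows G \<Longrightarrow> tgt G \<beta>' = tgt G \<gamma> \<Longrightarrow> \<beta>' \<noteq> \<beta> \<Longrightarrow> cterm f g \<gamma> \<beta>' = ezero \<O> (tgt G \<gamma>)"
  shows "(f \<star> g) \<gamma> = cterm f g \<gamma> \<beta>"
proof -
  interpret R: ring "stalk \<O> (tgt G \<gamma>)" using ring_stalk \<gamma> by simp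
  have "(f \<star> g) \<gamma> = finsum (stalk \<O> (tgt G \<gamma>)) (cterm f g \<gamma>) {\<beta>}"
    by (rule conv_eq_finsum [OF fg \<gamma>]) (use \<beta> 0 in auto)
  then show ?thesis
    using cterm_closed [OF fg \<beta>(1) \<gamma> \<beta>(2)] by (simp add: R.add.finprod_insert)
qed

lemma conv_nonzero:
  assumes fg: "f \<in> sections" "g \<in> sections" and \<gamma>: "\<gamma> \<in> arrows G" and nz: "(f \<star> g) \<gamma> \<noteq> ezero \<O> (tgt G \<gamma>)"
  obtains \<beta> where "\<beta> \<in> arrows G" "tgt G \<beta> = tgt G \<gamma>" "f \<beta> \<noteq> ezero \<O> (tgt G \<gamma>)"
    "g (ginv G \<beta> \<cdot> \<gamma>) \<noteq> ezero \<O> (src G \<beta>)"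
proof -
  interpret R: ring "stalk \<O> (tgt G \<gamma>)" using ring_stalk \<gamma> by simp
  have "\<exists>\<beta>. \<beta> \<in> arrows G \<and> tgt G \<beta> = tgt G \<gamma> \<and> cterm f g \<gamma> \<beta> \<noteq> ezero \<O> (tgt G \<gamma>)"
    using nz conv_eq_finsum [OF fg \<gamma>, of "{}"] by auto
  then show thesis
    using that cterm_zero [OF fg _ \<gamma>] by blast
qed

text \<open>A left factor with this property makes every convolution sum finite, whatever the right
  factor, so the value zero of \<open>finsum\<close> on infinite sets never enters.\<close>

definition fibfin :: "('g \<Rightarrow> 'e) \<Rightarrow> bool" where
  "fibfin f \<longleftrightarrow> (\<forall>x. finite {\<beta> \<in> arrows G. tgt G \<beta> = x \<and> f \<beta> \<noteq> ezero \<O> x})"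

text \<open>A bisection meets each range fibre in at most one arrow, so a sum of generators is
  nonzero there at no more arrows than it has summands.\<close>

lemma Gam_fibfin: "f \<in> Gam \<Longrightarrow> fibfin f"
proof (induction rule: Gamma_c_on_induct)
  case zero
  then show ?case by (simp add: fibfin_def cong: conj_cong)
next
  case (add U f g)
  show ?case
    unfolding fibfin_def
  proof
    fix x
    note F = bsecD [OF add(1)]
    have "{\<beta> \<in> arrows G. tgt G \<beta> = x \<and> f \<beta> \<noteq> ezero \<O> x} \<subseteq> {slice U x}"
    proof clarify
      fix \<beta> assume "\<beta> \<in> arrows G" "f \<beta> \<noteq> ezero \<O> (tgt G \<beta>)"
      then have "\<beta> \<in> U" using F(4) by blast
      then show "\<beta> = slice U (tgt G \<beta>)" using F(2) by simp
    qed
    then have "finite ({\<beta> \<in> arrows G. tgt G \<beta> = x \<and> f \<beta> \<noteq> ezero \<O> x} \<union> {\<beta> \<in> arrows G. tgt G \<beta> = x \<and> g \<beta> \<noteq> ezero \<O> x})"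
      using add(4) finite_subset unfolding fibfin_def by blast
    moreover have "{\<beta> \<in> arrows G. tgt G \<beta> = x \<and> sadd f g \<beta> \<noteq> ezero \<O> x} \<subseteq>
        {\<beta> \<in> arrows G. tgt G \<beta> = x \<and> f \<beta> \<noteq> ezero \<O> x} \<union> {\<beta> \<in> arrows G. tgt G \<beta> = x \<and> g \<beta> \<noteq> ezero \<O> x}"
      by auto
    ultimately show "finite {\<beta> \<in> arrows G. tgt G \<beta> = x \<and> sadd f g \<beta> \<noteq> ezero \<O> x}"
      by (rule finite_subset [rotated])
  qed
qed

section \<open>Biadditivity of convolution\<close>

lemma conv_sadd_left:
  assumes s: "f \<in> sections" "f' \<in> sections" "g \<in> sections" and fin: "fibfin f" "fibfin f'"
  shows "sadd f f' \<star> g = sadd (f \<star> g) (f' \<star> g)"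
proof (rule sections_eqI)
  fix \<gamma> assume \<gamma>: "\<gamma> \<in> arrows G"
  interpret R: ring "stalk \<O> (tgt G \<gamma>)" using ring_stalk \<gamma> by simp
  define B where "B = {\<beta> \<in> arrows G. tgt G \<beta> = tgt G \<gamma> \<and> f \<beta> \<noteq> ezero \<O> (tgt G \<gamma>)} \<union>
     {\<beta> \<in> arrows G. tgt G \<beta> = tgt G \<gamma> \<and> f' \<beta> \<noteq> ezero \<O> (tgt G \<gamma>)}"
  have B: "finite B" "B \<subseteq> {\<beta> \<in> arrows G. tgt G \<beta> = tgt G \<gamma>}"
    using fin by (auto simp: B_def fibfin_def)
  have 0: "(h \<star> g) \<gamma> = finsum (stalk \<O> (tgt G \<gamma>)) (cterm h g \<gamma>) B"
    if "h \<in> sections" "\<And>\<beta>. \<beta> \<in> arrows G \<Longrightarrow> tgt G \<beta> = tgt G \<gamma> \<Longrightarrow> \<beta> \<notin> B \<Longrightarrow> h \<beta> = ezero \<O> (tgt G \<gamma>)" for h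
    using that s by (intro conv_eq_finsum B \<gamma> cterm_zero) auto
  have cl: "cterm h k \<gamma> \<in> B \<rightarrow> fib (tgt G \<gamma>)" if "h \<in> sections" "k \<in> sections" for h k
    using B(2) \<gamma> that by (intro Pi_I cterm_closed) auto
  have "cterm (sadd f f') g \<gamma> \<beta> = eadd \<O> (cterm f g \<gamma> \<beta>) (cterm f' g \<gamma> \<beta>)" if "\<beta> \<in> B" for \<beta>
  proof -
    have \<beta>: "\<beta> \<in> arrows G" "tgt G \<beta> = tgt G \<gamma>" using that B by auto
    show ?thesis
      using \<beta> cterm_factor_closed(2) [OF s(3) \<beta>(1) \<gamma> \<beta>(2)] sections_fib_eq [OF s(1) \<beta>] sections_fib_eq [OF s(2) \<beta>]
      by (simp add: cterm_def eadd_emul)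
  qed
  then have "finsum (stalk \<O> (tgt G \<gamma>)) (cterm (sadd f f') g \<gamma>) B
      = finsum (stalk \<O> (tgt G \<gamma>)) (\<lambda>\<beta>. eadd \<O> (cterm f g \<gamma> \<beta>) (cterm f' g \<gamma> \<beta>)) B"
    using B cterm_closed s \<gamma> by (intro R.add.finprod_cong') auto
  also have "\<dots> = eadd \<O> (finsum (stalk \<O> (tgt G \<gamma>)) (cterm f g \<gamma>) B) (finsum (stalk \<O> (tgt G \<gamma>)) (cterm f' g \<gamma>) B)"
    using cl s R.finsum_addf [of "cterm f g \<gamma>" B "cterm f' g \<gamma>"] by simp
  finally have "finsum (stalk \<O> (tgt G \<gamma>)) (cterm (sadd f f') g \<gamma>) B = \<dots>" .
  moreover have "f \<beta> = ezero \<O> (tgt G \<gamma>)" "f' \<beta> = ezero \<O> (tgt G \<gamma>)" "sadd f f' \<beta> = ezero \<O> (tgt G \<gamma>)"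
    if "\<beta> \<in> arrows G" "tgt G \<beta> = tgt G \<gamma>" "\<beta> \<notin> B" for \<beta>
    using that \<gamma> by (auto simp: B_def)
  ultimately show "(sadd f f' \<star> g) \<gamma> = sadd (f \<star> g) (f' \<star> g) \<gamma>"
    using 0 [of f] 0 [of f'] 0 [of "sadd f f'"] s \<gamma> by simp
qed (use s in auto)

lemma conv_sadd_right:
  assumes s: "f \<in> sections" "g \<in> sections" "g' \<in> sections" and fin: "fibfin f"
  shows "f \<star> sadd g g' = sadd (f \<star> g) (f \<star> g')"
proof (rule sections_eqI)
  fix \<gamma> assume \<gamma>: "\<gamma> \<in> arrows G"
  interpret R: ring "stalk \<O> (tgt G \<gamma>)" using ring_stalk \<gamma> by simp
  define B where "B = {\<beta> \<in> arrows G. tgt G \<beta> = tgt G \<gamma> \<and> f \<beta> \<noteq> ezero \<O> (tgt G \<gamma>)}"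
  have B: "finite B" "B \<subseteq> {\<beta> \<in> arrows G. tgt G \<beta> = tgt G \<gamma>}"
    using fin by (auto simp: B_def fibfin_def)
  have 0: "(f \<star> h) \<gamma> = finsum (stalk \<O> (tgt G \<gamma>)) (cterm f h \<gamma>) B" if "h \<in> sections" for h
    using that s by (intro conv_eq_finsum B \<gamma> cterm_zero) (auto simp: B_def)
  have cl: "cterm h k \<gamma> \<in> B \<rightarrow> fib (tgt G \<gamma>)" if "h \<in> sections" "k \<in> sections" for h k
    using B(2) \<gamma> that by (intro Pi_I cterm_closed) auto
  have "cterm f (sadd g g') \<gamma> \<beta> = eadd \<O> (cterm f g \<gamma> \<beta>) (cterm f g' \<gamma> \<beta>)" if "\<beta> \<in> B" for \<beta>
  proof -
    have \<beta>: "\<beta> \<in> arrows G" "tgt G \<beta> = tgt G \<gamma>" using that B by auto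
    show ?thesis
      using \<beta> \<gamma> cterm_factor_closed [OF s(2) \<beta>(1) \<gamma> \<beta>(2)] cterm_factor_closed [OF s(3) \<beta>(1) \<gamma> \<beta>(2)]
        sections_fib_eq [OF s(1) \<beta>]
      by (simp add: cterm_def emul_eadd act_eadd)
  qed
  then have "finsum (stalk \<O> (tgt G \<gamma>)) (cterm f (sadd g g') \<gamma>) B
      = finsum (stalk \<O> (tgt G \<gamma>)) (\<lambda>\<beta>. eadd \<O> (cterm f g \<gamma> \<beta>) (cterm f g' \<gamma> \<beta>)) B"
    using B cterm_closed s \<gamma> by (intro R.add.finprod_cong') auto
  also have "\<dots> = eadd \<O> (finsum (stalk \<O> (tgt G \<gamma>)) (cterm f g \<gamma>) B) (finsum (stalk \<O> (tgt G \<gamma>)) (cterm f g' \<gamma>) B)"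
    using cl s R.finsum_addf [of "cterm f g \<gamma>" B "cterm f g' \<gamma>"] by simp
  finally show "(f \<star> sadd g g') \<gamma> = sadd (f \<star> g) (f \<star> g') \<gamma>"
    using s \<gamma> by (simp add: 0)
qed (use s in auto)

lemma conv_szero [simp]:
  assumes "f \<in> sections"
  shows "szero \<star> f = szero" "f \<star> szero = szero"
proof -
  show "szero \<star> f = szero"
  proof (rule sections_eqI)
    show "(szero \<star> f) \<gamma> = szero \<gamma>" if "\<gamma> \<in> arrows G" for \<gamma>
      using conv_nonzero [of szero f \<gamma>] assms that by (metis szero_apply szero_closed)
  qed (use assms in auto)
  show "f \<star> szero = szero"
  proof (rule sections_eqI)
    fix \<gamma> assume \<gamma>: "\<gamma> \<in> arrows G"
    then have "szero (ginv G \<beta> \<cdot> \<gamma>) = ezero \<O> (src G \<beta>)" if "\<beta> \<in> arrows G" "tgt G \<beta> = tgt G \<gamma>" for \<beta>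
      using that by simp
    then show "(f \<star> szero) \<gamma> = szero \<gamma>"
      using conv_nonzero [of f szero \<gamma>] assms \<gamma> by (metis szero_apply szero_closed)
  qed (use assms in auto)
qed

text \<open>Injectivity of the range map on \<open>U\<close> leaves a single factorisation of
  \<gamma> with left factor in \<open>U\<close>.\<close>

lemma conv_bsec_left:
  assumes f: "bsec U f" and g: "g \<in> sections" and \<gamma>: "\<gamma> \<in> arrows G" and \<beta>: "\<beta> \<in> U" "tgt G \<beta> = tgt G \<gamma>"
  shows "(f \<star> g) \<gamma> = emul \<O> (f \<beta>) (act \<O> \<beta> (g (ginv G \<beta> \<cdot> \<gamma>)))"
  unfolding cterm_def [symmetric]
proof (rule conv_eq_single)
  note F = bsecD [OF f]
  show \<beta>_arr: "\<beta> \<in> arrows G" using \<beta> cob_arrows [OF F(2)] by blast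
  fix \<beta>' assume \<beta>': "\<beta>' \<in> arrows G" "tgt G \<beta>' = tgt G \<gamma>" "\<beta>' \<noteq> \<beta>"
  then have "\<beta>' \<notin> U"
    using bisectionD(3) [OF cob_bisection [OF F(2)]] \<beta> by metis
  then show "cterm f g \<gamma> \<beta>' = ezero \<O> (tgt G \<gamma>)"
    using \<beta>' F(1,4) g \<gamma> by (intro cterm_zero) auto
qed (use assms bsecD(1) in auto)

lemma conv_bsec_left_outside:
  assumes f: "bsec U f" and g: "g \<in> sections" and \<gamma>: "\<gamma> \<in> arrows G" and "tgt G \<gamma> \<notin> tgt G ` U"
  shows "(f \<star> g) \<gamma> = ezero \<O> (tgt G \<gamma>)"
  using assms conv_nonzero [of f g \<gamma>] bsecD [OF f] by (metis image_eqI)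

text \<open>Here the right factor is fixed by its source, and the left factor is solved for as
  \<gamma> times the inverse of \<rho>.\<close>

lemma conv_bsec_right:
  assumes f: "f \<in> sections" and g: "bsec V g" and \<gamma>: "\<gamma> \<in> arrows G" and \<rho>: "\<rho> \<in> V" "src G \<rho> = src G \<gamma>"
  shows "(f \<star> g) \<gamma> = emul \<O> (f (\<gamma> \<cdot> ginv G \<rho>)) (act \<O> (\<gamma> \<cdot> ginv G \<rho>) (g \<rho>))"
proof -
  note H = bsecD [OF g]
  have \<rho>_arr: "\<rho> \<in> arrows G" using \<rho> cob_arrows [OF H(2)] by blast
  let ?\<beta> = "\<gamma> \<cdot> ginv G \<rho>"
  have \<beta>: "?\<beta> \<in> arrows G" "tgt G ?\<beta> = tgt G \<gamma>" using \<gamma> \<rho> \<rho>_arr by auto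
  have inv: "ginv G ?\<beta> \<cdot> \<gamma> = \<rho>"
    using \<gamma> \<rho> \<rho>_arr by (simp add: ginv_mult_distrib mult_assoc flip: \<rho>(2))
  have "(f \<star> g) \<gamma> = cterm f g \<gamma> ?\<beta>"
  proof (rule conv_eq_single [OF f H(1) \<gamma> \<beta>])
    fix \<beta>' assume \<beta>': "\<beta>' \<in> arrows G" "tgt G \<beta>' = tgt G \<gamma>" "\<beta>' \<noteq> ?\<beta>"
    let ?\<rho>' = "ginv G \<beta>' \<cdot> \<gamma>"
    have r: "?\<rho>' \<in> arrows G" "src G ?\<rho>' = src G \<gamma>" "tgt G ?\<rho>' = src G \<beta>'"
      using \<beta>' \<gamma> by auto
    have "?\<rho>' \<notin> V"
    proof
      assume "?\<rho>' \<in> V"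
      then have "?\<rho>' = \<rho>"
        using bisectionD(2) [OF cob_bisection [OF H(2)]] \<rho> r(2) by metis
      then have "\<beta>' \<cdot> \<rho> = \<gamma>" "src G \<beta>' = tgt G \<rho>"
        using \<beta>' \<gamma> r(3) by auto
      then have "?\<beta> = \<beta>'"
        using \<beta>'(1) \<rho>_arr mult_src [OF \<beta>'(1)] by (auto simp: mult_assoc)
      then show False using \<beta>'(3) by simp
    qed
    then show "cterm f g \<gamma> \<beta>' = ezero \<O> (tgt G \<gamma>)"
      using \<beta>' H(4) [OF r(1)] r(3) f H(1) \<gamma> by (intro cterm_zero) auto
  qed
  then show ?thesis by (simp add: cterm_def inv)
qed

lemma conv_bsec_right_outside:
  assumes f: "f \<in> sections" and g: "bsec V g" and \<gamma>: "\<gamma> \<in> arrows G" and out: "src G \<gamma> \<notin> src G ` V"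
  shows "(f \<star> g) \<gamma> = ezero \<O> (tgt G \<gamma>)"
proof (rule ccontr)
  assume "(f \<star> g) \<gamma> \<noteq> ezero \<O> (tgt G \<gamma>)"
  then obtain \<beta> where \<beta>: "\<beta> \<in> arrows G" "tgt G \<beta> = tgt G \<gamma>" "g (ginv G \<beta> \<cdot> \<gamma>) \<noteq> ezero \<O> (src G \<beta>)"
    using conv_nonzero [OF f bsecD(1) [OF g] \<gamma>] by blast
  then have "ginv G \<beta> \<cdot> \<gamma> \<in> V"
    using bsecD(4) [OF g, of "ginv G \<beta> \<cdot> \<gamma>"] \<gamma> by fastforce
  moreover have "src G (ginv G \<beta> \<cdot> \<gamma>) = src G \<gamma>" using \<beta> \<gamma> by simp
  ultimately show False using out by (metis image_eqI)
qed

lemma bis_multE: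
  assumes "\<gamma> \<in> bis_mult U V" "U \<in> cob" "V \<in> cob"
  obtains \<beta> \<rho> where "\<gamma> = \<beta> \<cdot> \<rho>" "\<beta> \<in> U" "\<rho> \<in> V" "\<beta> \<in> arrows G" "\<rho> \<in> arrows G" "src G \<beta> = tgt G \<rho>"
  using assms cob_arrows unfolding bis_mult_def by blast

lemma conv_bsec_bsec:
  assumes f: "bsec U f" and g: "bsec V g" and "\<beta> \<in> U" "\<rho> \<in> V" "src G \<beta> = tgt G \<rho>"
  shows "(f \<star> g) (\<beta> \<cdot> \<rho>) = emul \<O> (f \<beta>) (act \<O> \<beta> (g \<rho>))"
proof -
  have "\<beta> \<in> arrows G" "\<rho> \<in> arrows G" using assms cob_arrows bsecD(2) by blast+
  then show ?thesis
    using conv_bsec_left [OF f bsecD(1) [OF g], of "\<beta> \<cdot> \<rho>" \<beta>] assms by simp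
qed

text \<open>An arrow of the product bisection has exactly one factorisation, its left factor being
  the slice of \<open>U\<close> at its range. Both factors depend continuously on the arrow, hence
  so does the single term of the convolution.\<close>

lemma bsec_conv:
  assumes f: "bsec U f" and g: "bsec V g"
  shows "bsec (bis_mult U V) (f \<star> g)"
proof -
  note F = bsecD [OF f] and H = bsecD [OF g]
  have arr: "U \<subseteq> arrows G" "V \<subseteq> arrows G" using F H cob_arrows by auto
  have W: "bis_mult U V \<in> cob" using F H cob_bis_mult by blast
  let ?X = "subtopology (gtop G) (bis_mult U V)"
  have top: "topspace ?X = bis_mult U V" using W by (rule topspace_cob)
  have sl: "\<exists>\<beta> \<rho>. \<delta> = \<beta> \<cdot> \<rho> \<and> \<beta> \<in> U \<and> \<rho> \<in> V \<and> \<beta> \<in> arrows G \<and> \<rho> \<in> arrows G \<and> src G \<beta> = tgt G \<rho> \<and>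
      slice U (tgt G \<delta>) = \<beta> \<and> ginv G \<beta> \<cdot> \<delta> = \<rho>" if \<delta>: "\<delta> \<in> bis_mult U V" for \<delta>
  proof -
    obtain \<beta> \<rho> where "\<delta> = \<beta> \<cdot> \<rho>" "\<beta> \<in> U" "\<rho> \<in> V" "\<beta> \<in> arrows G" "\<rho> \<in> arrows G" "src G \<beta> = tgt G \<rho>"
      using \<delta> F(2) H(2) by (rule bis_multE)
    then show ?thesis using F(2) by (intro exI [of _ \<beta>] exI [of _ \<rho>]) auto
  qed
  have c1: "continuous_map ?X (gtop G) (\<lambda>\<delta>. slice U (tgt G \<delta>))"
  proof (intro continuous_map_slice F continuous_map_tgt continuous_map_id_subtopology)
    fix \<delta> assume "\<delta> \<in> topspace ?X"
    then obtain \<beta> \<rho> where "\<delta> = \<beta> \<cdot> \<rho>" "\<beta> \<in> U" "\<beta> \<in> arrows G" "\<rho> \<in> arrows G" "src G \<beta> = tgt G \<rho>"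
      using sl [of \<delta>] top by blast
    then show "tgt G \<delta> \<in> tgt G ` U" by simp
  qed
  have c2: "continuous_map ?X (gtop G) (\<lambda>\<delta>. ginv G (slice U (tgt G \<delta>)) \<cdot> \<delta>)"
  proof (intro continuous_map_mult continuous_map_ginv c1 continuous_map_id_subtopology)
    fix \<delta> assume "\<delta> \<in> topspace ?X"
    then obtain \<beta> \<rho> where "\<delta> = \<beta> \<cdot> \<rho>" "\<beta> \<in> arrows G" "\<rho> \<in> arrows G" "src G \<beta> = tgt G \<rho>"
       "slice U (tgt G \<delta>) = \<beta>"
      using sl [of \<delta>] top by blast
    then show "src G (ginv G (slice U (tgt G \<delta>))) = tgt G \<delta>" by simp
  qed
  have c1': "continuous_map ?X (subtopology (gtop G) U) (\<lambda>\<delta>. slice U (tgt G \<delta>))"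
    using c1 sl top by (fastforce simp: continuous_map_in_subtopology)
  have c2': "continuous_map ?X (subtopology (gtop G) V) (\<lambda>\<delta>. ginv G (slice U (tgt G \<delta>)) \<cdot> \<delta>)"
    using c2 sl top by (fastforce simp: continuous_map_in_subtopology)
  have fc: "continuous_map ?X (etop \<O>) (\<lambda>\<delta>. f (slice U (tgt G \<delta>)))"
    using continuous_map_compose [OF c1' F(3)] by (simp add: o_def)
  have gc: "continuous_map ?X (etop \<O>) (\<lambda>\<delta>. g (ginv G (slice U (tgt G \<delta>)) \<cdot> \<delta>))"
    using continuous_map_compose [OF c2' H(3)] by (simp add: o_def)
  have ac: "continuous_map ?X (etop \<O>) (\<lambda>\<delta>. act \<O> (slice U (tgt G \<delta>)) (g (ginv G (slice U (tgt G \<delta>)) \<cdot> \<delta>)))"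
  proof (intro continuous_map_act c1 gc)
    fix \<delta> assume "\<delta> \<in> topspace ?X"
    then obtain \<beta> \<rho> where "slice U (tgt G \<delta>) = \<beta>" "ginv G \<beta> \<cdot> \<delta> = \<rho>" "\<rho> \<in> arrows G" "src G \<beta> = tgt G \<rho>"
      using sl [of \<delta>] top by blast
    then show "src G (slice U (tgt G \<delta>)) = proj \<O> (g (ginv G (slice U (tgt G \<delta>)) \<cdot> \<delta>))"
      using H(1) by (simp add: proj_sections)
  qed
  have "continuous_map ?X (etop \<O>) (f \<star> g)"
  proof (rule continuous_map_eq [OF continuous_map_emul [OF fc ac]])
    fix \<delta> assume "\<delta> \<in> topspace ?X"
    then obtain \<beta> \<rho> where *: "\<delta> = \<beta> \<cdot> \<rho>" "\<beta> \<in> U" "\<rho> \<in> V" "\<beta> \<in> arrows G" "\<rho> \<in> arrows G" "src G \<beta> = tgt G \<rho>"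
      "slice U (tgt G \<delta>) = \<beta>" "ginv G \<beta> \<cdot> \<delta> = \<rho>"
      using sl [of \<delta>] top by blast
    have "act \<O> \<beta> (g \<rho>) \<in> fib (tgt G \<beta>)"
      using * sections_fib [OF H(1) *(5)] by (intro act_closed) auto
    then show "proj \<O> (f (slice U (tgt G \<delta>))) = proj \<O> (act \<O> (slice U (tgt G \<delta>)) (g (ginv G (slice U (tgt G \<delta>)) \<cdot> \<delta>)))"
      using * F(1) by (simp only: *(7,8)) (simp add: proj_sections proj_fib)
    show "emul \<O> (f (slice U (tgt G \<delta>))) (act \<O> (slice U (tgt G \<delta>)) (g (ginv G (slice U (tgt G \<delta>)) \<cdot> \<delta>))) = (f \<star> g) \<delta>"
      using conv_bsec_bsec [OF f g *(2,3,6)] by (simp only: *(7,8)) (simp add: *(1))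
  qed
  moreover have "(f \<star> g) \<gamma> = ezero \<O> (tgt G \<gamma>)" if \<gamma>: "\<gamma> \<in> arrows G" "\<gamma> \<notin> bis_mult U V" for \<gamma>
  proof (rule ccontr)
    assume "(f \<star> g) \<gamma> \<noteq> ezero \<O> (tgt G \<gamma>)"
    then obtain \<beta> where \<beta>: "\<beta> \<in> arrows G" "tgt G \<beta> = tgt G \<gamma>" "f \<beta> \<noteq> ezero \<O> (tgt G \<gamma>)"
        "g (ginv G \<beta> \<cdot> \<gamma>) \<noteq> ezero \<O> (src G \<beta>)"
      using conv_nonzero [OF F(1) H(1) \<gamma>(1)] by blast
    then have "\<beta> \<in> U" "ginv G \<beta> \<cdot> \<gamma> \<in> V"
      using F(4) [OF \<beta>(1)] H(4) [of "ginv G \<beta> \<cdot> \<gamma>"] \<gamma>(1) by auto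
    moreover have "\<gamma> = \<beta> \<cdot> (ginv G \<beta> \<cdot> \<gamma>)" "src G \<beta> = tgt G (ginv G \<beta> \<cdot> \<gamma>)"
      using \<beta> \<gamma>(1) by auto
    ultimately show False using \<gamma>(2) unfolding bis_mult_def by blast
  qed
  ultimately show ?thesis
    using W F H by (simp add: bsec_def)
qed

section \<open>Ring axioms on the convolution ring\<close>

lemma Gam_sadd: "f \<in> Gam \<Longrightarrow> g \<in> Gam \<Longrightarrow> sadd f g \<in> Gam"
  and Gam_szero: "szero \<in> Gam"
  and Gam_sneg: "f \<in> Gam \<Longrightarrow> sneg f \<in> Gam"
  using Gamma_c_on_add_closed [of "arrows G"] by (auto simp: add_closed_def)

lemma Gam_conv_sadd_left: "f \<in> Gam \<Longrightarrow> f' \<in> Gam \<Longrightarrow> g \<in> Gam \<Longrightarrow> sadd f f' \<star> g = sadd (f \<star> g) (f' \<star> g)"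
  by (simp add: conv_sadd_left Gam_sections Gam_fibfin)

lemma Gam_conv_sadd_right: "f \<in> Gam \<Longrightarrow> g \<in> Gam \<Longrightarrow> g' \<in> Gam \<Longrightarrow> f \<star> sadd g g' = sadd (f \<star> g) (f \<star> g')"
  by (simp add: conv_sadd_right Gam_sections Gam_fibfin)

lemma Gam_conv_closed: "f \<in> Gam \<Longrightarrow> g \<in> Gam \<Longrightarrow> f \<star> g \<in> Gam"
proof (induction f rule: Gamma_c_on_induct)
  case zero
  then show ?case by (simp add: Gam_sections Gam_szero)
next
  case (add U f f')
  have "f \<star> g \<in> Gam"
    using add(5)
  proof (induction g rule: Gamma_c_on_induct)
    case zero
    then show ?case using add(1) by (simp add: bsecD Gam_szero)
  next
    case (add V g g')
    then show ?case
      using \<open>bsec U f\<close> by (simp add: Gam_conv_sadd_right bsec_Gam Gam_sadd bsec_conv [THEN bsec_Gam])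
  qed
  then show ?case
    using add by (simp add: Gam_conv_sadd_left bsec_Gam Gam_sadd)
qed

text \<open>With \<beta> in \<open>U\<close> and \<rho> in \<open>V\<close> fixed by the ranges,
  each side has at most one term, and these agree by associativity in the stalk and multiplicativity
  of the action. Biadditivity then extends the law to \<open>R\<close> without interchanging double
  sums.\<close>

lemma conv_assoc_bsec:
  assumes f: "bsec U f" and g: "bsec V g" and h: "h \<in> sections"
  shows "(f \<star> g) \<star> h = f \<star> (g \<star> h)"
proof (rule sections_eqI)
  note F = bsecD [OF f] and H = bsecD [OF g]
  have arr: "U \<subseteq> arrows G" "V \<subseteq> arrows G" using F H cob_arrows by auto
  fix \<gamma> assume \<gamma>: "\<gamma> \<in> arrows G"
  note fg = bsec_conv [OF f g]
  have gh: "g \<star> h \<in> sections" using H h by simp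
  show "((f \<star> g) \<star> h) \<gamma> = (f \<star> (g \<star> h)) \<gamma>"
  proof (cases "tgt G \<gamma> \<in> tgt G ` U")
    case False
    then have "tgt G \<gamma> \<notin> tgt G ` bis_mult U V"
      using arr unfolding bis_mult_def by (auto simp: subset_iff)
    then show ?thesis
      using False \<gamma> by (simp add: conv_bsec_left_outside [OF f gh] conv_bsec_left_outside [OF fg h])
  next
    case True
    then obtain \<beta> where \<beta>: "\<beta> \<in> U" "tgt G \<beta> = tgt G \<gamma>" by auto
    then have \<beta>_arr: "\<beta> \<in> arrows G" using arr by blast
    let ?\<delta> = "ginv G \<beta> \<cdot> \<gamma>"
    have \<delta>: "?\<delta> \<in> arrows G" "tgt G ?\<delta> = src G \<beta>" using \<beta>_arr \<beta> \<gamma> by auto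
    have f\<beta>: "f \<beta> \<in> fib (tgt G \<gamma>)" using sections_fib [OF F(1) \<beta>_arr] \<beta>(2) by simp
    have rhs: "(f \<star> (g \<star> h)) \<gamma> = emul \<O> (f \<beta>) (act \<O> \<beta> ((g \<star> h) ?\<delta>))"
      using conv_bsec_left [OF f gh \<gamma> \<beta>] .
    show ?thesis
    proof (cases "src G \<beta> \<in> tgt G ` V")
      case False
      have "tgt G \<gamma> \<notin> tgt G ` bis_mult U V"
      proof
        assume "tgt G \<gamma> \<in> tgt G ` bis_mult U V"
        then obtain \<beta>' \<rho> where "tgt G \<gamma> = tgt G (\<beta>' \<cdot> \<rho>)" "\<beta>' \<in> U" "\<rho> \<in> V" "\<beta>' \<in> arrows G" "\<rho> \<in> arrows G" "src G \<beta>' = tgt G \<rho>"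
          using bis_multE [OF _ F(2) H(2)] by (metis imageE)
        then show False
          using False bisectionD(3) [OF cob_bisection [OF F(2)] \<beta>(1), of \<beta>'] \<beta>(2) by auto
      qed
      then have "((f \<star> g) \<star> h) \<gamma> = ezero \<O> (tgt G \<gamma>)"
        by (rule conv_bsec_left_outside [OF fg h \<gamma>])
      moreover have "(g \<star> h) ?\<delta> = ezero \<O> (src G \<beta>)"
        using conv_bsec_left_outside [OF g h \<delta>(1)] False \<delta>(2) by simp
      ultimately show ?thesis
        using rhs \<beta>_arr \<beta>(2) f\<beta> by simp
    next
      case True
      then obtain \<rho> where \<rho>: "\<rho> \<in> V" "tgt G \<rho> = src G \<beta>" by auto
      then have \<rho>_arr: "\<rho> \<in> arrows G" using arr by blast
      have m: "\<beta> \<cdot> \<rho> \<in> bis_mult U V" using \<beta> \<rho> unfolding bis_mult_def by force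
      have "((f \<star> g) \<star> h) \<gamma> = emul \<O> ((f \<star> g) (\<beta> \<cdot> \<rho>)) (act \<O> (\<beta> \<cdot> \<rho>) (h (ginv G (\<beta> \<cdot> \<rho>) \<cdot> \<gamma>)))"
        using \<beta> \<beta>_arr \<rho> \<rho>_arr by (intro conv_bsec_left [OF fg h \<gamma> m]) auto
      also have "ginv G (\<beta> \<cdot> \<rho>) \<cdot> \<gamma> = ginv G \<rho> \<cdot> ?\<delta>"
        using \<beta> \<beta>_arr \<rho> \<rho>_arr \<gamma> by (simp add: ginv_mult_distrib mult_assoc)
      also have "(f \<star> g) (\<beta> \<cdot> \<rho>) = emul \<O> (f \<beta>) (act \<O> \<beta> (g \<rho>))"
        using conv_bsec_bsec [OF f g \<beta>(1) \<rho>(1)] \<rho>(2) by simp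
      finally have lhs: "((f \<star> g) \<star> h) \<gamma> = emul \<O> (emul \<O> (f \<beta>) (act \<O> \<beta> (g \<rho>))) (act \<O> (\<beta> \<cdot> \<rho>) (h (ginv G \<rho> \<cdot> ?\<delta>)))" .
      have gr: "g \<rho> \<in> fib (src G \<beta>)" using sections_fib [OF H(1) \<rho>_arr] \<rho>(2) by simp
      have hr: "h (ginv G \<rho> \<cdot> ?\<delta>) \<in> fib (src G \<rho>)" "act \<O> \<rho> (h (ginv G \<rho> \<cdot> ?\<delta>)) \<in> fib (src G \<beta>)"
        using cterm_factor_closed [OF h \<rho>_arr \<delta>(1)] \<rho>(2) \<delta>(2) by auto
      have gh_val: "(g \<star> h) ?\<delta> = emul \<O> (g \<rho>) (act \<O> \<rho> (h (ginv G \<rho> \<cdot> ?\<delta>)))"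
        using conv_bsec_left [OF g h \<delta>(1) \<rho>(1)] \<delta>(2) \<rho>(2) by simp
      have cl: "act \<O> \<beta> (g \<rho>) \<in> fib (tgt G \<gamma>)" "act \<O> \<beta> (act \<O> \<rho> (h (ginv G \<rho> \<cdot> ?\<delta>))) \<in> fib (tgt G \<gamma>)"
        using act_closed [OF \<beta>_arr] gr hr \<beta>(2) by fastforce+
      show ?thesis
        unfolding lhs rhs gh_val
        using \<beta>_arr \<rho>_arr \<rho>(2) gr hr f\<beta> cl by (simp add: act_emul act_mult emul_assoc)
    qed
  qed
qed (use assms bsecD(1) in auto)

lemma Gam_conv_assoc: "f \<in> Gam \<Longrightarrow> g \<in> Gam \<Longrightarrow> h \<in> Gam \<Longrightarrow> (f \<star> g) \<star> h = f \<star> (g \<star> h)"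
proof (induction f rule: Gamma_c_on_induct)
  case zero
  then show ?case by (simp add: Gam_sections)
next
  case (add U f f')
  have "(f \<star> g) \<star> h = f \<star> (g \<star> h)"
    using add(5)
  proof (induction g rule: Gamma_c_on_induct)
    case zero
    then show ?case using add by (simp add: bsecD Gam_sections)
  next
    case (add V g g')
    then show ?case
      using \<open>bsec U f\<close> \<open>h \<in> Gam\<close>
      by (simp add: Gam_conv_sadd_right Gam_conv_sadd_left bsec_Gam Gam_conv_closed conv_assoc_bsec Gam_sections)
  qed
  then show ?case
    using add by (simp add: Gam_conv_sadd_left bsec_Gam Gam_conv_closed)
qed

section \<open>The diagonal subring\<close>

text \<open>The unit left factor must be the range of \<gamma>. So a diagonal section scales from
  the left by its value at the range, and from the right by its transported value at the source;
  comparing the two is what detects the kernel.\<close>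

lemma bsec_unit_conv:
  assumes a: "bsec K a" "K \<subseteq> units G" and g: "g \<in> sections" and \<gamma>: "\<gamma> \<in> arrows G"
  shows "(a \<star> g) \<gamma> = emul \<O> (a (tgt G \<gamma>)) (g \<gamma>)"
proof (cases "tgt G \<gamma> \<in> K")
  case True
  have "(a \<star> g) \<gamma> = emul \<O> (a (tgt G \<gamma>)) (act \<O> (tgt G \<gamma>) (g (ginv G (tgt G \<gamma>) \<cdot> \<gamma>)))"
    using \<gamma> by (intro conv_bsec_left [OF a(1) g \<gamma> True]) simp
  then show ?thesis
    using \<gamma> g act_unit_fib [OF sections_fib [OF g \<gamma>]] by simp
next
  case False
  have "tgt G \<beta> \<noteq> tgt G \<gamma>" if "\<beta> \<in> K" for \<beta>
  proof -
    have "tgt G \<beta> = \<beta>" using that a(2) by auto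
    then show ?thesis using False that by metis
  qed
  then have "(a \<star> g) \<gamma> = ezero \<O> (tgt G \<gamma>)"
    by (intro conv_bsec_left_outside [OF a(1) g \<gamma>]) (metis imageE)
  moreover have "a (tgt G \<gamma>) = ezero \<O> (tgt G \<gamma>)"
    using bsecD(4) [OF a(1) _ False] \<gamma> by simp
  ultimately show ?thesis
    using \<gamma> g by (simp add: ezero_emul [OF sections_fib])
qed

lemma bsec_conv_unit:
  assumes a: "bsec K a" "K \<subseteq> units G" and f: "f \<in> sections" and \<gamma>: "\<gamma> \<in> arrows G"
  shows "(f \<star> a) \<gamma> = emul \<O> (f \<gamma>) (act \<O> \<gamma> (a (src G \<gamma>)))"
proof (cases "src G \<gamma> \<in> K")
  case True
  have "(f \<star> a) \<gamma> = emul \<O> (f (\<gamma> \<cdot> ginv G (src G \<gamma>))) (act \<O> (\<gamma> \<cdot> ginv G (src G \<gamma>)) (a (src G \<gamma>)))"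
    using \<gamma> by (intro conv_bsec_right [OF f a(1) \<gamma> True]) simp
  then show ?thesis
    using \<gamma> by simp
next
  case False
  have "src G \<beta> \<noteq> src G \<gamma>" if "\<beta> \<in> K" for \<beta>
  proof -
    have "src G \<beta> = \<beta>" using that a(2) by auto
    then show ?thesis using False that by metis
  qed
  then have "(f \<star> a) \<gamma> = ezero \<O> (tgt G \<gamma>)"
    by (intro conv_bsec_right_outside [OF f a(1) \<gamma>]) (metis imageE)
  moreover have "a (src G \<gamma>) = ezero \<O> (src G \<gamma>)"
    using bsecD(4) [OF a(1) _ False] \<gamma> by simp
  ultimately show ?thesis
    using \<gamma> f by (simp add: emul_ezero [OF sections_fib])
qed

text \<open>\<open>K\<close> is compact in the Hausdorff unit space, hence closed there, so
  \<open>f\<close> is the zero section on an open complement and does not jump at the boundary of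
  \<open>K\<close>.\<close>

lemma bsec_units_continuous:
  assumes f: "bsec K f" "K \<subseteq> units G"
  shows "continuous_map (unit_space G) (etop \<O>) f"
proof (rule continuous_map_locallyI)
  note F = bsecD [OF f(1)]
  have sub: "subtopology (unit_space G) U = subtopology (gtop G) U" if "U \<subseteq> units G" for U
    using that by (simp add: unit_space_def subtopology_subtopology inf_absorb2)
  have C: "openin (unit_space G) (units G - K)"
    using closedin_compact_units [OF cob_compact [OF F(2)] f(2)] by (simp add: closedin_def)
  have "continuous_map (subtopology (unit_space G) (units G - K)) (etop \<O>) (ezero \<O>)"
    by (intro continuous_map_from_subtopology continuous_ezero)
  then have 0: "continuous_map (subtopology (unit_space G) (units G - K)) (etop \<O>) f"
    by (rule continuous_map_eq) (use F(4) units_arrows in auto)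
  fix x assume x: "x \<in> topspace (unit_space G)"
  show "\<exists>U. openin (unit_space G) U \<and> x \<in> U \<and> continuous_map (subtopology (unit_space G) U) (etop \<O>) f"
  proof (cases "x \<in> K")
    case True
    then show ?thesis
      using F(3) f(2) cob_open [OF F(2)] sub [OF f(2)] by (intro exI [of _ K]) (simp add: openin_unit_space)
  next
    case False
    then show ?thesis using C 0 x by (intro exI [of _ "units G - K"]) auto
  qed
qed

lemma bsec_units_iff:
  assumes "K \<subseteq> units G" "K \<in> cob"
  shows "bsec K f \<longleftrightarrow> f \<in> sections \<and> continuous_map (unit_space G) (etop \<O>) f \<and>
    (\<forall>\<gamma> \<in> arrows G - K. f \<gamma> = ezero \<O> (tgt G \<gamma>))"
proof -
  have "continuous_map (subtopology (gtop G) K) (etop \<O>) f" if "continuous_map (unit_space G) (etop \<O>) f"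
    using that assms(1) unfolding unit_space_def by (rule continuous_map_from_subtopology_mono)
  then show ?thesis
    using assms bsec_units_continuous [of K f] by (auto simp: bsec_def)
qed

lemma bsec_units_enlarge:
  assumes "bsec K f" "K \<subseteq> L" "L \<subseteq> units G" "L \<in> cob"
  shows "bsec L f"
  using assms bsec_units_continuous [of K f] bsecD [OF assms(1)] by (auto simp: bsec_units_iff)

text \<open>One bisection is enough here: two compact open sets of units lie in their union, which
  is again one, and extension by zero to it stays continuous. Hence \<open>diag\<close> is closed
  under addition, although generators in general are not.\<close>

definition diag :: "('g \<Rightarrow> 'e) set" where
  "diag = {f. \<exists>K\<subseteq>units G. bsec K f}"

lemma diag_Gam: "f \<in> diag \<Longrightarrow> f \<in> Gam"
  by (auto simp: diag_def bsec_Gam)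

lemma diag_sections: "f \<in> diag \<Longrightarrow> f \<in> sections"
  by (auto simp: diag_def bsecD)

lemma bsec_diag: "bsec K f \<Longrightarrow> K \<subseteq> units G \<Longrightarrow> f \<in> diag"
  by (auto simp: diag_def)

lemma diag_sadd:
  assumes "f \<in> diag" "g \<in> diag"
  shows "sadd f g \<in> diag"
proof -
  obtain K L where K: "bsec K f" "K \<subseteq> units G" and L: "bsec L g" "L \<subseteq> units G"
    using assms by (auto simp: diag_def)
  have KL: "K \<union> L \<in> cob" using K L bsecD(2) cob_Un_units by blast
  have "bsec (K \<union> L) (sadd f g)"
    using bsec_units_enlarge [OF K(1) _ _ KL] bsec_units_enlarge [OF L(1) _ _ KL] K(2) L(2)
    by (simp add: bsec_sadd)
  then show ?thesis using K(2) L(2) unfolding diag_def by blast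
qed

lemma empty_cob: "{} \<in> cob"
  by (simp add: cob_iff bisection_def)

lemma diag_szero: "szero \<in> diag"
proof -
  have "bsec {} szero"
    using empty_cob by (simp add: bsec_def)
  then show ?thesis by (auto simp: diag_def)
qed

lemma diag_eq_Gamma_c_on: "diag = Gamma_c_on G \<O> (units G)"
proof (intro subset_antisym subsetI)
  show "f \<in> Gamma_c_on G \<O> (units G)" if "f \<in> diag" for f
    using that bsec_Gamma_c_on by (auto simp: diag_def)
  show "f \<in> diag" if "f \<in> Gamma_c_on G \<O> (units G)" for f
    using that by (induction rule: Gamma_c_on_induct) (auto intro: diag_szero diag_sadd bsec_diag)
qed

lemma diag_conv:
  assumes "a \<in> diag" "g \<in> sections" "\<gamma> \<in> arrows G"
  shows "(a \<star> g) \<gamma> = emul \<O> (a (tgt G \<gamma>)) (g \<gamma>)"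
  using assms bsec_unit_conv by (auto simp: diag_def)

lemma conv_diag:
  assumes "a \<in> diag" "f \<in> sections" "\<gamma> \<in> arrows G"
  shows "(f \<star> a) \<gamma> = emul \<O> (f \<gamma>) (act \<O> \<gamma> (a (src G \<gamma>)))"
  using assms bsec_conv_unit by (auto simp: diag_def)

lemma diag_outside: "a \<in> diag \<Longrightarrow> \<gamma> \<in> arrows G \<Longrightarrow> \<gamma> \<notin> units G \<Longrightarrow> a \<gamma> = ezero \<O> (tgt G \<gamma>)"
  by (auto simp: diag_def dest: bsecD(4))

section \<open>Summation over the range fibres\<close>

text \<open>\<open>tot\<close> is the quotient map from the convolution ring onto its left module of sections over the
  unit space, with those sections extended by zero.\<close>
definition tot :: "('g \<Rightarrow> 'e) \<Rightarrow> 'g \<Rightarrow> 'e" where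
  "tot f = (\<lambda>x \<in> arrows G. if x \<in> units G
      then finsum (stalk \<O> x) f {\<beta> \<in> arrows G. tgt G \<beta> = x \<and> f \<beta> \<noteq> ezero \<O> x} else ezero \<O> (tgt G x))"

lemma tot_eq_finsum:
  assumes f: "f \<in> sections" and x: "x \<in> units G" and B: "finite B" "B \<subseteq> {\<beta> \<in> arrows G. tgt G \<beta> = x}"
    and 0: "\<And>\<beta>. \<beta> \<in> arrows G \<Longrightarrow> tgt G \<beta> = x \<Longrightarrow> \<beta> \<notin> B \<Longrightarrow> f \<beta> = ezero \<O> x"
  shows "tot f x = finsum (stalk \<O> x) f B"
proof -
  interpret R: ring "stalk \<O> x" using ring_stalk x .
  have "finsum (stalk \<O> x) f {\<beta> \<in> arrows G. tgt G \<beta> = x \<and> f \<beta> \<noteq> ezero \<O> x} = finsum (stalk \<O> x) f B"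
    by (rule R.add.finprod_mono_neutral_cong_left) (use B 0 f in auto)
  then show ?thesis using x units_arrows by (simp add: tot_def)
qed

lemma tot_closed [simp]:
  assumes "f \<in> sections"
  shows "tot f \<in> sections"
  unfolding sections_iff
proof (intro conjI ballI)
  show "tot f \<in> extensional (arrows G)" by (simp add: tot_def)
  fix x assume x: "x \<in> arrows G"
  show "tot f x \<in> fib (tgt G x)"
  proof (cases "x \<in> units G")
    case True
    interpret R: ring "stalk \<O> x" using ring_stalk True .
    have "finsum (stalk \<O> x) f {\<beta> \<in> arrows G. tgt G \<beta> = x \<and> f \<beta> \<noteq> ezero \<O> x} \<in> fib x"
      by (rule R.finsum_closed) (use assms in auto)
    then show ?thesis using True x by (simp add: tot_def)
  qed (use x in \<open>simp add: tot_def\<close>)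
qed

lemma tot_outside: "x \<in> arrows G \<Longrightarrow> x \<notin> units G \<Longrightarrow> tot f x = ezero \<O> (tgt G x)"
  by (simp add: tot_def)

lemma tot_single:
  assumes f: "f \<in> sections" and \<beta>: "\<beta> \<in> arrows G"
    and 0: "\<And>\<beta>'. \<beta>' \<in> arrows G \<Longrightarrow> tgt G \<beta>' = tgt G \<beta> \<Longrightarrow> \<beta>' \<noteq> \<beta> \<Longrightarrow> f \<beta>' = ezero \<O> (tgt G \<beta>)"
  shows "tot f (tgt G \<beta>) = f \<beta>"
proof -
  interpret R: ring "stalk \<O> (tgt G \<beta>)" using ring_stalk \<beta> by simp
  have "tot f (tgt G \<beta>) = finsum (stalk \<O> (tgt G \<beta>)) f {\<beta>}"
    by (rule tot_eq_finsum) (use f \<beta> 0 in auto)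
  then show ?thesis
    using sections_fib [OF f \<beta>] by (simp add: R.add.finprod_insert)
qed

lemma tot_all_zero:
  assumes "f \<in> sections" "x \<in> units G" "\<And>\<beta>. \<beta> \<in> arrows G \<Longrightarrow> tgt G \<beta> = x \<Longrightarrow> f \<beta> = ezero \<O> x"
  shows "tot f x = ezero \<O> x"
proof -
  interpret R: ring "stalk \<O> x" using ring_stalk assms(2) .
  show ?thesis
    using tot_eq_finsum [of f x "{}"] assms by simp
qed

lemma tot_sadd:
  assumes s: "f \<in> sections" "g \<in> sections" and fin: "fibfin f" "fibfin g"
  shows "tot (sadd f g) = sadd (tot f) (tot g)"
proof (rule sections_eqI)
  fix x assume x: "x \<in> arrows G"
  show "tot (sadd f g) x = sadd (tot f) (tot g) x"
  proof (cases "x \<in> units G")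
    case False
    then show ?thesis using x by (simp add: tot_outside)
  next
    case True
    interpret R: ring "stalk \<O> x" using ring_stalk True .
    define B where "B = {\<beta> \<in> arrows G. tgt G \<beta> = x \<and> f \<beta> \<noteq> ezero \<O> x} \<union>
       {\<beta> \<in> arrows G. tgt G \<beta> = x \<and> g \<beta> \<noteq> ezero \<O> x}"
    have B: "finite B" "B \<subseteq> {\<beta> \<in> arrows G. tgt G \<beta> = x}"
      using fin by (auto simp: B_def fibfin_def)
    have 0: "f \<beta> = ezero \<O> x" "g \<beta> = ezero \<O> x" "sadd f g \<beta> = ezero \<O> x"
      if "\<beta> \<in> arrows G" "tgt G \<beta> = x" "\<beta> \<notin> B" for \<beta>
      using that True by (auto simp: B_def)
    have cl: "f \<in> B \<rightarrow> fib x" "g \<in> B \<rightarrow> fib x"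
      using B(2) s sections_fib_eq by (auto simp: Pi_iff)
    have "finsum (stalk \<O> x) (sadd f g) B = finsum (stalk \<O> x) (\<lambda>\<beta>. eadd \<O> (f \<beta>) (g \<beta>)) B"
      using B cl by (intro R.add.finprod_cong') (auto simp: Pi_iff)
    also have "\<dots> = eadd \<O> (finsum (stalk \<O> x) f B) (finsum (stalk \<O> x) g B)"
      using R.finsum_addf cl by simp
    finally show ?thesis
      using tot_eq_finsum [OF _ True B, of f] tot_eq_finsum [OF _ True B, of g]
         tot_eq_finsum [OF _ True B, of "sadd f g"] 0 s x by simp
  qed
qed (use s in auto)

text \<open>On a single bisection no summation takes place: \<open>tot f\<close> is \<open>f\<close>
  carried along the homeomorphism of \<open>U\<close> onto its range.\<close>

lemma tot_bsec:
  assumes f: "bsec U f"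
  shows "\<beta> \<in> U \<Longrightarrow> tot f (tgt G \<beta>) = f \<beta>"
    and "x \<in> units G \<Longrightarrow> x \<notin> tgt G ` U \<Longrightarrow> tot f x = ezero \<O> x"
    and "bsec (tgt G ` U) (tot f)"
proof -
  note F = bsecD [OF f]
  have arr: "U \<subseteq> arrows G" using F(2) by (rule cob_arrows)
  show 1: "tot f (tgt G \<beta>) = f \<beta>" if "\<beta> \<in> U" for \<beta>
  proof (rule tot_single [OF F(1)])
    show "f \<beta>' = ezero \<O> (tgt G \<beta>)" if "\<beta>' \<in> arrows G" "tgt G \<beta>' = tgt G \<beta>" "\<beta>' \<noteq> \<beta>" for \<beta>'
      using bisectionD(3) [OF cob_bisection [OF F(2)] \<open>\<beta> \<in> U\<close>, of \<beta>'] F(4) [of \<beta>'] that by metis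
  qed (use that arr in auto)
  show 2: "tot f x = ezero \<O> x" if "x \<in> units G" "x \<notin> tgt G ` U" for x
    using that F by (intro tot_all_zero) auto
  have K: "tgt G ` U \<in> cob" "tgt G ` U \<subseteq> units G" using F(2) cob_tgt cob_tgt_units by auto
  have "continuous_map (subtopology (gtop G) (tgt G ` U)) (subtopology (gtop G) U) (slice U)"
    using continuous_map_slice [OF F(2) continuous_map_id_subtopology, of "tgt G ` U"] topspace_cob [OF K(1)]
      slice_in [OF F(2)] by (auto simp: continuous_map_in_subtopology)
  from continuous_map_compose [OF this F(3)]
  have "continuous_map (subtopology (gtop G) (tgt G ` U)) (etop \<O>) (tot f)"
    by (rule continuous_map_eq) (use topspace_cob [OF K(1)] F(2) 1 in auto)
  then show "bsec (tgt G ` U) (tot f)"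
    using K F(1) 2 tot_outside unfolding bsec_def by (metis DiffE tgt_unit tot_closed)
qed

lemma tot_szero [simp]: "tot szero = szero"
proof (rule sections_eqI)
  show "tot szero x = szero x" if x: "x \<in> arrows G" for x
  proof (cases "x \<in> units G")
    case True
    then show ?thesis using tot_all_zero [of szero x] x by simp
  qed (use x in \<open>simp add: tot_outside\<close>)
qed auto

lemma tot_diag: "f \<in> Gam \<Longrightarrow> tot f \<in> diag"
proof (induction rule: Gamma_c_on_induct)
  case zero
  then show ?case by (simp add: diag_szero)
next
  case (add U f g)
  then show ?case
    using tot_bsec(3) [OF add(1)] cob_tgt_units [OF bsecD(2) [OF add(1)]]
    by (auto simp: tot_sadd bsecD(1) bsec_Gam Gam_sections Gam_fibfin intro: diag_sadd bsec_diag)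
qed

text \<open>Replacing a right factor \<rho> by the unit at its range leaves the range of the product
  unchanged, and summation over range fibres sees only that range; the value of \<open>h\<close> at
  \<rho> is the value of \<open>tot h\<close> at that unit.\<close>

lemma tot_tot_conv_bsec:
  assumes f: "bsec U f" and h: "bsec V h"
  shows "tot (f \<star> h) = tot (f \<star> tot h)"
proof (rule sections_eqI)
  note F = bsecD [OF f] and H = bsecD [OF h] and th = tot_bsec [OF h]
  note fh = bsec_conv [OF f h] and fth = bsec_conv [OF f th(3)]
  have arr: "U \<subseteq> arrows G" "V \<subseteq> arrows G" using F H cob_arrows by auto
  fix x assume x: "x \<in> arrows G"
  show "tot (f \<star> h) x = tot (f \<star> tot h) x"
  proof (cases "x \<in> units G")
    case False
    then show ?thesis using x by (simp add: tot_outside)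
  next
    case x: True
    show ?thesis
    proof (cases "\<exists>\<beta>\<in>U. \<exists>\<rho>\<in>V. x = tgt G \<beta> \<and> src G \<beta> = tgt G \<rho>")
      case True
      then obtain \<beta> \<rho> where *: "\<beta> \<in> U" "\<rho> \<in> V" "x = tgt G \<beta>" "src G \<beta> = tgt G \<rho>" by blast
      then have a: "\<beta> \<in> arrows G" "\<rho> \<in> arrows G" using arr by auto
      have m: "\<beta> \<cdot> \<rho> \<in> bis_mult U V" "\<beta> \<cdot> tgt G \<rho> \<in> bis_mult U (tgt G ` V)"
        unfolding bis_mult_def using * a by (blast, force)
      have e: "\<beta> \<cdot> tgt G \<rho> = \<beta>" using * a by (metis mult_src)
      have "tot (f \<star> h) x = emul \<O> (f \<beta>) (act \<O> \<beta> (h \<rho>))"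
        using tot_bsec(1) [OF fh m(1)] conv_bsec_bsec [OF f h *(1,2,4)] * a by simp
      moreover have "(f \<star> tot h) (\<beta> \<cdot> tgt G \<rho>) = emul \<O> (f \<beta>) (act \<O> \<beta> (tot h (tgt G \<rho>)))"
        using * a by (intro conv_bsec_bsec [OF f th(3)]) auto
      moreover have "tot h (tgt G \<rho>) = h \<rho>" using th(1) * by simp
      ultimately show ?thesis
        using tot_bsec(1) [OF fth m(2)] * by (simp add: e)
    next
      case False
      have "x \<notin> tgt G ` bis_mult U V"
      proof
        assume "x \<in> tgt G ` bis_mult U V"
        then obtain \<delta> where \<delta>: "x = tgt G \<delta>" "\<delta> \<in> bis_mult U V" by blast
        from \<delta>(2) F(2) H(2) show False
          by (rule bis_multE) (use False \<delta>(1) in auto)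
      qed
      moreover have "x \<notin> tgt G ` bis_mult U (tgt G ` V)"
      proof
        assume "x \<in> tgt G ` bis_mult U (tgt G ` V)"
        then obtain \<delta> where \<delta>: "x = tgt G \<delta>" "\<delta> \<in> bis_mult U (tgt G ` V)" by blast
        from \<delta>(2) F(2) cob_tgt [OF H(2)] show False
        proof (rule bis_multE)
          fix \<beta> \<rho> assume *: "\<delta> = \<beta> \<cdot> \<rho>" "\<beta> \<in> U" "\<rho> \<in> tgt G ` V" "\<beta> \<in> arrows G" "\<rho> \<in> arrows G" "src G \<beta> = tgt G \<rho>"
          then have "tgt G \<rho> = \<rho>" using cob_tgt_units [OF H(2)] by (meson subsetD tgt_unit)
          moreover obtain \<rho>' where "\<rho>' \<in> V" "\<rho> = tgt G \<rho>'" using *(3) by blast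
          ultimately show False using False *(1,2,4,5,6) \<delta>(1) by auto
        qed
      qed
      ultimately show ?thesis
        using tot_bsec(2) [OF fh x] tot_bsec(2) [OF fth x] by simp
    qed
  qed
qed (use assms bsecD(1) in auto)

text \<open>Says that the kernel of \<open>tot\<close> is a left ideal. So \<open>R\<close> acts on
  diagonal sections \<open>m\<close> by sending \<open>m\<close> to
  \<open>tot (f \<star> m)\<close>.\<close>

lemma tot_tot_conv:
  assumes "f \<in> Gam" "h \<in> Gam"
  shows "tot (f \<star> h) = tot (f \<star> tot h)"
  using assms
proof (induction f rule: Gamma_c_on_induct)
  case zero
  then show ?case by (simp add: Gam_sections)
next
  case (add U f f')
  have "tot (f \<star> h) = tot (f \<star> tot h)"
    using add(5)
  proof (induction h rule: Gamma_c_on_induct)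
    case zero
    then show ?case by simp
  next
    case (add V h h')
    note * = bsec_Gam [OF add(1)] add(3) bsec_Gam [OF \<open>bsec U f\<close>] diag_Gam [OF tot_diag]
    show ?case
      using add(4) tot_tot_conv_bsec [OF \<open>bsec U f\<close> add(1)] *
      by (simp add: Gam_conv_sadd_right tot_sadd Gam_sections Gam_fibfin Gam_conv_closed)
  qed
  then show ?case
    using add bsec_Gam [OF add(1)] diag_Gam [OF tot_diag]
    by (simp add: Gam_conv_sadd_left tot_sadd Gam_sections Gam_fibfin Gam_conv_closed)
qed

text \<open>Arrows of the kernel over x are loops that fix the stalk, so each term of
  \<open>f\<close> acting on \<open>m\<close> at x is a value of \<open>f\<close> times
  \<open>m x\<close>, and \<open>m x\<close> factors out of the sum. Hence \<open>f\<close> and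
  \<open>tot f\<close> differ by an element of the annihilator.\<close>

lemma tot_conv_ker:
  assumes f: "f \<in> Gam" and h: "h \<in> Gam" and ker: "supp G \<O> f \<subseteq> sheaf_ker G \<O>"
  shows "tot (f \<star> h) = tot (tot f \<star> h)"
proof (rule sections_eqI)
  define m where "m = tot h"
  have m: "m \<in> diag" "m \<in> Gam" using tot_diag [OF h] diag_Gam by (auto simp: m_def)
  have tf: "tot f \<in> diag" "tot f \<in> Gam" using tot_diag [OF f] diag_Gam by auto
  note S = Gam_sections [OF f] Gam_sections [OF h] Gam_sections [OF m(2)] Gam_sections [OF tf(2)]
  fix x assume x: "x \<in> arrows G"
  show "tot (f \<star> h) x = tot (tot f \<star> h) x"
  proof (cases "x \<in> units G")
    case False
    then show ?thesis using x by (simp add: tot_outside)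
  next
    case x: True
    interpret R: ring "stalk \<O> x" using ring_stalk x .
    define B where "B = {\<beta> \<in> arrows G. tgt G \<beta> = x \<and> f \<beta> \<noteq> ezero \<O> x}"
    have B: "finite B" "B \<subseteq> {\<beta> \<in> arrows G. tgt G \<beta> = x}"
      using Gam_fibfin [OF f] by (auto simp: B_def fibfin_def)
    have mx: "m x \<in> fib x" using sections_fib_eq [OF S(3)] x units_arrows by simp
    have val: "(f \<star> m) \<beta> = emul \<O> (f \<beta>) (m x)" if \<beta>: "\<beta> \<in> arrows G" "tgt G \<beta> = x" for \<beta>
    proof (cases "f \<beta> = ezero \<O> x")
      case True
      have "act \<O> \<beta> (m (src G \<beta>)) \<in> fib (tgt G \<beta>)"
        using \<beta> S(3) by (intro act_closed sections_fib_eq) auto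
      then show ?thesis
        using conv_diag [OF m(1) S(1) \<beta>(1)] mx True \<beta>(2) by simp
    next
      case False
      then have "\<beta> \<in> sheaf_ker G \<O>" using ker \<beta> by (auto simp: supp_def)
      then have s: "src G \<beta> = x" "\<forall>a \<in> fib x. act \<O> \<beta> a = a"
        using \<beta> by (auto simp: sheaf_ker_def Iso_def)
      show ?thesis
        using conv_diag [OF m(1) S(1) \<beta>(1)] s mx by simp
    qed
    have cl: "f \<in> B \<rightarrow> fib x" using B(2) S sections_fib_eq by (auto simp: Pi_iff)
    have "tot (f \<star> m) x = finsum (stalk \<O> x) (f \<star> m) B"
      by (rule tot_eq_finsum [OF _ x B]) (use S mx val in \<open>auto simp: B_def\<close>)
    also have "\<dots> = finsum (stalk \<O> x) (\<lambda>\<beta>. emul \<O> (f \<beta>) (m x)) B"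
      using B cl mx val by (intro R.add.finprod_cong') (auto simp: Pi_iff)
    also have "\<dots> = emul \<O> (finsum (stalk \<O> x) f B) (m x)"
      using R.finsum_ldistr [OF B(1) _ , of "m x" f] cl mx by simp
    also have "finsum (stalk \<O> x) f B = tot f x"
      by (rule tot_eq_finsum [OF _ x B, symmetric]) (use S in \<open>auto simp: B_def\<close>)
    also have "emul \<O> (tot f x) (m x) = (tot f \<star> m) x"
      using diag_conv [OF tf(1) S(3), of x] x units_arrows by simp
    \<comment> \<open>Both factors are diagonal, so the fibre over x contributes only the term at
      the unit x.\<close>
    also have "\<dots> = tot (tot f \<star> m) x"
    proof -
      have "tot (tot f \<star> m) (tgt G x) = (tot f \<star> m) x"
      proof (rule tot_single)
        fix \<beta>' assume \<beta>': "\<beta>' \<in> arrows G" "tgt G \<beta>' = tgt G x" "\<beta>' \<noteq> x"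
        then have "\<beta>' \<notin> units G" using x by auto
        then have "m \<beta>' = ezero \<O> (tgt G x)" using diag_outside [OF m(1) \<beta>'(1)] \<beta>'(2) by simp
        then show "(tot f \<star> m) \<beta>' = ezero \<O> (tgt G x)"
          using diag_conv [OF tf(1) S(3) \<beta>'(1)] \<beta>'(2) sections_fib_eq [OF S(4), of x x] x units_arrows by simp
      qed (use S x units_arrows in auto)
      then show ?thesis using x by simp
    qed
    finally show ?thesis
      using tot_tot_conv [OF f h] tot_tot_conv [OF tf(2) h] by (simp add: m_def)
  qed
qed (use f h Gam_sections in auto)

section \<open>Invariant ideals of the diagonal\<close>

lemma compact_units_cob_cover:
  assumes C: "compactin (gtop G) C" "C \<subseteq> units G"
  obtains K where "K \<in> cob" "K \<subseteq> units G" "C \<subseteq> K"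
proof -
  let ?\<K> = "{K \<in> cob. K \<subseteq> units G}"
  have "C \<subseteq> \<Union>?\<K>"
  proof
    fix x assume "x \<in> C"
    then have x: "x \<in> units G" using C(2) by blast
    show "x \<in> \<Union>?\<K>"
      by (rule unit_cob_nhd [OF open_units x x]) blast
  qed
  moreover have "\<forall>K\<in>?\<K>. openin (gtop G) K" using cob_open by blast
  ultimately have "\<exists>\<F>. finite \<F> \<and> \<F> \<subseteq> ?\<K> \<and> C \<subseteq> \<Union>\<F>"
    using C(1) unfolding compactin_def by presburger
  then obtain \<F> where \<F>: "finite \<F>" "\<F> \<subseteq> ?\<K>" "C \<subseteq> \<Union>\<F>" by metis
  have "\<Union>\<F> \<in> ?\<K>"
    using \<F>(1,2)
  proof (induction \<F> rule: finite_induct)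
    case empty
    then show ?case by (simp add: empty_cob)
  next
    case (insert K \<F>)
    then have "K \<in> cob" "K \<subseteq> units G" "\<Union>\<F> \<in> cob" "\<Union>\<F> \<subseteq> units G" by simp_all
    then show ?case by (simp add: cob_Un_units)
  qed
  then show thesis using that [of "\<Union>\<F>"] \<F>(3) by simp
qed

lemma diag_conv_diag:
  assumes "a \<in> diag" "b \<in> diag"
  shows "a \<star> b \<in> diag"
proof -
  obtain K L where K: "K \<subseteq> units G" "bsec K a" and L: "L \<subseteq> units G" "bsec L b"
    using assms by (auto simp: diag_def)
  have "\<gamma> \<in> units G" if "\<gamma> \<in> bis_mult K L" for \<gamma>
    using that K(1) L(1) unfolding bis_mult_def
    by clarsimp (metis mult_src src_unit subsetD tgt_unit units_arrows)
  then show ?thesis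
    using bsec_diag [OF bsec_conv [OF K(2) L(2)]] by blast
qed

declare units_arrows [simp]

lemma diag_conv_unit: "a \<in> diag \<Longrightarrow> b \<in> diag \<Longrightarrow> x \<in> units G \<Longrightarrow> (a \<star> b) x = emul \<O> (a x) (b x)"
  using diag_conv [of a b x] diag_sections by simp

lemma diag_fib: "a \<in> diag \<Longrightarrow> x \<in> units G \<Longrightarrow> a x \<in> fib x"
  using sections_fib_eq [of a x x] diag_sections by simp

lemma diag_eqI: "a \<in> diag \<Longrightarrow> b \<in> diag \<Longrightarrow> (\<And>x. x \<in> units G \<Longrightarrow> a x = b x) \<Longrightarrow> a = b"
  by (rule sections_eqI) (auto simp: diag_sections, metis diag_outside)

lemma diag_sneg: "f \<in> diag \<Longrightarrow> sneg f \<in> diag"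
  using bsec_sneg unfolding diag_def by blast

lemma add_closed_diag: "add_closed diag"
  by (auto simp: add_closed_def diag_sections diag_szero diag_sadd diag_sneg)

lemma tot_diag_id:
  assumes "f \<in> diag"
  shows "tot f = f"
proof (rule diag_eqI)
  fix x assume x: "x \<in> units G"
  have "tot f (tgt G x) = f x"
    by (rule tot_single) (use assms x diag_sections diag_outside tgt_unit in \<open>metis units_arrows\<close>)+
  then show "tot f x = f x" using x by simp
qed (use assms tot_diag diag_Gam in auto)

text \<open>The action of \<open>s\<close> realised inside \<open>R\<close>, as conjugation by its
  characteristic section. On sections supported on the source of \<open>s\<close> it is the partial
  action of the theorem; other diagonal sections are in effect cut down to that source. As a
  two-sided multiplication it preserves ideals of \<open>R\<close>, so these meet
  \<open>diag\<close> in invariant ideals.\<close>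

definition sact :: "'g set \<Rightarrow> ('g \<Rightarrow> 'e) \<Rightarrow> 'g \<Rightarrow> 'e" where
  "sact s f = indic s \<star> f \<star> indic (ginv G ` s)"

lemma sact_diag:
  assumes s: "s \<in> cob" and f: "f \<in> diag"
  shows "sact s f \<in> diag"
proof -
  obtain K where K: "K \<subseteq> units G" "bsec K f" using f by (auto simp: diag_def)
  have arr: "s \<subseteq> arrows G" using s by (rule cob_arrows)
  have "bsec (bis_mult (bis_mult s K) (ginv G ` s)) (sact s f)"
    unfolding sact_def using s by (intro bsec_conv bsec_indic cob_ginv K)
  moreover have "bis_mult (bis_mult s K) (ginv G ` s) \<subseteq> units G"
  proof
    fix \<delta> assume "\<delta> \<in> bis_mult (bis_mult s K) (ginv G ` s)"
    then obtain \<beta> k \<gamma> where *: "\<delta> = \<beta> \<cdot> k \<cdot> ginv G \<gamma>" "\<beta> \<in> s" "k \<in> K" "\<gamma> \<in> s" "src G \<beta> = tgt G k"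
        "src G (\<beta> \<cdot> k) = tgt G (ginv G \<gamma>)"
      unfolding bis_mult_def by blast
    have k: "k \<in> units G" using * K by blast
    then have a: "\<beta> \<in> arrows G" "\<gamma> \<in> arrows G" "k = src G \<beta>" using * arr by auto
    \<comment> \<open>The middle factor is a unit, so the outer arrows share their source and
      coincide by injectivity of the source map on \<open>s\<close>.\<close>
    then have "src G \<beta> = src G \<gamma>" using *(6) by (metis mult_src tgt_ginv)
    then have "\<beta> = \<gamma>" using bisectionD(2) [OF cob_bisection [OF s] *(2,4)] by simp
    then show "\<delta> \<in> units G" using * a by simp
  qed
  ultimately show ?thesis by (rule bsec_diag)
qed

lemma sact_apply:
  assumes s: "s \<in> cob" and f: "f \<in> diag"
  shows "\<gamma> \<in> s \<Longrightarrow> sact s f (tgt G \<gamma>) = act \<O> \<gamma> (f (src G \<gamma>))"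
    and "x \<in> units G \<Longrightarrow> x \<notin> tgt G ` s \<Longrightarrow> sact s f x = ezero \<O> x"
proof -
  have arr: "s \<subseteq> arrows G" using s by (rule cob_arrows)
  have i: "indic s \<in> sections" using bsecD(1) [OF bsec_indic [OF s]] .
  have if': "indic s \<star> f \<in> sections" using i f diag_sections by simp
  note i' = bsec_indic [OF cob_ginv [OF s]]
  show "sact s f (tgt G \<gamma>) = act \<O> \<gamma> (f (src G \<gamma>))" if \<gamma>: "\<gamma> \<in> s"
  proof -
    have g: "\<gamma> \<in> arrows G" using \<gamma> arr by blast
    have fa: "act \<O> \<gamma> (f (src G \<gamma>)) \<in> fib (tgt G \<gamma>)"
      using g diag_fib [OF f] by (intro act_closed) auto
    have "(indic s \<star> f) \<gamma> = act \<O> \<gamma> (f (src G \<gamma>))"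
      using conv_diag [OF f i g] \<gamma> g fa by simp
    moreover have "sact s f (tgt G \<gamma>) = emul \<O> ((indic s \<star> f) (tgt G \<gamma> \<cdot> ginv G (ginv G \<gamma>)))
       (act \<O> (tgt G \<gamma> \<cdot> ginv G (ginv G \<gamma>)) (indic (ginv G ` s) (ginv G \<gamma>)))"
      unfolding sact_def using \<gamma> g by (intro conv_bsec_right [OF if' i']) auto
    ultimately show ?thesis using g \<gamma> fa by simp
  qed
  show "sact s f x = ezero \<O> x" if "x \<in> units G" "x \<notin> tgt G ` s"
  proof -
    have "src G ` ginv G ` s = tgt G ` s"
      using arr by (force simp: image_image)
    then have "sact s f x = ezero \<O> (tgt G x)"
      unfolding sact_def using that by (intro conv_bsec_right_outside [OF if' i']) auto
    then show ?thesis using that by simp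
  qed
qed

text \<open>Invariant ideals of \<open>Gamma_c_units\<close> moved into \<open>diag\<close>. The
  support condition mentions the sources of \<open>s\<close> because these are the ranges of its
  inverse.\<close>

definition inv_diag_ideal :: "('g \<Rightarrow> 'e) set \<Rightarrow> bool" where
  "inv_diag_ideal J \<longleftrightarrow> J \<subseteq> diag \<and> add_closed J \<and> (\<forall>a\<in>diag. \<forall>f\<in>J. a \<star> f \<in> J \<and> f \<star> a \<in> J) \<and>
     (\<forall>s\<in>cob. \<forall>f\<in>J. supp G \<O> f \<subseteq> src G ` s \<longrightarrow> sact s f \<in> J)"

section \<open>Identification of sections over the unit space with the diagonal\<close>

abbreviation A\<^sub>0 :: "('g \<Rightarrow> 'e) ring" where "A\<^sub>0 \<equiv> Gamma_c_units G \<O>"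

lemma Gamma_c_units_simps [simp]:
  "zero A\<^sub>0 = (\<lambda>x \<in> units G. ezero \<O> x)" "add A\<^sub>0 = (\<lambda>f g. \<lambda>x \<in> units G. eadd \<O> (f x) (g x))"
  "mult A\<^sub>0 = (\<lambda>f g. \<lambda>x \<in> units G. emul \<O> (f x) (g x))"
  by (simp_all add: Gamma_c_units_def)

lemma carrier_Gamma_c_units:
  "u \<in> carrier A\<^sub>0 \<longleftrightarrow> u \<in> extensional (units G) \<and> (\<forall>x\<in>units G. u x \<in> fib x) \<and>
     continuous_map (unit_space G) (etop \<O>) u \<and> compactin (gtop G) (unit_supp G \<O> u)"
  by (auto simp: Gamma_c_units_def PiE_def Pi_iff compact_Hausdorff_in_unit_space unit_supp_def)

abbreviation on_units :: "('g \<Rightarrow> 'e) \<Rightarrow> 'g \<Rightarrow> 'e" where "on_units f \<equiv> restrict f (units G)"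

lemma on_units_diag:
  assumes "f \<in> diag"
  shows "on_units f \<in> carrier A\<^sub>0" "extend_by_zero G \<O> (on_units f) = f"
proof -
  obtain K where K: "K \<subseteq> units G" "bsec K f" using assms by (auto simp: diag_def)
  note F = bsecD [OF K(2)]
  have c: "continuous_map (unit_space G) (etop \<O>) f"
    using K by (intro bsec_units_continuous)
  have pr: "proj \<O> (f x) = x" if "x \<in> units G" for x
    using diag_fib [OF assms that] by (rule proj_fib)
  \<comment> \<open>The support is the part of \<open>K\<close> off the open zero set, hence compact
    as a closed part of a compact set.\<close>
  have us: "unit_supp G \<O> (on_units f) = (units G - {x \<in> units G. f x = ezero \<O> (proj \<O> (f x))}) \<inter> K"
  proof -
    have "x \<in> K" if "x \<in> units G" "f x \<noteq> ezero \<O> x" for x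
      using F(4) [of x] that by auto
    then show ?thesis
      using K(1) pr by (force simp: unit_supp_def)
  qed
  have "closedin (unit_space G) (units G - {x \<in> units G. f x = ezero \<O> (proj \<O> (f x))})"
    using open_zeros [OF c] by (simp add: openin_closedin_eq)
  moreover have "compactin (unit_space G) K"
    using cob_compact F(2) K(1) by (simp add: compactin_unit_space)
  ultimately have "compactin (unit_space G) (unit_supp G \<O> (on_units f))"
    unfolding us by (rule closed_Int_compactin)
  moreover have "continuous_map (unit_space G) (etop \<O>) (on_units f)"
    using c by (rule continuous_map_eq) simp
  ultimately show "on_units f \<in> carrier A\<^sub>0"
    using diag_fib [OF assms] by (simp add: carrier_Gamma_c_units compactin_unit_space)
  show "extend_by_zero G \<O> (on_units f) = f"
    using F(1) diag_outside [OF assms] by (auto simp: extend_by_zero_def sections_iff fun_eq_iff extensional_def)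
qed

text \<open>The compact support of \<open>u\<close> need not be open when the stalks are merely
  rings, so it is enlarged to a compact open set of units before a generator can be formed.\<close>

lemma extend_diag:
  assumes "u \<in> carrier A\<^sub>0"
  shows "extend_by_zero G \<O> u \<in> diag" "on_units (extend_by_zero G \<O> u) = u"
proof -
  note u = assms [unfolded carrier_Gamma_c_units]
  obtain K where K: "K \<in> cob" "K \<subseteq> units G" "unit_supp G \<O> u \<subseteq> K"
    using compact_units_cob_cover [of "unit_supp G \<O> u"] u by (auto simp: unit_supp_def)
  have "extend_by_zero G \<O> u \<in> sections"
    using u by (auto simp: extend_by_zero_def sections_iff)
  moreover have "continuous_map (unit_space G) (etop \<O>) (extend_by_zero G \<O> u)"
    by (rule continuous_map_eq [of _ _ u]) (use u in \<open>auto simp: extend_by_zero_def\<close>)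
  moreover have "extend_by_zero G \<O> u \<gamma> = ezero \<O> (tgt G \<gamma>)" if "\<gamma> \<in> arrows G" "\<gamma> \<notin> K" for \<gamma>
    using that K(3) by (auto simp: extend_by_zero_def unit_supp_def)
  ultimately have "bsec K (extend_by_zero G \<O> u)"
    using bsec_units_iff [OF K(2,1)] by blast
  then show "extend_by_zero G \<O> u \<in> diag"
    using K(2) by (rule bsec_diag)
  show "on_units (extend_by_zero G \<O> u) = u"
    using u by (intro extensionalityI [of _ "units G"]) (auto simp: extend_by_zero_def)
qed

lemma extend_image: "extend_by_zero G \<O> ` carrier A\<^sub>0 = diag"
  using on_units_diag extend_diag by (metis (no_types, lifting) image_eqI image_subsetI subsetI subset_antisym)

lemma on_units_image: "carrier A\<^sub>0 = on_units ` diag"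
  using on_units_diag extend_diag by (metis (no_types, lifting) image_eqI image_subsetI subsetI subset_antisym)

lemma on_units_inj: "f \<in> diag \<Longrightarrow> g \<in> diag \<Longrightarrow> on_units f = on_units g \<Longrightarrow> f = g"
  using on_units_diag(2) by metis

lemma on_units_ops:
  "on_units szero = zero A\<^sub>0" "add A\<^sub>0 (on_units f) (on_units g) = on_units (sadd f g)"
  "f \<in> diag \<Longrightarrow> g \<in> diag \<Longrightarrow> mult A\<^sub>0 (on_units f) (on_units g) = on_units (f \<star> g)"
  by (auto simp: fun_eq_iff diag_conv_unit)

lemma abelian_group_Gamma_c_units: "abelian_group A\<^sub>0"
proof (rule abelian_groupI)
  fix u v w assume "u \<in> carrier A\<^sub>0" "v \<in> carrier A\<^sub>0" "w \<in> carrier A\<^sub>0"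
  then obtain f g h where *: "f \<in> diag" "g \<in> diag" "h \<in> diag" "u = on_units f" "v = on_units g" "w = on_units h"
    using on_units_image by blast
  note [simp] = * diag_sections
  show "u \<oplus>\<^bsub>A\<^sub>0\<^esub> v \<oplus>\<^bsub>A\<^sub>0\<^esub> w = u \<oplus>\<^bsub>A\<^sub>0\<^esub> (v \<oplus>\<^bsub>A\<^sub>0\<^esub> w)"
    by (simp only: on_units_ops *) (simp add: sadd_assoc)
next
  fix u v assume "u \<in> carrier A\<^sub>0" "v \<in> carrier A\<^sub>0"
  then obtain f g where *: "f \<in> diag" "g \<in> diag" "u = on_units f" "v = on_units g"
    using on_units_image by blast
  show "u \<oplus>\<^bsub>A\<^sub>0\<^esub> v = v \<oplus>\<^bsub>A\<^sub>0\<^esub> u"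
    using *(1,2) by (simp only: on_units_ops *(3,4)) (metis sadd_comm diag_sections)
  show "u \<oplus>\<^bsub>A\<^sub>0\<^esub> v \<in> carrier A\<^sub>0"
    using *(1,2) by (simp only: on_units_ops *(3,4) on_units_diag diag_sadd)
next
  show "\<zero>\<^bsub>A\<^sub>0\<^esub> \<in> carrier A\<^sub>0"
    using on_units_diag(1) [OF diag_szero] by (simp only: on_units_ops)
next
  fix u assume "u \<in> carrier A\<^sub>0"
  then obtain f where *: "f \<in> diag" "u = on_units f"
    using on_units_image by blast
  show "\<zero>\<^bsub>A\<^sub>0\<^esub> \<oplus>\<^bsub>A\<^sub>0\<^esub> u = u"
    unfolding *(2) on_units_ops(1) [symmetric] on_units_ops(2) using * diag_sections by simp
  have "on_units (sneg f) \<oplus>\<^bsub>A\<^sub>0\<^esub> u = \<zero>\<^bsub>A\<^sub>0\<^esub>"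
    unfolding *(2) on_units_ops(1) [symmetric] on_units_ops(2)
    using diag_sections [OF *(1)] sadd_sneg [of f] sadd_comm [of f "sneg f"] by simp
  then show "\<exists>v\<in>carrier A\<^sub>0. v \<oplus>\<^bsub>A\<^sub>0\<^esub> u = \<zero>\<^bsub>A\<^sub>0\<^esub>"
    using on_units_diag(1) [OF diag_sneg [OF *(1)]] by blast
qed

lemma a_inv_on_units:
  assumes "f \<in> diag"
  shows "a_inv A\<^sub>0 (on_units f) = on_units (sneg f)"
proof (rule abelian_group.minus_equality [OF abelian_group_Gamma_c_units])
  show "on_units (sneg f) \<oplus>\<^bsub>A\<^sub>0\<^esub> on_units f = \<zero>\<^bsub>A\<^sub>0\<^esub>"
    unfolding on_units_ops(1) [symmetric] on_units_ops(2)
    using diag_sections [OF assms] sadd_sneg [of f] sadd_comm [of f "sneg f"] by simp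
qed (use on_units_diag diag_sneg assms in auto)

lemma bisection_act_on_units:
  assumes s: "s \<in> cob" and f: "f \<in> diag"
  shows "bisection_act G \<O> s (on_units f) = on_units (sact s f)"
proof
  fix x
  show "bisection_act G \<O> s (on_units f) x = on_units (sact s f) x"
  proof (cases "x \<in> units G \<and> x \<in> tgt G ` s")
    case True
    then obtain \<gamma> where \<gamma>: "\<gamma> \<in> s" "x = tgt G \<gamma>" by blast
    moreover have "\<gamma> \<in> arrows G" using \<gamma> cob_arrows [OF s] by blast
    moreover have "the_inv_into s (tgt G) x = \<gamma>"
      using slice_tgt [OF s \<gamma>(1)] by (simp add: slice_def \<gamma>(2))
    ultimately show ?thesis
      using True sact_apply(1) [OF s f \<gamma>(1)] by (simp add: bisection_act_def)
  next
    case False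
    then show ?thesis
      using sact_apply(2) [OF s f, of x] by (auto simp: bisection_act_def)
  qed
qed

lemma supp_diag:
  assumes "f \<in> diag"
  shows "supp G \<O> f = unit_supp G \<O> (on_units f)"
proof -
  have "\<gamma> \<in> units G" if "\<gamma> \<in> arrows G" "f \<gamma> \<noteq> ezero \<O> (tgt G \<gamma>)" for \<gamma>
    using diag_outside [OF assms that(1)] that(2) by blast
  then show ?thesis
    by (auto simp: supp_def unit_supp_def)
qed

text \<open>Restriction to units is injective on \<open>diag\<close> and turns convolution into
  pointwise multiplication and \<open>sact\<close> into \<open>bisection_act\<close>, so each clause
  of the definition transfers separately.\<close>

lemma invariant_ideal_on_units:
  assumes J: "J \<subseteq> diag"
  shows "invariant_ideal G \<O> (on_units ` J) \<longleftrightarrow> inv_diag_ideal J"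
proof -
  interpret A: abelian_group A\<^sub>0 by (rule abelian_group_Gamma_c_units)
  have mem: "on_units f \<in> on_units ` J \<longleftrightarrow> f \<in> J" if "f \<in> diag" for f
    using that J on_units_inj by blast
  have "additive_subgroup (on_units ` J) A\<^sub>0 \<longleftrightarrow>
      on_units szero \<in> on_units ` J \<and> (\<forall>f\<in>J. \<forall>g\<in>J. on_units (sadd f g) \<in> on_units ` J) \<and>
      (\<forall>f\<in>J. on_units (sneg f) \<in> on_units ` J)"
  proof -
    have "on_units ` J \<subseteq> carrier A\<^sub>0" using J on_units_diag(1) by blast
    moreover have "(\<forall>f\<in>J. \<ominus>\<^bsub>A\<^sub>0\<^esub> on_units f \<in> on_units ` J) \<longleftrightarrow> (\<forall>f\<in>J. on_units (sneg f) \<in> on_units ` J)"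
      using J a_inv_on_units by (intro ball_cong) auto
    ultimately show ?thesis
      unfolding A.additive_subgroup_iff on_units_ops(1) [symmetric] by (simp only: ball_simps on_units_ops(2) simp_thms)
  qed
  also have "\<dots> \<longleftrightarrow> add_closed J"
    using J mem diag_szero diag_sadd diag_sneg diag_sections unfolding add_closed_def by (meson subset_iff)
  finally have add: "additive_subgroup (on_units ` J) A\<^sub>0 \<longleftrightarrow> add_closed J" .
  have "(\<forall>a\<in>carrier A\<^sub>0. \<forall>x\<in>on_units ` J. a \<otimes>\<^bsub>A\<^sub>0\<^esub> x \<in> on_units ` J \<and> x \<otimes>\<^bsub>A\<^sub>0\<^esub> a \<in> on_units ` J)
      \<longleftrightarrow> (\<forall>a\<in>diag. \<forall>f\<in>J. on_units a \<otimes>\<^bsub>A\<^sub>0\<^esub> on_units f \<in> on_units ` J \<and> on_units f \<otimes>\<^bsub>A\<^sub>0\<^esub> on_units a \<in> on_units ` J)"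
    by (simp only: on_units_image ball_simps)
  also have "\<dots> \<longleftrightarrow> (\<forall>a\<in>diag. \<forall>f\<in>J. a \<star> f \<in> J \<and> f \<star> a \<in> J)"
  proof (intro ball_cong refl)
    fix a f assume "a \<in> diag" "f \<in> J"
    then have "f \<in> diag" using J by blast
    then show "(on_units a \<otimes>\<^bsub>A\<^sub>0\<^esub> on_units f \<in> on_units ` J \<and> on_units f \<otimes>\<^bsub>A\<^sub>0\<^esub> on_units a \<in> on_units ` J)
        = (a \<star> f \<in> J \<and> f \<star> a \<in> J)"
      using \<open>a \<in> diag\<close> by (simp only: on_units_ops(3) mem diag_conv_diag)
  qed
  finally have mul: "(\<forall>a\<in>carrier A\<^sub>0. \<forall>x\<in>on_units ` J. a \<otimes>\<^bsub>A\<^sub>0\<^esub> x \<in> on_units ` J \<and> x \<otimes>\<^bsub>A\<^sub>0\<^esub> a \<in> on_units ` J)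
      \<longleftrightarrow> (\<forall>a\<in>diag. \<forall>f\<in>J. a \<star> f \<in> J \<and> f \<star> a \<in> J)" .
  have "bisection_act G \<O> s ` (bisection_ideal G \<O> (ginv G ` s) \<inter> on_units ` J) \<subseteq> on_units ` J \<longleftrightarrow>
      (\<forall>f\<in>J. supp G \<O> f \<subseteq> src G ` s \<longrightarrow> sact s f \<in> J)" if s: "s \<in> cob" for s
  proof -
    have "bisection_ideal G \<O> (ginv G ` s) \<inter> on_units ` J = on_units ` {f \<in> J. supp G \<O> f \<subseteq> src G ` s}"
      using J on_units_diag(1) supp_diag src_image_eq [OF cob_arrows [OF s]]
      by (fastforce simp: bisection_ideal_def)
    moreover have "bisection_act G \<O> s (on_units f) \<in> on_units ` J \<longleftrightarrow> sact s f \<in> J" if "f \<in> J" for f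
      using that J bisection_act_on_units [OF s] mem [OF sact_diag [OF s]] by (metis subset_iff)
    ultimately show ?thesis by (auto simp: image_subset_iff)
  qed
  then show ?thesis
    using add mul J unfolding invariant_ideal_def rng_ideal_def inv_diag_ideal_def by (simp cong: ball_cong)
qed

lemma bisection_simple_iff:
  "bisection_simple G \<O> \<longleftrightarrow> (\<forall>J. inv_diag_ideal J \<longrightarrow> J = {szero} \<or> J = diag)"
proof -
  have image_eq: "on_units ` J = on_units ` J' \<longleftrightarrow> J = J'" if "J \<subseteq> diag" "J' \<subseteq> diag" for J J'
    using that by (intro inj_on_image_eq_iff [of _ diag]) (auto intro: inj_onI on_units_inj)
  have J: "J = {szero} \<longleftrightarrow> on_units ` J = {\<zero>\<^bsub>A\<^sub>0\<^esub>}" "J = diag \<longleftrightarrow> on_units ` J = carrier A\<^sub>0" if "J \<subseteq> diag" for J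
    using image_eq [OF that, of "{szero}"] image_eq [OF that, of diag] diag_szero
    unfolding on_units_image on_units_ops(1) [symmetric] by auto
  show ?thesis
  proof
    assume "bisection_simple G \<O>"
    then show "\<forall>J. inv_diag_ideal J \<longrightarrow> J = {szero} \<or> J = diag"
      unfolding bisection_simple_def by (metis J invariant_ideal_on_units inv_diag_ideal_def)
  next
    assume *: "\<forall>J. inv_diag_ideal J \<longrightarrow> J = {szero} \<or> J = diag"
    show "bisection_simple G \<O>"
      unfolding bisection_simple_def
    proof (intro allI impI)
      fix I assume I: "invariant_ideal G \<O> I"
      then have "I \<subseteq> carrier A\<^sub>0"
        using abelian_group.additive_subgroup_iff [OF abelian_group_Gamma_c_units]
        by (auto simp: invariant_ideal_def rng_ideal_def)
      then obtain J where "J \<subseteq> diag" "I = on_units ` J"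
        unfolding on_units_image by (metis subset_image_iff)
      then show "I = {\<zero>\<^bsub>A\<^sub>0\<^esub>} \<or> I = carrier A\<^sub>0"
        using * I J invariant_ideal_on_units by metis
    qed
  qed
qed

section \<open>Two-sided ideals of the convolution ring\<close>

definition gideal :: "('g \<Rightarrow> 'e) set \<Rightarrow> bool" where
  "gideal I \<longleftrightarrow> I \<subseteq> Gam \<and> add_closed I \<and> (\<forall>a\<in>Gam. \<forall>f\<in>I. a \<star> f \<in> I \<and> f \<star> a \<in> I)"

lemma rng_simple_iff: "rng_simple (Gamma_c G \<O>) \<longleftrightarrow> (\<forall>I. gideal I \<longrightarrow> I = {szero} \<or> I = Gam)"
  by (simp add: rng_simple_def rng_ideal_def gideal_def additive_subgroup_Gamma_c)

lemma add_closedD: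
  assumes "add_closed T"
  shows "szero \<in> T" "f \<in> T \<Longrightarrow> g \<in> T \<Longrightarrow> sadd f g \<in> T" "f \<in> T \<Longrightarrow> sneg f \<in> T"
  using assms by (auto simp: add_closed_def)

lemma gideal_inv_diag_ideal:
  assumes "gideal I"
  shows "inv_diag_ideal (I \<inter> diag)"
proof -
  note I = assms [unfolded gideal_def]
  have "add_closed (I \<inter> diag)"
    using I add_closed_diag by (auto simp: add_closed_def)
  moreover have "a \<star> f \<in> I \<inter> diag \<and> f \<star> a \<in> I \<inter> diag" if "a \<in> diag" "f \<in> I \<inter> diag" for a f
    using that I diag_Gam diag_conv_diag by auto
  moreover have "sact s f \<in> I \<inter> diag" if "s \<in> cob" "f \<in> I \<inter> diag" for s f
    using that I sact_diag bsec_Gam [OF bsec_indic] cob_ginv unfolding sact_def by blast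
  ultimately show ?thesis
    unfolding inv_diag_ideal_def by blast
qed

section \<open>Sheaves of fields\<close>

lemma unit_in_cob:
  assumes "x \<in> units G"
  shows "\<exists>K. K \<in> cob \<and> K \<subseteq> units G \<and> x \<in> K"
  by (rule unit_cob_nhd [OF open_units assms assms]) blast

text \<open>Kept general in \<open>T\<close> since it serves both \<open>diag\<close> and
  \<open>R\<close>: the ideals attached to an invariant set \<open>D\<close> of units are cut out by
  this support condition.\<close>

lemma add_closed_tgt_support:
  assumes "add_closed T"
  shows "add_closed {f \<in> T. \<forall>\<gamma>\<in>arrows G. f \<gamma> \<noteq> ezero \<O> (tgt G \<gamma>) \<longrightarrow> tgt G \<gamma> \<in> D}" (is "add_closed ?I")
  unfolding add_closed_def
proof (intro conjI ballI)
  note T = add_closedD [OF assms]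
  show "?I \<subseteq> sections" using assms by (auto simp: add_closed_def)
  show "szero \<in> ?I" using T(1) by simp
  have "f \<gamma> \<noteq> ezero \<O> (tgt G \<gamma>) \<or> g \<gamma> \<noteq> ezero \<O> (tgt G \<gamma>)"
    if "\<gamma> \<in> arrows G" "sadd f g \<gamma> \<noteq> ezero \<O> (tgt G \<gamma>)" for f g \<gamma>
    using that by auto
  then show "sadd f g \<in> ?I" if "f \<in> ?I" "g \<in> ?I" for f g
    using that T(2) by blast
  have "f \<gamma> \<noteq> ezero \<O> (tgt G \<gamma>)" if "\<gamma> \<in> arrows G" "sneg f \<gamma> \<noteq> ezero \<O> (tgt G \<gamma>)" for f \<gamma>
    using that by auto
  then show "sneg f \<in> ?I" if "f \<in> ?I" for f
    using that T(3) by blast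
qed

lemma diag_comm:
  assumes fld: "\<And>x. x \<in> units G \<Longrightarrow> field (stalk \<O> x)" and a: "a \<in> diag" "b \<in> diag"
  shows "a \<star> b = b \<star> a"
proof (rule diag_eqI)
  fix x assume x: "x \<in> units G"
  interpret field "stalk \<O> x" using fld x .
  show "(a \<star> b) x = (b \<star> a) x"
    using m_comm [of "a x" "b x"] a x by (simp add: diag_conv_unit diag_fib)
qed (use a diag_conv_diag in auto)

text \<open>The point is that the bisection stays \<open>U\<close>. The two products can therefore
  be subtracted within one generator, so commuting with a diagonal section does not increase the
  number of summands.\<close>

lemma bsec_diag_conv:
  assumes f: "bsec U f" and a: "a \<in> diag"
  shows "bsec U (a \<star> f)" "bsec U (f \<star> a)"
proof -
  note F = bsecD [OF f]
  have arr: "U \<subseteq> arrows G" using F(2) by (rule cob_arrows)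
  let ?X = "subtopology (gtop G) U"
  have top: "topspace ?X = U" using F(2) by (rule topspace_cob)
  have ac: "continuous_map (unit_space G) (etop \<O>) a"
    using a bsec_units_continuous by (auto simp: diag_def)
  have at: "continuous_map ?X (etop \<O>) (\<lambda>\<gamma>. a (tgt G \<gamma>))"
    by (intro continuous_map_unit_space [OF ac] continuous_map_tgt continuous_map_id_subtopology)
      (use top arr in auto)
  have as: "continuous_map ?X (etop \<O>) (\<lambda>\<gamma>. a (src G \<gamma>))"
    by (intro continuous_map_unit_space [OF ac] continuous_map_src continuous_map_id_subtopology)
      (use top arr in auto)
  have fibs: "a (tgt G \<gamma>) \<in> fib (tgt G \<gamma>)" "act \<O> \<gamma> (a (src G \<gamma>)) \<in> fib (tgt G \<gamma>)" if "\<gamma> \<in> arrows G" for \<gamma>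
    using that diag_fib [OF a] by auto
  have aa: "continuous_map ?X (etop \<O>) (\<lambda>\<gamma>. act \<O> \<gamma> (a (src G \<gamma>)))"
  proof (intro continuous_map_act as continuous_map_id_subtopology)
    show "src G \<gamma> = proj \<O> (a (src G \<gamma>))" if "\<gamma> \<in> topspace ?X" for \<gamma>
      using that top arr proj_fib [OF diag_fib [OF a]] by (metis src_units subsetD)
  qed
  have pr: "proj \<O> (a (tgt G \<gamma>)) = proj \<O> (f \<gamma>)" "proj \<O> (f \<gamma>) = proj \<O> (act \<O> \<gamma> (a (src G \<gamma>)))"
    if "\<gamma> \<in> topspace ?X" for \<gamma>
    using that top arr fibs [of \<gamma>] F(1) by (auto simp: proj_fib proj_sections subset_iff)
  have "continuous_map ?X (etop \<O>) (a \<star> f)"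
    by (rule continuous_map_eq [OF continuous_map_emul [OF at F(3) pr(1)]])
      (use top arr diag_conv [OF a F(1)] in auto)
  moreover have "continuous_map ?X (etop \<O>) (f \<star> a)"
    by (rule continuous_map_eq [OF continuous_map_emul [OF F(3) aa pr(2)]])
      (use top arr conv_diag [OF a F(1)] in auto)
  moreover have "(a \<star> f) \<gamma> = ezero \<O> (tgt G \<gamma>)" "(f \<star> a) \<gamma> = ezero \<O> (tgt G \<gamma>)"
    if "\<gamma> \<in> arrows G" "\<gamma> \<notin> U" for \<gamma>
    using that F(4) [OF that] fibs [OF that(1)] diag_conv [OF a F(1)] conv_diag [OF a F(1)] by simp_all
  ultimately show "bsec U (a \<star> f)" "bsec U (f \<star> a)"
    using F a diag_sections unfolding bsec_def by auto
qed

text \<open>Applied below to right translation by the inverse of a bisection and to the commutator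
  with a diagonal section: both are additive and send generators to generators, so neither lengthens
  a sum.\<close>

lemma bsum_map:
  assumes "bsum W n f"
    and "\<And>U f. bsec U f \<Longrightarrow> U \<subseteq> W \<Longrightarrow> \<exists>V\<subseteq>W. bsec V (T f)"
    and "T szero = szero"
    and "\<And>f g. f \<in> Gam \<Longrightarrow> g \<in> Gam \<Longrightarrow> T (sadd f g) = sadd (T f) (T g)" and "W \<subseteq> arrows G"
  shows "bsum W n (T f)"
  using assms(1)
proof (induction rule: bsum.induct)
  case bsum_szero
  then show ?case using assms(3) bsum.bsum_szero by simp
next
  case (bsum_sadd U f n g)
  have "bsum V n g" if "bsum W n g" "W \<subseteq> V" for n g V
    using that by (induction rule: bsum.induct) (auto intro: bsum.intros)
  then have "g \<in> Gam" using bsum_sadd(3) assms(5) Gamma_c_on_iff by blast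
  moreover obtain V where "V \<subseteq> W" "bsec V (T f)" using assms(2) bsum_sadd(1,2) by blast
  ultimately show ?case
    using assms(4) [of f g] bsec_Gam [OF bsum_sadd(1)] bsum.bsum_sadd [of V "T f"] bsum_sadd(4) by simp
qed

end

locale ample_field_sheaf = ample_ring_sheaf + sheaf_of_fields G \<O>
begin

section \<open>Inverting nonzero values\<close>

lemma eone_nonzero [simp]: "x \<in> units G \<Longrightarrow> eone \<O> x \<noteq> ezero \<O> x" "x \<in> units G \<Longrightarrow> ezero \<O> x \<noteq> eone \<O> x"
  using domain.one_not_zero [OF field.axioms(1) [OF field_stalk], of x] by auto

lemma emul_comm: "a \<in> fib x \<Longrightarrow> b \<in> fib x \<Longrightarrow> emul \<O> a b = emul \<O> b a"
  using cring.cring_simprules(14) [OF domain.axioms(1) [OF field.axioms(1) [OF field_stalk]], of x a b] fib_units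
  by simp

lemma fib_inverse:
  assumes "e \<in> fib x" "e \<noteq> ezero \<O> x"
  obtains e' where "e' \<in> fib x" "emul \<O> e' e = eone \<O> x"
proof -
  interpret field "stalk \<O> x" using field_stalk fib_units assms by blast
  have "e \<in> Units (stalk \<O> x)" using assms field_Units by simp
  then show thesis using that [of "inv\<^bsub>stalk \<O> x\<^esub> e"] Units_inv_closed Units_l_inv by simp
qed

lemma emul_cancel:
  assumes "e \<in> fib x" "e \<noteq> ezero \<O> x" "a \<in> fib x" "b \<in> fib x" "emul \<O> e a = emul \<O> e b"
  shows "a = b"
proof -
  obtain e' where e': "e' \<in> fib x" "emul \<O> e' e = eone \<O> x" using fib_inverse assms(1,2) .
  have "emul \<O> (emul \<O> e' e) a = emul \<O> (emul \<O> e' e) b"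
    using e'(1) assms by (simp add: emul_assoc)
  then show ?thesis using e' assms by simp
qed

lemma Gam_indic: "U \<in> cob \<Longrightarrow> indic U \<in> Gam"
  by (rule bsec_Gam [OF bsec_indic])

lemma diag_indic: "K \<in> cob \<Longrightarrow> K \<subseteq> units G \<Longrightarrow> indic K \<in> diag"
  by (rule bsec_diag [OF bsec_indic])

text \<open>A local section through the inverse of the value at x multiplies \<open>f\<close> to one
  at x, hence nearby, and there \<open>f\<close> cannot vanish. This is how the field property of
  the stalks enters the topology.\<close>

lemma open_nonzeros:
  assumes f: "continuous_map X (etop \<O>) f"
  shows "openin X {x \<in> topspace X. f x \<noteq> ezero \<O> (proj \<O> (f x))}"
proof (subst openin_subopen, clarify)
  fix x assume x: "x \<in> topspace X" "f x \<noteq> ezero \<O> (proj \<O> (f x))"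
  have ft: "f y \<in> fib (proj \<O> (f y))" if "y \<in> topspace X" for y
    using that continuous_map_funspace [OF f] by (auto simp: fib_iff)
  obtain e where e: "e \<in> fib (proj \<O> (f x))" "emul \<O> e (f x) = eone \<O> (proj \<O> (f x))"
    using fib_inverse [OF ft x(2)] x(1) by blast
  obtain K t where t: "bsec K t" "K \<subseteq> units G" "t (proj \<O> (f x)) = e"
    using bsec_through [OF e(1) open_units fib_units [OF e(1)]] by metis
  have td: "t \<in> diag" using t bsec_diag by blast
  have pc: "continuous_map X (gtop G) (\<lambda>y. proj \<O> (f y))"
    using f by (rule continuous_map_proj)
  have pu: "proj \<O> (f y) \<in> units G" if "y \<in> topspace X" for y
    using ft [OF that] by (rule fib_units)
  have tc: "continuous_map X (etop \<O>) (\<lambda>y. t (proj \<O> (f y)))"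
    by (intro continuous_map_unit_space [OF bsec_units_continuous [OF t(1,2)]] pc pu)
  have tp: "t (proj \<O> (f y)) \<in> fib (proj \<O> (f y))" if "y \<in> topspace X" for y
    using diag_fib [OF td pu [OF that]] .
  have mc: "continuous_map X (etop \<O>) (\<lambda>y. emul \<O> (t (proj \<O> (f y))) (f y))"
    by (intro continuous_map_emul tc f) (use tp proj_fib in metis)
  have oc: "continuous_map X (etop \<O>) (\<lambda>y. eone \<O> (proj \<O> (f y)))"
    by (intro continuous_map_eone pc pu)
  have "proj \<O> (emul \<O> (t (proj \<O> (f y))) (f y)) = proj \<O> (eone \<O> (proj \<O> (f y)))" if "y \<in> topspace X" for y
    using proj_fib [OF emul_closed [OF tp [OF that] ft [OF that]]] proj_fib [OF eone_closed [OF pu [OF that]]] by simp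
  from eventually_agree [OF mc oc this x(1)] e(2) t(3)
  obtain N where N: "openin X N" "x \<in> N" "\<forall>y\<in>N. emul \<O> (t (proj \<O> (f y))) (f y) = eone \<O> (proj \<O> (f y))"
    by auto
  moreover have "f y \<noteq> ezero \<O> (proj \<O> (f y))" if "y \<in> N" for y
  proof
    assume *: "f y = ezero \<O> (proj \<O> (f y))"
    have y: "y \<in> topspace X" using that openin_subset [OF N(1)] by blast
    have "emul \<O> (t (proj \<O> (f y))) (f y) = ezero \<O> (proj \<O> (f y))"
      by (subst (2) *) (rule emul_ezero [OF tp [OF y]])
    then show False using N(3) that pu [OF y] by simp
  qed
  moreover have "N \<subseteq> topspace X" using N(1) by (rule openin_subset)
  ultimately show "\<exists>T. openin X T \<and> x \<in> T \<and> T \<subseteq> {x \<in> topspace X. f x \<noteq> ezero \<O> (proj \<O> (f x))}"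
    by (intro exI [of _ N]) auto
qed

section \<open>Invariant ideals of the diagonal and open invariant sets of units\<close>

lemma diag_nonzeros_open:
  assumes "f \<in> diag"
  shows "openin (gtop G) {x \<in> units G. f x \<noteq> ezero \<O> x}"
proof -
  have "continuous_map (unit_space G) (etop \<O>) f"
    using assms bsec_units_continuous by (auto simp: diag_def)
  from open_nonzeros [OF this]
  have "openin (gtop G) {x \<in> units G. f x \<noteq> ezero \<O> (proj \<O> (f x))}"
    by (simp add: openin_unit_space)
  moreover have "{x \<in> units G. f x \<noteq> ezero \<O> (proj \<O> (f x))} = {x \<in> units G. f x \<noteq> ezero \<O> x}"
    using diag_fib [OF assms] proj_fib by (metis (no_types, lifting))
  ultimately show ?thesis by simp
qed

text \<open>Multiplying \<open>f\<close> by a diagonal section through the inverse of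
  \<open>f x\<close> stays in the ideal and gives one at x, hence on a neighbourhood.\<close>

lemma inv_diag_ideal_local_unit:
  assumes J: "inv_diag_ideal J" and f: "f \<in> J" and x: "x \<in> units G" "f x \<noteq> ezero \<O> x"
  obtains g N where "g \<in> J" "openin (gtop G) N" "x \<in> N" "\<And>y. y \<in> N \<Longrightarrow> y \<in> units G \<and> g y = eone \<O> y"
proof -
  have fd: "f \<in> diag" using J f by (auto simp: inv_diag_ideal_def)
  obtain e where e: "e \<in> fib x" "emul \<O> e (f x) = eone \<O> x"
    using fib_inverse [OF diag_fib [OF fd x(1)] x(2)] .
  obtain K t where t: "bsec K t" "K \<subseteq> units G" "t x = e"
    using bsec_through [OF e(1) open_units x(1)] by metis
  have td: "t \<in> diag" using t bsec_diag by blast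
  have g: "t \<star> f \<in> J" "t \<star> f \<in> diag" using J f td diag_conv_diag fd by (auto simp: inv_diag_ideal_def)
  have gc: "continuous_map (unit_space G) (etop \<O>) (t \<star> f)"
    using g(2) bsec_units_continuous by (auto simp: diag_def)
  have "proj \<O> ((t \<star> f) y) = proj \<O> (eone \<O> y)" if "y \<in> topspace (unit_space G)" for y
    using that proj_fib [OF diag_fib [OF g(2)]] proj_fib [OF eone_closed] by simp
  from eventually_agree [OF gc continuous_eone this, of x]
  obtain N where "openin (unit_space G) N" "x \<in> N" "\<forall>y\<in>N. (t \<star> f) y = eone \<O> y"
    using x e(2) t(3) diag_conv_unit [OF td fd x(1)] by auto
  then show thesis
    using that [OF g(1), of N] by (auto simp: openin_unit_space)
qed

text \<open>A finite subcover by the neighbourhoods of \<open>inv_diag_ideal_local_unit\<close>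
  reduces the claim to joining two sets on each of which some element of \<open>J\<close> is
  one.\<close>

lemma inv_diag_ideal_unit_on_compact:
  assumes J: "inv_diag_ideal J" and full: "\<And>x. x \<in> units G \<Longrightarrow> \<exists>f\<in>J. f x \<noteq> ezero \<O> x"
    and C: "compactin (gtop G) C" "C \<subseteq> units G"
  shows "\<exists>g\<in>J. \<forall>y\<in>C. g y = eone \<O> y"
proof -
  define good where "good N \<longleftrightarrow> N \<subseteq> units G \<and> (\<exists>g\<in>J. \<forall>y\<in>N. g y = eone \<O> y)" for N
  let ?\<N> = "{N. openin (gtop G) N \<and> good N}"
  have Jd: "J \<subseteq> diag" "add_closed J" using J by (auto simp: inv_diag_ideal_def)
  have Un: "good (M \<union> N)" if "good M" "good N" for M N
  proof -
    obtain g h where g: "g \<in> J" "\<forall>y\<in>M. g y = eone \<O> y" and h: "h \<in> J" "\<forall>y\<in>N. h y = eone \<O> y"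
      using \<open>good M\<close> \<open>good N\<close> by (auto simp: good_def)
    have MN: "M \<union> N \<subseteq> units G" using that by (auto simp: good_def)
    have d: "g \<in> diag" "h \<in> diag" using g h Jd by auto
    \<comment> \<open>This is g + h - gh, formally 1 - (1 - g)(1 - h), so it is one wherever
      \<open>g\<close> or \<open>h\<close> is.\<close>
    define w where "w = sadd g (sadd h (sneg (g \<star> h)))"
    have "g \<star> h \<in> J" using J h(1) d(1) by (auto simp: inv_diag_ideal_def)
    then have "w \<in> J" unfolding w_def using g h add_closedD [OF Jd(2)] by simp
    moreover have "w y = eone \<O> y" if y: "y \<in> M \<union> N" for y
    proof -
      have yu: "y \<in> units G" using y MN by blast
      have gf: "g y \<in> fib y" "h y \<in> fib y" using yu d diag_fib by auto
      have w: "w y = eadd \<O> (g y) (eadd \<O> (h y) (eneg (emul \<O> (g y) (h y))))"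
        using yu d by (simp add: w_def diag_conv_unit)
      show ?thesis
      proof (cases "y \<in> M")
        case True
        then show ?thesis using g gf yu w by (simp add: eadd_eneg)
      next
        case False
        then have hy: "h y = eone \<O> y" using y h by blast
        have "eadd \<O> (g y) (eadd \<O> (eneg (g y)) (eone \<O> y)) = eone \<O> y"
          using gf yu by (simp add: eadd_eneg flip: eadd_assoc)
        then show ?thesis using gf yu w hy eadd_comm [of "eone \<O> y" y "eneg (g y)"] by simp
      qed
    qed
    ultimately show ?thesis using MN by (auto simp: good_def)
  qed
  have "C \<subseteq> \<Union>?\<N>"
  proof
    fix x assume "x \<in> C"
    then have x: "x \<in> units G" using C by blast
    then obtain f where f: "f \<in> J" "f x \<noteq> ezero \<O> x" using full by blast
    show "x \<in> \<Union>?\<N>"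
    proof (rule inv_diag_ideal_local_unit [OF J f(1) x f(2)])
      fix g N assume "g \<in> J" "openin (gtop G) N" "x \<in> N" "\<And>y. y \<in> N \<Longrightarrow> y \<in> units G \<and> g y = eone \<O> y"
      then have "N \<in> ?\<N>" unfolding good_def by blast
      then show ?thesis using \<open>x \<in> N\<close> by blast
    qed
  qed
  moreover have "\<forall>N\<in>?\<N>. openin (gtop G) N" by simp
  ultimately have "\<exists>\<F>. finite \<F> \<and> \<F> \<subseteq> ?\<N> \<and> C \<subseteq> \<Union>\<F>"
    using C(1) unfolding compactin_def by presburger
  then obtain \<F> where \<F>: "finite \<F>" "\<F> \<subseteq> ?\<N>" "C \<subseteq> \<Union>\<F>" by metis
  have "good (\<Union>\<F>)"
    using \<F>(1,2)
  proof (induction \<F> rule: finite_induct)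
    case empty
    then show ?case using add_closedD(1) [OF Jd(2)] by (auto simp: good_def)
  next
    case (insert N \<F>)
    then have "good N" "good (\<Union>\<F>)" by simp_all
    then show ?case using Un by simp
  qed
  then obtain g where "g \<in> J" "\<forall>y\<in>\<Union>\<F>. g y = eone \<O> y" unfolding good_def by metis
  then show ?thesis using \<F>(3) by (meson subsetD)
qed

text \<open>\<open>diag\<close> has no unit in general. An element of \<open>J\<close> that is one
  on a compact set carrying \<open>v\<close> serves as a unit for \<open>v\<close> and so puts
  \<open>v\<close> into \<open>J\<close>.\<close>

lemma inv_diag_ideal_full:
  assumes J: "inv_diag_ideal J" and full: "\<And>x. x \<in> units G \<Longrightarrow> \<exists>f\<in>J. f x \<noteq> ezero \<O> x"
  shows "J = diag"
proof
  show "J \<subseteq> diag" using J by (auto simp: inv_diag_ideal_def)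
  show "diag \<subseteq> J"
  proof
    fix v assume v: "v \<in> diag"
    then obtain K where K: "K \<subseteq> units G" "bsec K v" by (auto simp: diag_def)
    note V = bsecD [OF K(2)]
    obtain g where g: "g \<in> J" "\<forall>y\<in>K. g y = eone \<O> y"
      using inv_diag_ideal_unit_on_compact [OF J full cob_compact [OF V(2)] K(1)] by blast
    have gd: "g \<in> diag" using g J by (auto simp: inv_diag_ideal_def)
    have "g \<star> v = v"
    proof (rule diag_eqI)
      fix x assume x: "x \<in> units G"
      show "(g \<star> v) x = v x"
        using diag_conv_unit [OF gd v x] g(2) V(4) [of x] x diag_fib [OF v x] diag_fib [OF gd x]
        by (cases "x \<in> K") auto
    qed (use gd v diag_conv_diag in auto)
    moreover have "g \<star> v \<in> J" using J g(1) v by (auto simp: inv_diag_ideal_def)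
    ultimately show "v \<in> J" by simp
  qed
qed

text \<open>The open invariant set attached to \<open>J\<close> consists of the units where not all
  members of \<open>J\<close> vanish. If it is empty, \<open>J\<close> is zero; if it is everything,
  \<open>inv_diag_ideal_full\<close> applies.\<close>

lemma minimal_imp_bisection_simple:
  assumes "minimal G"
  shows "bisection_simple G \<O>"
  unfolding bisection_simple_iff
proof (intro allI impI)
  fix J assume J: "inv_diag_ideal J"
  define D where "D = {x \<in> units G. \<exists>f\<in>J. f x \<noteq> ezero \<O> x}"
  have Jd: "J \<subseteq> diag" "szero \<in> J" using J by (auto simp: inv_diag_ideal_def add_closed_def)
  have "D = (\<Union>f\<in>J. {x \<in> units G. f x \<noteq> ezero \<O> x})" by (auto simp: D_def)
  then have "openin (gtop G) D"
    using Jd diag_nonzeros_open by auto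
  then have op: "openin (unit_space G) D" by (auto simp: openin_unit_space D_def)
  have tr: "tgt G \<gamma> \<in> D" if \<gamma>: "\<gamma> \<in> arrows G" "src G \<gamma> \<in> D" for \<gamma>
  proof -
    obtain f where f: "f \<in> J" "f (src G \<gamma>) \<noteq> ezero \<O> (src G \<gamma>)" using \<gamma>(2) by (auto simp: D_def)
    have fd: "f \<in> diag" using f Jd by blast
    have "openin (gtop G) (arrows G)" by (simp add: arrows_def)
    then obtain s where s: "s \<in> cob" "\<gamma> \<in> s" using cob_nhd \<gamma>(1) by metis
    have K: "src G ` s \<in> cob" "src G ` s \<subseteq> units G"
      using s(1) cob_src cob_arrows by (auto simp: subset_iff)
    \<comment> \<open>\<open>f\<close> is cut down to the source of \<open>s\<close>, because
      invariance of \<open>J\<close> speaks only about sections supported there; the value at the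
      source of \<gamma> survives.\<close>
    define f' where "f' = f \<star> indic (src G ` s)"
    have id: "indic (src G ` s) \<in> diag" using diag_indic [OF K] .
    have f': "f' \<in> J" "f' \<in> diag"
      using J f(1) id Jd unfolding f'_def inv_diag_ideal_def by blast+
    have val: "f' x = (if x \<in> src G ` s then f x else ezero \<O> x)" if "x \<in> units G" for x
      using that diag_conv_unit [OF fd id that] diag_fib [OF fd that] by (simp add: f'_def)
    have "supp G \<O> f' \<subseteq> src G ` s"
      unfolding supp_diag [OF f'(2)] using val by (auto simp: unit_supp_def)
    then have "sact s f' \<in> J" using J s(1) f'(1) by (auto simp: inv_diag_ideal_def)
    moreover have "sact s f' (tgt G \<gamma>) \<noteq> ezero \<O> (tgt G \<gamma>)"
      using sact_apply(1) [OF s(1) f'(2) s(2)] val [of "src G \<gamma>"] s(2) \<gamma>(1) f(2) diag_fib [OF fd, of "src G \<gamma>"]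
      by (simp add: act_eq_ezero)
    ultimately show ?thesis using \<gamma>(1) by (auto simp: D_def)
  qed
  have "invariant G D"
    unfolding invariant_def
  proof (intro conjI ballI iffI)
    show "D \<subseteq> units G" by (auto simp: D_def)
    fix \<gamma> assume \<gamma>: "\<gamma> \<in> arrows G"
    show "tgt G \<gamma> \<in> D" if "src G \<gamma> \<in> D" using tr \<gamma> that .
    show "src G \<gamma> \<in> D" if "tgt G \<gamma> \<in> D" using tr [of "ginv G \<gamma>"] \<gamma> that by simp
  qed
  then consider "D = {}" | "D = units G"
    using assms op unfolding minimal_def by blast
  then show "J = {szero} \<or> J = diag"
  proof cases
    case 1
    have "f = szero" if "f \<in> J" for f
      using that Jd diag_szero 1 by (intro diag_eqI) (auto simp: D_def)
    then show ?thesis using Jd by blast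
  next
    case 2
    then have "\<exists>f\<in>J. f x \<noteq> ezero \<O> x" if "x \<in> units G" for x
      using that unfolding D_def by blast
    then show ?thesis using inv_diag_ideal_full [OF J] by blast
  qed
qed

lemma indic_nonzero:
  assumes "x \<in> units G" "x \<in> K"
  shows "indic K \<noteq> szero"
proof
  assume "indic K = szero"
  then have "indic K x = szero x" by simp
  then show False using assms by simp
qed

text \<open>The sections vanishing off \<open>D\<close> form an invariant ideal. Characteristic
  sections of sets inside \<open>D\<close> prevent it from being zero, and those around an arbitrary
  unit show that it is all of \<open>diag\<close> only if \<open>D\<close> is everything.\<close>

lemma bisection_simple_imp_minimal:
  assumes simple: "bisection_simple G \<O>"
  shows "minimal G"
  unfolding minimal_def
proof (intro allI impI)
  fix D assume D: "openin (unit_space G) D \<and> invariant G D"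
  then have inv: "\<And>\<gamma>. \<gamma> \<in> arrows G \<Longrightarrow> src G \<gamma> \<in> D \<longleftrightarrow> tgt G \<gamma> \<in> D" "D \<subseteq> units G" "openin (gtop G) D"
    by (auto simp: invariant_def openin_unit_space)
  define J where "J = {f \<in> diag. \<forall>x\<in>units G. f x \<noteq> ezero \<O> x \<longrightarrow> x \<in> D}"
  have Jd: "J \<subseteq> diag" by (auto simp: J_def)
  have "J = {f \<in> diag. \<forall>\<gamma>\<in>arrows G. f \<gamma> \<noteq> ezero \<O> (tgt G \<gamma>) \<longrightarrow> tgt G \<gamma> \<in> D}" (is "J = ?J")
  proof (intro subset_antisym subsetI)
    fix f assume f: "f \<in> ?J"
    then have *: "\<forall>\<gamma>\<in>arrows G. f \<gamma> \<noteq> ezero \<O> (tgt G \<gamma>) \<longrightarrow> tgt G \<gamma> \<in> D" by blast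
    have "x \<in> D" if "x \<in> units G" "f x \<noteq> ezero \<O> x" for x
      using bspec [OF *, of x] that by simp
    then show "f \<in> J" using f by (simp add: J_def)
  next
    fix f assume f: "f \<in> J"
    have "tgt G \<gamma> \<in> D" if \<gamma>: "\<gamma> \<in> arrows G" "f \<gamma> \<noteq> ezero \<O> (tgt G \<gamma>)" for \<gamma>
    proof -
      have "\<gamma> \<in> units G" using diag_outside [of f \<gamma>] f Jd \<gamma> by blast
      then show ?thesis using f \<gamma>(2) by (simp add: J_def)
    qed
    then show "f \<in> ?J" using f Jd by blast
  qed
  then have "add_closed J"
    using add_closed_tgt_support [OF add_closed_diag] by simp
  moreover have "a \<star> f \<in> J \<and> f \<star> a \<in> J" if "a \<in> diag" "f \<in> J" for a f
  proof -
    have fd: "f \<in> diag" using that by (simp add: J_def)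
    have "f x \<noteq> ezero \<O> x" if "x \<in> units G" "(a \<star> f) x \<noteq> ezero \<O> x \<or> (f \<star> a) x \<noteq> ezero \<O> x" for x
      using that diag_conv_unit [OF \<open>a \<in> diag\<close> fd that(1)] diag_conv_unit [OF fd \<open>a \<in> diag\<close> that(1)]
        diag_fib [OF \<open>a \<in> diag\<close> that(1)] by auto
    then show ?thesis using that diag_conv_diag fd unfolding J_def by blast
  qed
  moreover have "sact s f \<in> J" if s: "s \<in> cob" and f: "f \<in> J" for s f
  proof -
    have fd: "f \<in> diag" using f by (simp add: J_def)
    have "x \<in> D" if x: "x \<in> units G" "sact s f x \<noteq> ezero \<O> x" for x
    proof -
      obtain \<gamma> where \<gamma>: "\<gamma> \<in> s" "x = tgt G \<gamma>" using sact_apply(2) [OF s fd x(1)] x(2) by blast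
      then have g: "\<gamma> \<in> arrows G" using cob_arrows [OF s] by blast
      have "f (src G \<gamma>) \<noteq> ezero \<O> (src G \<gamma>)"
        using sact_apply(1) [OF s fd \<gamma>(1)] x(2) g \<gamma>(2) by auto
      then have "src G \<gamma> \<in> D" using f g by (simp add: J_def)
      then show ?thesis using inv(1) [OF g] \<gamma>(2) by simp
    qed
    then show ?thesis using sact_diag [OF s fd] by (simp add: J_def)
  qed
  ultimately have "inv_diag_ideal J"
    using Jd unfolding inv_diag_ideal_def by blast
  then have J: "J = {szero} \<or> J = diag" using simple by (simp add: bisection_simple_iff)
  show "D = {} \<or> D = units G"
  proof (cases "D = {}")
    case False
    then obtain x where x: "x \<in> D" by blast
    obtain K where K: "K \<in> cob" "K \<subseteq> units G" "x \<in> K" "K \<subseteq> D"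
      using unit_cob_nhd [OF inv(3) x] inv(2) x by blast
    have "indic K \<in> J" using diag_indic [OF K(1,2)] K(4) by (auto simp: J_def)
    then have "J = diag" using J indic_nonzero [of x K] K x inv(2) by blast
    moreover have "y \<in> D" if "J = diag" and y: "y \<in> units G" for y
    proof -
      obtain L where L: "L \<in> cob" "L \<subseteq> units G" "y \<in> L"
        using unit_in_cob [OF y] by blast
      then have "indic L \<in> J" using diag_indic that by simp
      then show ?thesis using y L by (simp add: J_def)
    qed
    ultimately show ?thesis using inv(2) by blast
  qed simp
qed

section \<open>Necessary conditions for simplicity\<close>

lemma gideal_tgt_support:
  assumes "invariant G D"
  shows "gideal {f \<in> Gam. \<forall>\<gamma>\<in>arrows G. f \<gamma> \<noteq> ezero \<O> (tgt G \<gamma>) \<longrightarrow> tgt G \<gamma> \<in> D}" (is "gideal ?I")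
  unfolding gideal_def
proof (intro conjI ballI)
  show "add_closed ?I"
    by (intro add_closed_tgt_support Gamma_c_on_add_closed)
  fix a f assume a: "a \<in> Gam" and f: "f \<in> ?I"
  have s: "a \<in> sections" "f \<in> sections" using a f Gam_sections by auto
  have "tgt G \<gamma> \<in> D" if g: "\<gamma> \<in> arrows G" "(a \<star> f) \<gamma> \<noteq> ezero \<O> (tgt G \<gamma>)" for \<gamma>
  proof -
    obtain \<beta> where \<beta>: "\<beta> \<in> arrows G" "tgt G \<beta> = tgt G \<gamma>" "f (ginv G \<beta> \<cdot> \<gamma>) \<noteq> ezero \<O> (src G \<beta>)"
      using conv_nonzero [OF s g] by blast
    moreover have "\<forall>\<gamma>\<in>arrows G. f \<gamma> \<noteq> ezero \<O> (tgt G \<gamma>) \<longrightarrow> tgt G \<gamma> \<in> D" using f by blast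
    \<comment> \<open>The right factor has its range at the source of \<beta>, which therefore lies
      in \<open>D\<close>; invariance carries this along \<beta> to the range of \<gamma>.\<close>
    from bspec [OF this, of "ginv G \<beta> \<cdot> \<gamma>"] have "src G \<beta> \<in> D"
      using \<beta> g(1) by simp
    ultimately have "src G \<beta> \<in> D" by blast
    then show ?thesis using assms \<beta> by (auto simp: invariant_def)
  qed
  then show "a \<star> f \<in> ?I" using a f Gam_conv_closed by auto
  have "tgt G \<gamma> \<in> D" if g: "\<gamma> \<in> arrows G" "(f \<star> a) \<gamma> \<noteq> ezero \<O> (tgt G \<gamma>)" for \<gamma>
  proof -
    obtain \<beta> where "\<beta> \<in> arrows G" "tgt G \<beta> = tgt G \<gamma>" "f \<beta> \<noteq> ezero \<O> (tgt G \<gamma>)"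
      using conv_nonzero [OF s(2,1) g] by blast
    then show ?thesis using f by force
  qed
  then show "f \<star> a \<in> ?I" using a f Gam_conv_closed by auto
qed auto

lemma simple_imp_minimal:
  assumes "rng_simple (Gamma_c G \<O>)"
  shows "minimal G"
  unfolding minimal_def
proof (intro allI impI)
  fix D assume D: "openin (unit_space G) D \<and> invariant G D"
  let ?I = "{f \<in> Gam. \<forall>\<gamma>\<in>arrows G. f \<gamma> \<noteq> ezero \<O> (tgt G \<gamma>) \<longrightarrow> tgt G \<gamma> \<in> D}"
  have I: "?I = {szero} \<or> ?I = Gam"
    using assms gideal_tgt_support D unfolding rng_simple_iff by blast
  have sub: "D \<subseteq> units G" "openin (gtop G) D" using D by (auto simp: openin_unit_space)
  show "D = {} \<or> D = units G"
  proof (cases "D = {}")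
    case False
    then obtain x where x: "x \<in> D" by blast
    obtain K where K: "K \<in> cob" "K \<subseteq> units G" "x \<in> K" "K \<subseteq> D"
      using unit_cob_nhd [OF sub(2) x] sub(1) x by blast
    have "indic K \<in> ?I"
      using Gam_indic [OF K(1)] K by (auto simp: subset_iff)
    then have "?I = Gam" using I indic_nonzero [of x K] K x sub(1) by blast
    moreover have "y \<in> D" if "?I = Gam" and y: "y \<in> units G" for y
    proof -
      obtain L where L: "L \<in> cob" "L \<subseteq> units G" "y \<in> L"
        using unit_in_cob [OF y] by blast
      then have "indic L \<in> ?I" using Gam_indic that by blast
      then have "\<forall>\<gamma>\<in>arrows G. indic L \<gamma> \<noteq> ezero \<O> (tgt G \<gamma>) \<longrightarrow> tgt G \<gamma> \<in> D" by blast
      from bspec [OF this, of y] show ?thesis using y L by simp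
    qed
    ultimately show ?thesis using sub by blast
  qed simp
qed

text \<open>Hinge of the equivalences: it amounts to maximal commutativity of \<open>diag\<close>,
  and also to the two kernel conditions of the theorem taken together.\<close>

definition ker_cond :: bool where
  "ker_cond \<longleftrightarrow> (\<forall>f\<in>Gam. supp G \<O> f \<subseteq> sheaf_ker G \<O> \<longrightarrow> f \<in> diag)"

text \<open>This is the annihilator of the module. As \<open>h\<close> ranges over all of
  \<open>R\<close>, right multiples are covered by associativity; left multiples are covered by
  \<open>tot_tot_conv\<close>, which lets the inner product be replaced by its total, zero.\<close>

lemma gideal_annihilator: "gideal {f \<in> Gam. \<forall>h\<in>Gam. tot (f \<star> h) = szero}" (is "gideal ?I")
  unfolding gideal_def
proof (intro conjI ballI)
  have add: "tot (sadd f g \<star> h) = sadd (tot (f \<star> h)) (tot (g \<star> h))" if "f \<in> Gam" "g \<in> Gam" "h \<in> Gam" for f g h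
    using that by (simp add: Gam_conv_sadd_left tot_sadd Gam_sections Gam_fibfin Gam_conv_closed)
  show "add_closed ?I"
    unfolding add_closed_def
  proof (intro conjI ballI)
    show "?I \<subseteq> sections" using Gam_sections by blast
    show "szero \<in> ?I" by (auto simp: Gam_szero Gam_sections)
    show "sadd f g \<in> ?I" if "f \<in> ?I" "g \<in> ?I" for f g
      using that by (auto simp: add Gam_sadd)
    show "sneg f \<in> ?I" if f: "f \<in> ?I" for f
    proof -
      have "tot (sneg f \<star> h) = szero" if h: "h \<in> Gam" for h
      proof -
        have fG: "f \<in> Gam" "tot (f \<star> h) = szero" using f h by auto
        have "tot (sneg f \<star> h) = sadd (tot (f \<star> h)) (tot (sneg f \<star> h))"
          using fG h Gam_sneg [OF fG(1)] by (simp add: Gam_sections)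
        also have "\<dots> = tot (sadd f (sneg f) \<star> h)"
          using fG(1) h by (simp only: add Gam_sneg)
        also have "\<dots> = szero"
          using fG(1) h by (simp add: sadd_sneg Gam_sections)
        finally show ?thesis .
      qed
      then show ?thesis using f Gam_sneg by blast
    qed
  qed
  fix a f assume a: "a \<in> Gam" and f: "f \<in> ?I"
  have "tot (a \<star> f \<star> h) = szero" if h: "h \<in> Gam" for h
    using tot_tot_conv [OF a, of "f \<star> h"] f h a by (simp add: Gam_conv_assoc Gam_conv_closed Gam_sections)
  then show "a \<star> f \<in> ?I" using a f Gam_conv_closed by auto
  show "f \<star> a \<in> ?I" using a f by (auto simp: Gam_conv_assoc Gam_conv_closed)
qed auto

lemma simple_imp_ker_cond:
  assumes "rng_simple (Gamma_c G \<O>)"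
  shows ker_cond
  unfolding ker_cond_def
proof (intro ballI impI)
  fix f assume f: "f \<in> Gam" and ker: "supp G \<O> f \<subseteq> sheaf_ker G \<O>"
  let ?I = "{f \<in> Gam. \<forall>h\<in>Gam. tot (f \<star> h) = szero}"
  have I: "?I = {szero} \<or> ?I = Gam"
    using assms gideal_annihilator unfolding rng_simple_iff by blast
  have tf: "tot f \<in> diag" "tot f \<in> Gam" using tot_diag [OF f] diag_Gam by auto
  note S = Gam_sections [OF f] Gam_sections [OF tf(2)]
  define u where "u = sadd f (sneg (tot f))"
  have "tot (u \<star> h) = szero" if h: "h \<in> Gam" for h
  proof -
    have n: "sneg (tot f) \<in> Gam" using tf Gam_sneg by blast
    have "tot (u \<star> h) = sadd (tot (f \<star> h)) (tot (sneg (tot f) \<star> h))"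
      using f h n by (simp add: u_def Gam_conv_sadd_left tot_sadd Gam_sections Gam_fibfin Gam_conv_closed)
    also have "\<dots> = sadd (tot (tot f \<star> h)) (tot (sneg (tot f) \<star> h))"
      using tot_conv_ker [OF f h ker] by simp
    also have "\<dots> = tot (sadd (tot f) (sneg (tot f)) \<star> h)"
      using tf h n by (simp add: Gam_conv_sadd_left tot_sadd Gam_sections Gam_fibfin Gam_conv_closed)
    also have "\<dots> = szero" using S h by (simp add: sadd_sneg Gam_sections)
    finally show ?thesis .
  qed
  then have u: "u \<in> ?I" using f tf by (simp add: u_def Gam_sadd Gam_sneg)
  show "f \<in> diag"
  \<comment> \<open>Properness of the annihilator requires an element that acts nontrivially: the
    characteristic section of a set of units around x, whose square still has value one at x.
    Without units \<open>R\<close> is zero.\<close>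
  proof (cases "units G = {}")
    case True
    then have "arrows G = {}" using src_units by blast
    then have "f = szero" using S by (intro sections_eqI) auto
    then show ?thesis using diag_szero by simp
  next
    case False
    then obtain x where x: "x \<in> units G" by blast
    obtain K where K: "K \<in> cob" "K \<subseteq> units G" "x \<in> K"
      using unit_in_cob [OF x] by blast
    have i: "indic K \<in> diag" using diag_indic K by simp
    have "tot (indic K \<star> indic K) x = eone \<O> x"
      using tot_diag_id [OF diag_conv_diag [OF i i]] diag_conv_unit [OF i i x] x K by simp
    then have "tot (indic K \<star> indic K) \<noteq> szero" using x by (metis eone_nonzero(1) szero_apply tgt_unit units_arrows)
    then have "?I \<noteq> Gam" using diag_Gam [OF i] by blast
    then have "u = szero" using I u by blast
    have "f = tot f"
    proof -
      have "sadd (sneg (tot f)) f = szero" using \<open>u = szero\<close> S by (simp add: u_def sadd_comm)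
      then have "f = sneg (sneg (tot f))" using S by (intro sadd_eq_szero) auto
      moreover have "tot f = sneg (sneg (tot f))"
        using S by (intro sadd_eq_szero) (auto simp: sadd_sneg sadd_comm [of "sneg (tot f)"])
      ultimately show ?thesis by simp
    qed
    then show ?thesis using tf(1) by simp
  qed
qed

section \<open>Commutation with the diagonal\<close>

lemma units_sheaf_ker: "units G \<subseteq> sheaf_ker G \<O>"
  by (auto simp: sheaf_ker_def Iso_def)

lemma supp_diag_units: "f \<in> diag \<Longrightarrow> supp G \<O> f \<subseteq> units G"
  using diag_outside by (auto simp: supp_def)

text \<open>Where \<open>f\<close> is nonzero, its value cancels from the two products, so every
  diagonal \<open>a\<close> has at the range of \<gamma> the transport of its value at the source.
  Characteristic sections then force range and source to coincide, and sections through arbitrary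
  stalk elements force the action to be trivial.\<close>

lemma commutes_with_diag_iff:
  assumes f: "f \<in> Gam"
  shows "(\<forall>a\<in>diag. a \<star> f = f \<star> a) \<longleftrightarrow> supp G \<O> f \<subseteq> sheaf_ker G \<O>"
proof
  note S = Gam_sections [OF f]
  assume comm: "\<forall>a\<in>diag. a \<star> f = f \<star> a"
  show "supp G \<O> f \<subseteq> sheaf_ker G \<O>"
  proof
    fix \<gamma> assume "\<gamma> \<in> supp G \<O> f"
    then have \<gamma>: "\<gamma> \<in> arrows G" "f \<gamma> \<noteq> ezero \<O> (tgt G \<gamma>)" by (auto simp: supp_def)
    have eq: "a (tgt G \<gamma>) = act \<O> \<gamma> (a (src G \<gamma>))" if a: "a \<in> diag" for a
    proof -
      have fibs: "a (tgt G \<gamma>) \<in> fib (tgt G \<gamma>)" "act \<O> \<gamma> (a (src G \<gamma>)) \<in> fib (tgt G \<gamma>)" "f \<gamma> \<in> fib (tgt G \<gamma>)"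
        using \<gamma>(1) diag_fib [OF a] S by auto
      have "(a \<star> f) \<gamma> = (f \<star> a) \<gamma>" using comm a by simp
      then have "emul \<O> (f \<gamma>) (a (tgt G \<gamma>)) = emul \<O> (f \<gamma>) (act \<O> \<gamma> (a (src G \<gamma>)))"
        using diag_conv [OF a S \<gamma>(1)] conv_diag [OF a S \<gamma>(1)] emul_comm [OF fibs(3,1)] by simp
      then show ?thesis using emul_cancel [OF fibs(3) \<gamma>(2) fibs(1,2)] by simp
    qed
    have iso: "src G \<gamma> = tgt G \<gamma>"
    proof (rule ccontr)
      assume "src G \<gamma> \<noteq> tgt G \<gamma>"
      then obtain W where W: "openin (unit_space G) W" "tgt G \<gamma> \<in> W" "src G \<gamma> \<notin> W"
        using Hausdorff_units \<gamma>(1) unfolding Hausdorff_space_def disjnt_def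
        by (metis disjoint_iff src_units tgt_units topspace_unit_space)
      then obtain K where K: "K \<in> cob" "K \<subseteq> units G" "tgt G \<gamma> \<in> K" "K \<subseteq> W"
        using unit_cob_nhd [of W "tgt G \<gamma>"] \<gamma>(1) by (auto simp: openin_unit_space)
      have "indic K (tgt G \<gamma>) = act \<O> \<gamma> (indic K (src G \<gamma>))"
        using eq diag_indic K by blast
      moreover have "src G \<gamma> \<notin> K" using K W by blast
      ultimately show False using K(3) \<gamma>(1) by simp
    qed
    have "act \<O> \<gamma> e = e" if e: "e \<in> fib (src G \<gamma>)" for e
    proof -
      obtain K a where "bsec K a" "K \<subseteq> units G" "a (src G \<gamma>) = e"
        using bsec_through [OF e open_units fib_units [OF e]] by metis
      then show ?thesis using eq [OF bsec_diag] iso by metis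
    qed
    then show "\<gamma> \<in> sheaf_ker G \<O>" using \<gamma>(1) iso by (simp add: sheaf_ker_def Iso_def)
  qed
next
  note S = Gam_sections [OF f]
  assume ker: "supp G \<O> f \<subseteq> sheaf_ker G \<O>"
  show "\<forall>a\<in>diag. a \<star> f = f \<star> a"
  proof
    fix a assume a: "a \<in> diag"
    show "a \<star> f = f \<star> a"
    proof (rule sections_eqI)
      fix \<gamma> assume \<gamma>: "\<gamma> \<in> arrows G"
      have fibs: "a (tgt G \<gamma>) \<in> fib (tgt G \<gamma>)" "act \<O> \<gamma> (a (src G \<gamma>)) \<in> fib (tgt G \<gamma>)" "f \<gamma> \<in> fib (tgt G \<gamma>)"
        using \<gamma> diag_fib [OF a] S by auto
      show "(a \<star> f) \<gamma> = (f \<star> a) \<gamma>"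
      proof (cases "f \<gamma> = ezero \<O> (tgt G \<gamma>)")
        case True
        then show ?thesis using fibs diag_conv [OF a S \<gamma>] conv_diag [OF a S \<gamma>] by simp
      next
        case False
        then have "\<gamma> \<in> sheaf_ker G \<O>" using ker \<gamma> by (auto simp: supp_def)
        then have "src G \<gamma> = tgt G \<gamma>" "act \<O> \<gamma> (a (src G \<gamma>)) = a (src G \<gamma>)"
          using diag_fib [OF a] \<gamma> by (auto simp: sheaf_ker_def Iso_def)
        then show ?thesis
          using diag_conv [OF a S \<gamma>] conv_diag [OF a S \<gamma>] emul_comm [OF fibs(1,3)] by simp
      qed
    qed (use S a diag_sections in auto)
  qed
qed

section \<open>From simplicity of the diagonal to simplicity of the ring\<close>

lemma ker_condD: "ker_cond \<Longrightarrow> f \<in> Gam \<Longrightarrow> supp G \<O> f \<subseteq> sheaf_ker G \<O> \<Longrightarrow> f \<in> diag"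
  by (simp add: ker_cond_def)

text \<open>Right translation by the inverse of \<open>U\<close> moves the value at \<gamma>
  unchanged to the unit at its range, because the action of \<gamma> is applied only to a one. So an
  element nonzero at \<gamma> has a nonzero translate.\<close>

lemma Gam_shift_to_unit:
  assumes f: "f \<in> Gam" and U: "U \<in> cob" and \<gamma>: "\<gamma> \<in> U"
  shows "(f \<star> indic (ginv G ` U)) (tgt G \<gamma>) = f \<gamma>"
proof -
  have g: "\<gamma> \<in> arrows G" using cob_arrows [OF U] \<gamma> by blast
  have "(f \<star> indic (ginv G ` U)) (tgt G \<gamma>) = emul \<O> (f (tgt G \<gamma> \<cdot> ginv G (ginv G \<gamma>)))
     (act \<O> (tgt G \<gamma> \<cdot> ginv G (ginv G \<gamma>)) (indic (ginv G ` U) (ginv G \<gamma>)))"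
    using \<gamma> g by (intro conv_bsec_right [OF Gam_sections [OF f] bsec_indic [OF cob_ginv [OF U]]]) auto
  then show ?thesis
    using g \<gamma> sections_fib [OF Gam_sections [OF f] g] by simp
qed

lemma bis_mult_ginv_units:
  assumes "U \<in> cob"
  shows "bis_mult U (ginv G ` U) \<subseteq> units G"
proof
  fix \<delta> assume "\<delta> \<in> bis_mult U (ginv G ` U)"
  then obtain \<beta> \<gamma> where *: "\<delta> = \<beta> \<cdot> ginv G \<gamma>" "\<beta> \<in> U" "\<gamma> \<in> U" "src G \<beta> = tgt G (ginv G \<gamma>)"
    unfolding bis_mult_def by blast
  have a: "\<beta> \<in> arrows G" "\<gamma> \<in> arrows G" using * cob_arrows [OF assms] by auto
  then have "\<beta> = \<gamma>" using * bisectionD(2) [OF cob_bisection [OF assms] *(2,3)] by simp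
  then show "\<delta> \<in> units G" using * a by simp
qed

text \<open>Take a nonzero element of the ideal that is a sum of as few bisection sections as possible,
  translated so that one summand is diagonal. Its commutator with a diagonal element is a
  shorter sum in the ideal, hence zero.\<close>
lemma gideal_meets_diag:
  assumes ker: ker_cond and I: "gideal I" and nz: "I \<noteq> {szero}"
  obtains f where "f \<in> I" "f \<in> diag" "f \<noteq> szero"
proof -
  have IG: "I \<subseteq> Gam" "add_closed I" "\<And>a f. a \<in> Gam \<Longrightarrow> f \<in> I \<Longrightarrow> a \<star> f \<in> I \<and> f \<star> a \<in> I"
    using I by (auto simp: gideal_def)
  note IC = add_closedD [OF IG(2)]
  define P where "P n \<longleftrightarrow> (\<exists>f\<in>I. f \<noteq> szero \<and> bsum (arrows G) n f)" for n
  obtain f0 where "f0 \<in> I" "f0 \<noteq> szero" using nz IC(1) by blast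
  then have "\<exists>n. P n" using IG(1) unfolding P_def Gamma_c_on_iff by (metis Gamma_c_on_iff subsetD)
  then obtain n where n: "P n" and least: "\<And>m. m < n \<Longrightarrow> \<not> P m"
    using exists_least_iff [of P] by blast
  obtain f where f: "f \<in> I" "f \<noteq> szero" "bsum (arrows G) n f" using n by (auto simp: P_def)
  have fG: "f \<in> Gam" using f IG by blast
  have "\<exists>\<gamma>\<in>arrows G. f \<gamma> \<noteq> ezero \<O> (tgt G \<gamma>)"
  proof (rule ccontr)
    assume "\<not> ?thesis"
    then have "f = szero" using Gam_sections [OF fG] by (intro sections_eqI) auto
    then show False using f by simp
  qed
  then obtain \<gamma> where \<gamma>: "\<gamma> \<in> arrows G" "f \<gamma> \<noteq> ezero \<O> (tgt G \<gamma>)" by blast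
  obtain U g h m where g: "bsec U g" "g \<gamma> \<noteq> ezero \<O> (tgt G \<gamma>)" and n_eq: "n = Suc m"
    and h: "bsum (arrows G) m h" and f_eq: "f = sadd g h"
    using bsum_pick [OF f(3) \<gamma>] by blast
  have U: "U \<in> cob" "\<gamma> \<in> U" using bsecD(2) [OF g(1)] bsecD(4) [OF g(1) \<gamma>(1)] g(2) by blast+
  have gG: "g \<in> Gam" "h \<in> Gam" using bsec_Gam [OF g(1)] h Gamma_c_on_iff by auto
  define e where "e = indic (ginv G ` U)"
  have e: "bsec (ginv G ` U) e" "e \<in> Gam"
    unfolding e_def using bsec_indic [OF cob_ginv [OF U(1)]] bsec_Gam by auto
  define f1 where "f1 = f \<star> e"
  define g1 where "g1 = g \<star> e"
  define h1 where "h1 = h \<star> e"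
  have f1_eq: "f1 = sadd g1 h1"
    using gG e by (simp add: f1_def g1_def h1_def f_eq Gam_conv_sadd_left)
  have f1: "f1 \<in> I" "f1 \<in> Gam" using IG(3) [OF e(2) f(1)] IG(1) by (auto simp: f1_def)
  have g1: "g1 \<in> diag"
    unfolding g1_def by (rule bsec_diag [OF bsec_conv [OF g(1) e(1)] bis_mult_ginv_units [OF U(1)]])
  have h1: "h1 \<in> Gam" unfolding h1_def using gG e Gam_conv_closed by blast
  have f1_nz: "f1 \<noteq> szero"
  proof
    assume "f1 = szero"
    then have "f1 (tgt G \<gamma>) = ezero \<O> (tgt G \<gamma>)" using \<gamma>(1) by simp
    then show False
      using Gam_shift_to_unit [OF fG U] \<gamma>(2) by (simp add: f1_def e_def)
  qed
  \<comment> \<open>Translation does not lengthen the remainder, so \<open>f1\<close> is still a sum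
    of \<open>n\<close> generators, now with a diagonal one among them.\<close>
  have h1_sum: "bsum (arrows G) m h1"
    unfolding h1_def
  proof (rule bsum_map [OF h, of "\<lambda>k. k \<star> e"])
    show "\<exists>W\<subseteq>arrows G. bsec W (k \<star> e)" if "bsec V k" for V k
      using bsec_conv [OF that e(1)] bsecD(2) cob_arrows by blast
    show "sadd k l \<star> e = sadd (k \<star> e) (l \<star> e)" if "k \<in> Gam" "l \<in> Gam" for k l
      using that e by (simp add: Gam_conv_sadd_left)
  qed (use e Gam_sections in auto)
  have "a \<star> f1 = f1 \<star> a" if a: "a \<in> diag" for a
  proof -
    have aG: "a \<in> Gam" using a by (rule diag_Gam)
    note S = Gam_sections [OF aG] Gam_sections [OF f1(2)] Gam_sections [OF h1] diag_sections [OF g1]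
    \<comment> \<open>The commutator with \<open>a\<close>. It kills the diagonal \<open>g1\<close>
      and sends each generator in \<open>h1\<close> to a generator on the same bisection, so
      minimality of \<open>n\<close> applies to \<open>T f1\<close>.\<close>
    define T where "T k = sadd (a \<star> k) (sneg (k \<star> a))" for k
    have T_add: "T (sadd k l) = sadd (T k) (T l)" if "k \<in> Gam" "l \<in> Gam" for k l
    proof (rule sections_eqI)
      fix \<delta> assume \<delta>: "\<delta> \<in> arrows G"
      note Skl = Gam_sections [OF that(1)] Gam_sections [OF that(2)]
      interpret R: ring "stalk \<O> (tgt G \<delta>)" using ring_stalk \<delta> by simp
      have fibs: "(a \<star> k) \<delta> \<in> fib (tgt G \<delta>)" "(a \<star> l) \<delta> \<in> fib (tgt G \<delta>)" "(k \<star> a) \<delta> \<in> fib (tgt G \<delta>)" "(l \<star> a) \<delta> \<in> fib (tgt G \<delta>)"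
        using Skl S \<delta> by auto
      have neg: "eneg z = \<ominus>\<^bsub>stalk \<O> (tgt G \<delta>)\<^esub> z" if "z \<in> fib (tgt G \<delta>)" for z
        using that by (simp add: eneg_def proj_fib)
      show "T (sadd k l) \<delta> = sadd (T k) (T l) \<delta>"
        using that aG \<delta> fibs R.minus_add [of "(k \<star> a) \<delta>" "(l \<star> a) \<delta>"] R.a_ac [of "(a \<star> k) \<delta>"] R.a_closed R.a_inv_closed
          R.add.m_assoc R.add.m_comm R.add.m_lcomm
        by (simp add: T_def Gam_conv_sadd_right Gam_conv_sadd_left neg)
    qed (use that aG Gam_sections in \<open>auto simp: T_def\<close>)
    have "T g1 = szero"
      using diag_comm [OF field_stalk a g1] S by (simp add: T_def sadd_sneg)
    moreover have "T h1 \<in> sections" using S by (simp add: T_def)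
    ultimately have Tf1: "T f1 = T h1"
      using T_add [of g1 h1] diag_Gam [OF g1] h1 f1_eq by simp
    have "bsum (arrows G) m (T h1)"
    proof (rule bsum_map [OF h1_sum])
      show "\<exists>W\<subseteq>arrows G. bsec W (T k)" if "bsec V k" for V k
        using bsec_diag_conv [OF that a] bsecD(2) [OF that] cob_arrows
        by (intro exI [of _ V]) (auto simp: T_def intro: bsec_sadd bsec_sneg)
      show "T szero = szero" using S sadd_sneg [OF szero_closed] by (simp add: T_def)
    qed (use T_add in auto)
    moreover have "T f1 \<in> I" unfolding T_def using IG(3) [OF aG f1(1)] IC by blast
    ultimately have "T f1 = szero"
      using least [of m] n_eq Tf1 unfolding P_def by auto
    then have "sneg (f1 \<star> a) = sneg (a \<star> f1)"
      unfolding T_def using S by (intro sadd_eq_szero) auto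
    moreover have "k = sneg (sneg k)" if "k \<in> sections" for k
      using that by (intro sadd_eq_szero) (auto simp: sadd_sneg sadd_comm [of "sneg k"])
    ultimately show "a \<star> f1 = f1 \<star> a" using S by (metis conv_closed)
  qed
  then have "f1 \<in> diag"
    using ker_condD [OF ker f1(2)] commutes_with_diag_iff [OF f1(2)] by blast
  then show thesis using that f1(1) f1_nz by blast
qed

text \<open>After \<open>gideal_meets_diag\<close>, simplicity of the diagonal puts all of
  \<open>diag\<close> into the ideal. Diagonal characteristic sections act as left units on the
  generators, so all of \<open>R\<close> follows.\<close>

lemma ker_cond_imp_simple:
  assumes ker: ker_cond and simple: "bisection_simple G \<O>"
  shows "rng_simple (Gamma_c G \<O>)"
  unfolding rng_simple_iff
proof (intro allI impI)
  fix I assume I: "gideal I"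
  have IG: "I \<subseteq> Gam" "add_closed I" "\<And>a f. a \<in> Gam \<Longrightarrow> f \<in> I \<Longrightarrow> a \<star> f \<in> I \<and> f \<star> a \<in> I"
    using I by (auto simp: gideal_def)
  show "I = {szero} \<or> I = Gam"
  proof (cases "I = {szero}")
    case False
    obtain f where f: "f \<in> I" "f \<in> diag" "f \<noteq> szero"
      using gideal_meets_diag [OF ker I False] .
    have "I \<inter> diag = {szero} \<or> I \<inter> diag = diag"
      using simple gideal_inv_diag_ideal [OF I] unfolding bisection_simple_iff by blast
    then have diag_I: "diag \<subseteq> I" using f by blast
    have "k \<in> I" if "k \<in> Gam" for k
      using that
    proof (induction rule: Gamma_c_on_induct)
      case zero
      then show ?case using IG(2) add_closedD by blast
    next
      case (add U k l)
      have K: "tgt G ` U \<in> cob" "tgt G ` U \<subseteq> units G"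
        using bsecD(2) [OF add(1)] cob_tgt cob_tgt_units by auto
      note k = bsecD [OF add(1)]
      have "indic (tgt G ` U) \<star> k = k"
      proof (rule sections_eqI)
        fix \<gamma> assume \<gamma>: "\<gamma> \<in> arrows G"
        show "(indic (tgt G ` U) \<star> k) \<gamma> = k \<gamma>"
          using diag_conv [OF diag_indic [OF K] k(1) \<gamma>] \<gamma> k(4) [OF \<gamma>] sections_fib [OF k(1) \<gamma>]
          by (cases "\<gamma> \<in> U") auto
      qed (use k diag_sections diag_indic [OF K] in auto)
      then have "k \<in> I"
        using IG(3) [OF bsec_Gam [OF add(1)]] diag_I diag_indic [OF K] by (metis subsetD)
      then show ?case using add(4) add_closedD(2) [OF IG(2)] by blast
    qed
    then show ?thesis using IG(1) by blast
  qed simp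
qed

section \<open>Maximal commutativity and the kernel conditions\<close>

lemma commutative_subrng_Gamma_c:
  "commutative_subrng S (Gamma_c G \<O>) \<longleftrightarrow>
     S \<subseteq> Gam \<and> add_closed S \<and> (\<forall>f\<in>S. \<forall>g\<in>S. f \<star> g \<in> S \<and> f \<star> g = g \<star> f)"
  by (simp add: commutative_subrng_def additive_subgroup_Gamma_c)

lemma maximal_commutative_iff:
  "maximal_commutative_subrng diag (Gamma_c G \<O>) \<longleftrightarrow> ker_cond"
proof
  assume max: "maximal_commutative_subrng diag (Gamma_c G \<O>)"
  show ker_cond
    unfolding ker_cond_def
  proof (intro ballI impI)
    fix f assume f: "f \<in> Gam" "supp G \<O> f \<subseteq> sheaf_ker G \<O>"
    then have fa: "a \<star> f = f \<star> a" if "a \<in> diag" for a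
      using commutes_with_diag_iff that by blast
    \<comment> \<open>\<open>Z\<close> is the centralizer of \<open>diag\<close> and
      \<open>f\<close>, and \<open>T\<close> the centralizer of \<open>Z\<close>. Since
      \<open>f\<close> and \<open>diag\<close> commute with each other, they lie in
      \<open>Z\<close>; hence \<open>T\<close> lies in \<open>Z\<close>, is commutative, and
      contains \<open>diag\<close> and \<open>f\<close>. This replaces a description of the subring
      that they generate.\<close>
    define Z where "Z = {h \<in> Gam. h \<star> f = f \<star> h \<and> (\<forall>a\<in>diag. h \<star> a = a \<star> h)}"
    define T where "T = {g \<in> Gam. \<forall>h\<in>Z. g \<star> h = h \<star> g}"
    have dZ: "diag \<subseteq> Z" using fa diag_comm [OF field_stalk] diag_Gam by (auto simp: Z_def)
    have fZ: "f \<in> Z" using f fa by (auto simp: Z_def)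
    have TZ: "T \<subseteq> Z" using dZ fZ unfolding T_def Z_def by blast
    have fT: "f \<in> T" and dT: "diag \<subseteq> T" using f diag_Gam by (auto simp: T_def Z_def)
    have ZG: "h \<in> Gam" if "h \<in> Z" for h using that by (simp add: Z_def)
    have neg: "sneg g \<star> h = sneg (g \<star> h)" "h \<star> sneg g = sneg (h \<star> g)" if "g \<in> Gam" "h \<in> Gam" for g h
    proof -
      note S = Gam_sections [OF that(1)] Gam_sections [OF that(2)]
      have "sadd (g \<star> h) (sneg g \<star> h) = sadd g (sneg g) \<star> h" "sadd (h \<star> g) (h \<star> sneg g) = h \<star> sadd g (sneg g)"
        using that by (simp_all only: Gam_conv_sadd_left Gam_conv_sadd_right Gam_sneg)
      then show "sneg g \<star> h = sneg (g \<star> h)" "h \<star> sneg g = sneg (h \<star> g)"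
        using S by (auto intro!: sadd_eq_szero simp: sadd_sneg)
    qed
    have "add_closed T"
      unfolding add_closed_def
    proof (intro conjI ballI)
      show "T \<subseteq> sections" using Gam_sections by (auto simp: T_def)
      show "szero \<in> T" using ZG Gam_sections by (auto simp: T_def Gam_szero)
      show "sadd g g' \<in> T" if "g \<in> T" "g' \<in> T" for g g'
        using that ZG by (auto simp: T_def Gam_sadd Gam_conv_sadd_left Gam_conv_sadd_right)
      show "sneg g \<in> T" if "g \<in> T" for g
        using that ZG by (auto simp: T_def Gam_sneg neg)
    qed
    moreover have "g \<star> g' \<in> T" if "g \<in> T" "g' \<in> T" for g g'
    proof -
      have G: "g \<in> Gam" "g' \<in> Gam" using that by (auto simp: T_def)
      have "g \<star> g' \<star> h = h \<star> (g \<star> g')" if h: "h \<in> Z" for h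
      proof -
        have c: "g \<star> h = h \<star> g" "g' \<star> h = h \<star> g'" using \<open>g \<in> T\<close> \<open>g' \<in> T\<close> h by (auto simp: T_def)
        have "g \<star> g' \<star> h = g \<star> h \<star> g'"
          using Gam_conv_assoc [OF G ZG [OF h]] Gam_conv_assoc [OF G(1) ZG [OF h] G(2)] by (simp add: c(2))
        then show ?thesis
          using Gam_conv_assoc [OF ZG [OF h] G] by (simp add: c(1))
      qed
      then show ?thesis using G Gam_conv_closed by (simp add: T_def)
    qed
    moreover have "g \<star> g' = g' \<star> g" if "g \<in> T" "g' \<in> T" for g g'
      using that TZ by (auto simp: T_def)
    moreover have "T \<subseteq> Gam" by (auto simp: T_def)
    ultimately have "commutative_subrng T (Gamma_c G \<O>)"
      unfolding commutative_subrng_Gamma_c by blast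
    then have "T = diag"
      using max dT unfolding maximal_commutative_subrng_def by blast
    then show "f \<in> diag" using fT by simp
  qed
next
  assume ker: ker_cond
  have "commutative_subrng diag (Gamma_c G \<O>)"
    unfolding commutative_subrng_Gamma_c using diag_Gam add_closed_diag diag_conv_diag diag_comm [OF field_stalk] by blast
  moreover have "T = diag" if T: "commutative_subrng T (Gamma_c G \<O>)" "diag \<subseteq> T" for T
  proof -
    have "f \<in> diag" if f: "f \<in> T" for f
    proof -
      have "f \<in> Gam" "\<forall>a\<in>diag. a \<star> f = f \<star> a" using T f unfolding commutative_subrng_Gamma_c by blast+
      then show ?thesis using ker_condD [OF ker] commutes_with_diag_iff by blast
    qed
    then show ?thesis using T(2) by blast
  qed
  ultimately show "maximal_commutative_subrng diag (Gamma_c G \<O>)"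
    unfolding maximal_commutative_subrng_def by blast
qed

text \<open>An arrow interior to the kernel has a compact open bisection around it inside the
  kernel; its characteristic section is diagonal by \<open>ker_cond\<close>, so the arrow is a unit.
  Conversely, once the interior is the unit space, the second clause says that \<open>diag\<close>
  is exactly the set of elements supported in the kernel.\<close>

lemma ker_cond_iff:
  "ker_cond \<longleftrightarrow> gtop G interior_of sheaf_ker G \<O> = units G \<and>
     Gamma_c_on G \<O> (gtop G interior_of sheaf_ker G \<O>) = {f \<in> Gam. supp G \<O> f \<subseteq> sheaf_ker G \<O>}"
proof
  assume ker: ker_cond
  have "gtop G interior_of sheaf_ker G \<O> \<subseteq> units G"
  proof
    fix \<gamma> assume "\<gamma> \<in> gtop G interior_of sheaf_ker G \<O>"
    then obtain U where U: "U \<in> cob" "\<gamma> \<in> U" "U \<subseteq> gtop G interior_of sheaf_ker G \<O>"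
      by (rule cob_nhd [OF openin_interior_of])
    have "supp G \<O> (indic U) \<subseteq> U"
      by (auto simp: supp_def split: if_splits)
    then have "supp G \<O> (indic U) \<subseteq> sheaf_ker G \<O>"
      using U(3) interior_of_subset [of "gtop G" "sheaf_ker G \<O>"] by (meson order_trans)
    then have "indic U \<in> diag" using ker_condD [OF ker Gam_indic [OF U(1)]] by blast
    moreover have g: "\<gamma> \<in> arrows G" using U cob_arrows by blast
    moreover have "indic U \<gamma> \<noteq> ezero \<O> (tgt G \<gamma>)" using g U(2) by simp
    ultimately show "\<gamma> \<in> units G" using diag_outside by blast
  qed
  moreover have "units G \<subseteq> gtop G interior_of sheaf_ker G \<O>"
    by (rule interior_of_maximal [OF units_sheaf_ker open_units])
  ultimately have eq: "gtop G interior_of sheaf_ker G \<O> = units G" by blast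
  moreover have "diag = {f \<in> Gam. supp G \<O> f \<subseteq> sheaf_ker G \<O>}"
    using ker_condD [OF ker] diag_Gam supp_diag_units units_sheaf_ker by blast
  ultimately show "gtop G interior_of sheaf_ker G \<O> = units G \<and>
     Gamma_c_on G \<O> (gtop G interior_of sheaf_ker G \<O>) = {f \<in> Gam. supp G \<O> f \<subseteq> sheaf_ker G \<O>}"
    by (simp only: diag_eq_Gamma_c_on [symmetric])
next
  assume *: "gtop G interior_of sheaf_ker G \<O> = units G \<and>
     Gamma_c_on G \<O> (gtop G interior_of sheaf_ker G \<O>) = {f \<in> Gam. supp G \<O> f \<subseteq> sheaf_ker G \<O>}"
  have "diag = {f \<in> Gam. supp G \<O> f \<subseteq> sheaf_ker G \<O>}"
    using conjunct2 [OF *] unfolding conjunct1 [OF *] diag_eq_Gamma_c_on .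
  then show ker_cond by (auto simp: ker_cond_def)
qed

section \<open>Hausdorff groupoids\<close>

lemma Hausdorff_bsec_continuous:
  assumes H: "Hausdorff_space (gtop G)" and f: "bsec U f"
  shows "continuous_map (gtop G) (etop \<O>) f"
proof (rule continuous_map_locallyI)
  note F = bsecD [OF f]
  have top: "topspace (gtop G) = arrows G" by (simp add: arrows_def)
  \<comment> \<open>Hausdorffness enters here: a compact bisection is closed, so the zero section
    takes over on an open set and no jump occurs.\<close>
  have "closedin (gtop G) U" using compactin_imp_closedin [OF H cob_compact [OF F(2)]] .
  then have C: "openin (gtop G) (arrows G - U)" by (simp add: closedin_def top)
  have "continuous_map (subtopology (gtop G) (arrows G - U)) (etop \<O>) (\<lambda>\<gamma>. ezero \<O> (tgt G \<gamma>))"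
    by (intro continuous_map_ezero continuous_map_tgt continuous_map_id_subtopology) (auto simp: top)
  then have 0: "continuous_map (subtopology (gtop G) (arrows G - U)) (etop \<O>) f"
    by (rule continuous_map_eq) (use F(4) in auto)
  fix \<gamma> assume \<gamma>: "\<gamma> \<in> topspace (gtop G)"
  show "\<exists>V. openin (gtop G) V \<and> \<gamma> \<in> V \<and> continuous_map (subtopology (gtop G) V) (etop \<O>) f"
  proof (cases "\<gamma> \<in> U")
    case True
    then show ?thesis using F(3) cob_open [OF F(2)] by blast
  next
    case False
    then show ?thesis using C 0 \<gamma> top by blast
  qed
qed

lemma Hausdorff_Gam_continuous:
  assumes H: "Hausdorff_space (gtop G)" and f: "f \<in> Gam"
  shows "continuous_map (gtop G) (etop \<O>) f"
  using f
proof (induction rule: Gamma_c_on_induct)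
  case zero
  have "bsec {} szero" using empty_cob by (simp add: bsec_def)
  then show ?case by (rule Hausdorff_bsec_continuous [OF H])
next
  case (add U f g)
  have top: "topspace (gtop G) = arrows G" by (simp add: arrows_def)
  have "continuous_map (gtop G) (etop \<O>) (\<lambda>\<gamma>. eadd \<O> (f \<gamma>) (g \<gamma>))"
    by (intro continuous_map_eadd Hausdorff_bsec_continuous [OF H add(1)] add(4))
      (simp add: top proj_sections bsecD(1) [OF add(1)] Gam_sections [OF add(3)])
  then show ?case by (rule continuous_map_eq) (simp add: top)
qed

lemma Gam_compact_support:
  assumes "f \<in> Gam"
  obtains C where "compactin (gtop G) C" "\<And>\<gamma>. \<gamma> \<in> arrows G \<Longrightarrow> \<gamma> \<notin> C \<Longrightarrow> f \<gamma> = ezero \<O> (tgt G \<gamma>)"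
proof -
  have "\<exists>C. compactin (gtop G) C \<and> (\<forall>\<gamma>\<in>arrows G. \<gamma> \<notin> C \<longrightarrow> f \<gamma> = ezero \<O> (tgt G \<gamma>))"
    using assms
  proof (induction rule: Gamma_c_on_induct)
    case zero
    then show ?case by (intro exI [of _ "{}"]) simp
  next
    case (add U f g)
    then obtain C where "compactin (gtop G) C" "\<forall>\<gamma>\<in>arrows G. \<gamma> \<notin> C \<longrightarrow> g \<gamma> = ezero \<O> (tgt G \<gamma>)" by blast
    then show ?case
      using bsecD [OF add(1)] cob_compact by (intro exI [of _ "U \<union> C"]) (auto intro: compactin_Un)
  qed
  then show thesis using that by blast
qed

text \<open>The open support lies in the interior of the kernel, hence among the units. It is also
  closed and contained in a compact set, hence compact; over a compact open set of units containing
  it, the element is a diagonal generator.\<close>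

lemma Hausdorff_imp_ker_cond:
  assumes H: "Hausdorff_space (gtop G)" and int: "gtop G interior_of sheaf_ker G \<O> = units G"
  shows ker_cond
  unfolding ker_cond_def
proof (intro ballI impI)
  fix f assume f: "f \<in> Gam" and ker: "supp G \<O> f \<subseteq> sheaf_ker G \<O>"
  have top: "topspace (gtop G) = arrows G" by (simp add: arrows_def)
  note S = Gam_sections [OF f]
  have c: "continuous_map (gtop G) (etop \<O>) f" using Hausdorff_Gam_continuous [OF H f] .
  have supp: "supp G \<O> f = {\<gamma> \<in> topspace (gtop G). f \<gamma> \<noteq> ezero \<O> (proj \<O> (f \<gamma>))}"
    using proj_sections [OF S] by (simp add: supp_def top cong: conj_cong)
  have "openin (gtop G) (supp G \<O> f)" unfolding supp using open_nonzeros [OF c] .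
  then have su: "supp G \<O> f \<subseteq> units G" using interior_of_maximal [OF ker] int by blast
  have cl: "closedin (gtop G) (supp G \<O> f)"
  proof -
    have "supp G \<O> f = topspace (gtop G) - {\<gamma> \<in> topspace (gtop G). f \<gamma> = ezero \<O> (proj \<O> (f \<gamma>))}"
      unfolding supp by blast
    then show ?thesis using open_zeros [OF c] by (simp add: openin_closedin_eq)
  qed
  obtain C where C: "compactin (gtop G) C" "\<And>\<gamma>. \<gamma> \<in> arrows G \<Longrightarrow> \<gamma> \<notin> C \<Longrightarrow> f \<gamma> = ezero \<O> (tgt G \<gamma>)"
    using Gam_compact_support [OF f] by blast
  have "supp G \<O> f = supp G \<O> f \<inter> C" using C(2) by (auto simp: supp_def)
  then have "compactin (gtop G) (supp G \<O> f)" using closed_Int_compactin [OF cl C(1)] by simp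
  then obtain K where K: "K \<in> cob" "K \<subseteq> units G" "supp G \<O> f \<subseteq> K"
    using compact_units_cob_cover su by blast
  have "continuous_map (unit_space G) (etop \<O>) f"
    unfolding unit_space_def by (rule continuous_map_from_subtopology [OF c])
  then have "bsec K f"
    using K S unfolding bsec_units_iff [OF K(2,1)] by (auto simp: supp_def)
  then show "f \<in> diag" using K(2) by (rule bsec_diag)
qed

text \<open>Simplicity gives minimality and \<open>ker_cond\<close>; minimality is interchangeable
  with simplicity of the diagonal, and \<open>ker_cond\<close> with maximal commutativity; together
  these give simplicity back.\<close>

lemma simplicity:
  "(rng_simple (Gamma_c G \<O>) \<longleftrightarrow>
      bisection_simple G \<O> \<and> maximal_commutative_subrng diag (Gamma_c G \<O>)) \<and>
   (rng_simple (Gamma_c G \<O>) \<longleftrightarrow> minimal G \<and> ker_cond)"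
  using simple_imp_minimal simple_imp_ker_cond ker_cond_imp_simple minimal_imp_bisection_simple
    bisection_simple_imp_minimal maximal_commutative_iff by blast

end

theorem theorem4p32:
  fixes G :: "'g top_groupoid" and \<O> :: "('g, 'e) ring_sheaf"
  assumes "ample_groupoid G" and "sheaf_of_fields G \<O>"
  shows "(rng_simple (Gamma_c G \<O>) \<longleftrightarrow>
            bisection_simple G \<O> \<and>
            maximal_commutative_subrng
              (extend_by_zero G \<O> ` carrier (Gamma_c_units G \<O>)) (Gamma_c G \<O>)) \<and>
         (rng_simple (Gamma_c G \<O>) \<longleftrightarrow>
            minimal G \<and> gtop G interior_of sheaf_ker G \<O> = units G \<and>
            Gamma_c_on G \<O> (gtop G interior_of sheaf_ker G \<O>) =
              {f \<in> carrier (Gamma_c G \<O>). supp G \<O> f \<subseteq> sheaf_ker G \<O>}) \<and>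
         (Hausdorff_space (gtop G) \<longrightarrow>
            (rng_simple (Gamma_c G \<O>) \<longleftrightarrow>
               minimal G \<and> gtop G interior_of sheaf_ker G \<O> = units G))"
proof -
  interpret ample_field_sheaf G \<O>
    using assms by (simp add: ample_field_sheaf_def ample_ring_sheaf_def sheaf_of_fields_def)
  show ?thesis
    unfolding extend_image Gamma_c_simps(1)
    using simplicity ker_cond_iff Hausdorff_imp_ker_cond by blast
qed

end
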